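(* Let $\mathbb{K}$ be a field of characteristic zero, $\mathbb{A}$ an alphabet (a finite set), $F$ a finite non-empty set of forbidden words over $\mathbb{A}$, and $k$ the maximal length of words in $F$. (i) If $k=1$, let $m$ be the number of letters in $\mathbb{A}$ that do not belong to $F$. If $m=1$, denote the unique such letter by $t$; then $$Z(\mathbb{K} X_F)=Z_3(\mathbb{K} X_F) = \{ f(t) \mid f(x) \in \mathbb{K}[x],\ f(0)=0 \}.$$ If $m \geq 2$, then $Z(\mathbb{K} X_F)=Z_3(\mathbb{K} X_F) = 0$. (ii) If $k \geq 2$, let $X_F^{[k]}$ be the $k$-th block formal language. Then $Z(\mathbb{K} X_F^{[k]})$ is the direct sum of the centers of the algebras associated to the algebraically irreducible components of $X_F^{[k]}$. If $X_F^{[k]}$ is algebraically irreducible, then $$Z(\mathbb{K} X_F^{[k]}) = \operatorname{span}\{\text{words of } X_F^{[k]} \text{ that are two-sided-unextendable}\},$$ except if $B_k(X_F)$ contains only $n$ distinct words $\omega_1,\dots,\omega_n$ such that the words $\omega_i[1,k-1]$ ($1\le i\le n$) are also $n$ distinct words, $\omega_i[2,k] = \omega_{i+1}[1,k-1]$ for $i=1,\dots,n-1$, and $\omega_n[2,k] = \omega_1[1,k-1]$; in this case, $$Z(\mathbb{K} X_F^{[k]}) = \left\{ \sum_{i=1}^n f(W_i) \,\bigg|\, f(x) \in \mathbb{K}[x],\ f(0)=0 \right\},$$ where $W_i = \omega_i \cdots \omega_n \omega_1 \cdots \omega_{i-1}$ (a word over the alphabet $B_k(X_F)$), and this is isomorphic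 to the subalgebra of $\mathbb{K}[x]$ of polynomials with zero constant term. (iii) If $k \geq 2$, let $X_F^{[k]}$ be the $k$-th block formal language. Then $Z_3(\mathbb{K} X_F^{[k]})$ is the direct sum of the 3-centers of the algebras associated to the algebraically irreducible components of $X_F^{[k]}$. If $X_F^{[k]}$ is algebraically irreducible, then $$Z_3(\mathbb{K} X_F^{[k]}) = \operatorname{span}\{\text{words of } X_F^{[k]} \text{ that satisfy property } (\Delta)\},$$ except if $B_k(X_F)$ contains only one word, consisting of $k$ identical letters; in this case, $Z_3(\mathbb{K} X_F^{[k]}) = \mathbb{K} X_F^{[k]}$, which is (isomorphic to) the subalgebra of $\mathbb{K}[x]$ of polynomials with zero constant term.
   Context: Words. An alphabet is a finite set whose elements are called letters. All words are non-empty finite sequences of letters. For a word $\mu=a_1\cdots a_r$ and $1\le i\le j\le r$, $\mu[i,j]=a_i\cdots a_j$; these are the subwords of $\mu$, and a word contains its subwords. $\mathbb{A}^+$ is the free semigroup of all non-empty words over $\mathbb{A}$ under concatenation; a formal language is a subset $L\subseteq\mathbb{A}^+$, and $B_n(L)$ is the set of words of length $n$ in $L$. For a finite set $F$ of (forbidden) words over $\mathbb{A}$, $X_F$ is the set of words over $\mathbb{A}$ containing no word of $F$, called the formal language with respect to $F$. $\mathbb{K}X_F$ is the $\mathbb{K}$-algebra with basis $X_F$, where the product of words $a,b\in X_F$ is $ab$ if $ab\in X_F$ and $0$ otherwise. Block language. Let $k\ge2$ be the maximal length of words in $F$. Regard $B_k(X_F)$ as a new alphabet and let $T=\{xy\mid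 x,y\in B_k(X_F),\ x[2,k]\ne y[1,k-1]\}$, a set of words of length $2$ over $B_k(X_F)$. The $k$-th block formal language $X_F^{[k]}$ is the formal language with respect to the forbidden set $T$ over the alphabet $B_k(X_F)$. Algebraic irreducibility. On a language $X_F$ consider the partial binary operation of concatenation, defined for $u,v\in X_F$ when $uv\in X_F$. $X_F$ is algebraically irreducible if there do not exist at least two pairwise disjoint formal languages $X_{F_i}$ with respect to forbidden sets $F_i$ (possibly over different alphabets) and a bijection $X_F\to\bigcup_i X_{F_i}$ that preserves the binary operation where defined. If $X_F$ is not algebraically irreducible, it can be written as a union of at least two pairwise disjoint $X_{F_i}$, each algebraically irreducible; these are the algebraically irreducible components of $X_F$, with associated algebras $\mathbb{K}X_{F_i}$. Centers. $Z(A)$ is the center of $A$. With $St_3(x_1,x_2,x_3)=\sum_{\sigma\in S_3}\operatorname{sgn}(\sigma)x_{\sigma(1)}x_{\sigma(2)}x_{\sigma(3)}$, the 3-center $Z_3(A)$ is the set of $a\in A$ such that $St_3(a,b,c)=0$ for all $b,c\in A$. Word properties. A word $\omega$ of a language with respect to a forbidden set is two-sided-unextendable if for every letter $a$ of its alphabet neither $a\omega$ nor $\omega a$ belongs to the language. A word $\omega_1$ of $X_F^{[k]}$ (over the alphabet $B_k(X_F)$) satisfies property $(\Delta)$ if either there do not exist two distinct letters $\omega_2\ne\omega_3$ of $X_F^{[k]}$ (i.e. elements of $B_k(X_F)$) such that $\omega_{\sigma(1)}\omega_{\sigma(2)}\omega_{\sigma(3)}\ne0$ in $\mathbb{K}X_F^{[k]}$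 for at least one $\sigma\in S_3$ (here $\omega_1$ may equal $\omega_2$ or $\omega_3$), or $\omega_1=A^l$ for some $l\ge1$, where $B_k(X_F)$ is one of the following: (1) $\{A\}$ with $A$ a word of $k$ identical letters; (2) $\{A, A[1,k-1]b_1,\dots,A[1,k-1]b_s\}$ where $A$ consists of $k$ identical letters $a$ and $b_i\ne a$ for all $i$; (3) $\{A, d_1A[2,k],\dots,d_tA[2,k]\}$ where $A$ consists of $k$ identical letters $a$ and $d_i\ne a$ for all $i$. *)

theory Defs
  imports
    "HOL-Library.Poly_Mapping"
    "HOL-Library.Sublist"
    "HOL-Library.FuncSet"
    "HOL-Combinatorics.Permutations"
    "HOL-Computational_Algebra.Polynomial"
begin

section \<open>Formal languages with forbidden words\<close>

definition words :: "'a set \<Rightarrow> 'a list set" where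
  "words A = {w. w \<noteq> [] \<and> set w \<subseteq> A}"

text \<open>The subwords of a word are its contiguous factors, i.e. \<^const>\<open>sublist\<close>
  (not \<^const>\<open>subseq\<close>).\<close>

definition formal_lang :: "'a set \<Rightarrow> 'a list set \<Rightarrow> 'a list set" where
  "formal_lang A F = {w \<in> words A. \<forall>f\<in>F. \<not> sublist f w}"

definition is_formal_lang :: "'a list set \<Rightarrow> bool" where
  "is_formal_lang L \<longleftrightarrow> (\<exists>A F. finite A \<and> finite F \<and> F \<subseteq> words A \<and> L = formal_lang A F)"

definition words_of_length :: "nat \<Rightarrow> 'a list set \<Rightarrow> 'a list set" where
  "words_of_length n L = {w \<in> L. length w = n}"

definition max_length :: "'a list set \<Rightarrow> nat" where
  "max_length F = Max (length ` F)"


section \<open>The algebra of a language\<close>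

text \<open>Elements are finitely supported functions on words. The multiplication depends on the
  language \<open>L\<close>, since a product of words leaving \<open>L\<close> is zero. The algebra has no unit.\<close>

definition lang_alg :: "'a list set \<Rightarrow> ('a list \<Rightarrow>\<^sub>0 'k::field) set" where
  "lang_alg L = {p. Poly_Mapping.keys p \<subseteq> L}"

definition scale :: "'k::field \<Rightarrow> ('a \<Rightarrow>\<^sub>0 'k) \<Rightarrow> ('a \<Rightarrow>\<^sub>0 'k)" where
  "scale c p = Poly_Mapping.map ((*) c) p"

definition mult :: "'a list set \<Rightarrow> ('a list \<Rightarrow>\<^sub>0 'k::field) \<Rightarrow> ('a list \<Rightarrow>\<^sub>0 'k) \<Rightarrow> ('a list \<Rightarrow>\<^sub>0 'k)"
  where
  "mult L p q = (\<Sum>u\<in>Poly_Mapping.keys p. \<Sum>v\<in>Poly_Mapping.keys q.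
     if u @ v \<in> L
     then Poly_Mapping.single (u @ v) (Poly_Mapping.lookup p u * Poly_Mapping.lookup q v)
     else 0)"

abbreviation word_elt :: "'a list \<Rightarrow> ('a list \<Rightarrow>\<^sub>0 'k::field)" where
  "word_elt w \<equiv> Poly_Mapping.single w 1"

abbreviation lin_span :: "('a \<Rightarrow>\<^sub>0 'k::field) set \<Rightarrow> ('a \<Rightarrow>\<^sub>0 'k) set" where
  "lin_span \<equiv> module.span scale"

lemma lookup_scale [simp]:
  "Poly_Mapping.lookup (scale c p) u = c * Poly_Mapping.lookup p u"
  by (simp add: scale_def map.rep_eq when_def)

lemma vector_space_scale: "vector_space (scale :: 'k::field \<Rightarrow> ('a \<Rightarrow>\<^sub>0 'k) \<Rightarrow> _)"
  by unfold_locales (auto intro!: poly_mapping_eqI simp: lookup_add algebra_simps)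

lemma mult_word_elt:
  "mult L (word_elt u) (word_elt v) = (if u @ v \<in> L then word_elt (u @ v) else 0)"
  by (simp add: mult_def)

text \<open>Only positive exponents are meaningful in an algebra without unit: \<open>alg_pow L a n\<close> is
  the \<open>n\<close>-th power of \<open>a\<close> for \<open>n \<ge> 1\<close>. Accordingly, \<open>poly_eval L f a\<close> is \<open>f(a)\<close> for
  polynomials \<open>f\<close> with zero constant term.\<close>

definition alg_pow :: "'a list set \<Rightarrow> ('a list \<Rightarrow>\<^sub>0 'k::field) \<Rightarrow> nat \<Rightarrow> ('a list \<Rightarrow>\<^sub>0 'k)" where
  "alg_pow L a n = (mult L a ^^ (n - 1)) a"

definition poly_eval :: "'a list set \<Rightarrow> 'k::field poly \<Rightarrow> ('a list \<Rightarrow>\<^sub>0 'k) \<Rightarrow> ('a list \<Rightarrow>\<^sub>0 'k)" where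
  "poly_eval L f a = (\<Sum>i = 1..degree f. scale (coeff f i) (alg_pow L a i))"

definition center :: "'a list set \<Rightarrow> ('a list \<Rightarrow>\<^sub>0 'k::field) set" where
  "center L = {a \<in> lang_alg L. \<forall>b\<in>lang_alg L. mult L a b = mult L b a}"

definition St3 :: "'a list set \<Rightarrow> ('a list \<Rightarrow>\<^sub>0 'k::field) \<Rightarrow> ('a list \<Rightarrow>\<^sub>0 'k) \<Rightarrow> ('a list \<Rightarrow>\<^sub>0 'k)
    \<Rightarrow> ('a list \<Rightarrow>\<^sub>0 'k)" where
  "St3 L a b c = (\<Sum>\<sigma> | \<sigma> permutes {0, 1, 2::nat}.
     let x = (\<lambda>i. [a, b, c] ! \<sigma> i)
     in scale (of_int (sign \<sigma>)) (mult L (mult L (x 0) (x 1)) (x 2)))"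

definition three_center :: "'a list set \<Rightarrow> ('a list \<Rightarrow>\<^sub>0 'k::field) set" where
  "three_center L = {a \<in> lang_alg L. \<forall>b\<in>lang_alg L. \<forall>c\<in>lang_alg L. St3 L a b c = 0}"

text \<open>\<open>S\<close>, with the operations of the algebra of \<open>L\<close>, is isomorphic to the algebra (without
  unit) of polynomials with zero constant term.\<close>

definition iso_polys_zero_const :: "'a list set \<Rightarrow> ('a list \<Rightarrow>\<^sub>0 'k::field) set \<Rightarrow> bool" where
  "iso_polys_zero_const L S \<longleftrightarrow>
     (\<exists>h. bij_betw h {f :: 'k poly. poly f 0 = 0} S \<and>
        (\<forall>f g. poly f 0 = 0 \<longrightarrow> poly g 0 = 0 \<longrightarrow>
           h (f + g) = h f + h g \<and> h (f * g) = mult L (h f) (h g)) \<and>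
        (\<forall>c f. poly f 0 = 0 \<longrightarrow> h (smult c f) = scale c (h f)))"


section \<open>Algebraic irreducibility and components\<close>

text \<open>Isomorphism for the partial operation of concatenation: \<open>\<phi>\<close> preserves products and
  whether they are defined (in both directions).\<close>

definition partial_iso :: "('a list \<Rightarrow> 'b list) \<Rightarrow> 'a list set \<Rightarrow> 'b list set \<Rightarrow> bool" where
  "partial_iso \<phi> L M \<longleftrightarrow> bij_betw \<phi> L M \<and>
     (\<forall>u\<in>L. \<forall>v\<in>L. (u @ v \<in> L \<longleftrightarrow> \<phi> u @ \<phi> v \<in> M) \<and>
                    (u @ v \<in> L \<longrightarrow> \<phi> (u @ v) = \<phi> u @ \<phi> v))"

text \<open>The members of a decomposition are required to be non-empty, as otherwise every language
  would be decomposable by adding an empty one. Finiteness of the family is automatic: \<open>\<phi>\<close>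
  restricts to a bijection between the letters occurring on both sides.\<close>

definition decomposition ::
    "'a list set \<Rightarrow> 'b list set set \<Rightarrow> ('a list \<Rightarrow> 'b list) \<Rightarrow> bool" where
  "decomposition L \<M> \<phi> \<longleftrightarrow> finite \<M> \<and> (\<forall>M\<in>\<M>. is_formal_lang M \<and> M \<noteq> {}) \<and>
     pairwise disjnt \<M> \<and> partial_iso \<phi> L (\<Union>\<M>)"

text \<open>The alphabets of the \<open>M\<close> may be arbitrary finite sets. Taking their letters from \<open>nat\<close>
  is no restriction, since the union of the alphabets is finite and hence embeds into \<open>nat\<close>.\<close>

definition alg_irreducible :: "'a list set \<Rightarrow> bool" where
  "alg_irreducible L \<longleftrightarrow>
     \<not> (\<exists>(\<M> :: nat list set set) \<phi>. decomposition L \<M> \<phi> \<and> card \<M> \<ge> 2)"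

text \<open>For irreducible \<open>L\<close> this forces a single component (none if \<open>L\<close> is empty); for
  other \<open>L\<close> there are at least two.\<close>

definition alg_components ::
    "'a list set \<Rightarrow> 'b list set set \<Rightarrow> ('a list \<Rightarrow> 'b list) \<Rightarrow> bool" where
  "alg_components L \<M> \<phi> \<longleftrightarrow> decomposition L \<M> \<phi> \<and> (\<forall>M\<in>\<M>. alg_irreducible M)"

definition relabel :: "('b \<Rightarrow> 'a) \<Rightarrow> ('b \<Rightarrow>\<^sub>0 'k::field) \<Rightarrow> ('a \<Rightarrow>\<^sub>0 'k)" where
  "relabel \<psi> p = (\<Sum>u\<in>Poly_Mapping.keys p. Poly_Mapping.single (\<psi> u) (Poly_Mapping.lookup p u))"

text \<open>Given a decomposition of \<open>L\<close> into the family \<open>\<M>\<close> via \<open>\<phi>\<close>, the subspace \<open>S\<close> of the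
  algebra of \<open>L\<close> is the direct sum of the subspaces \<open>C M\<close> of the algebras of the \<open>M\<close>:
  the canonical map from tuples (with componentwise operations) to sums is bijective onto
  \<open>S\<close> and respects the operations.\<close>

definition is_direct_sum ::
    "'a list set \<Rightarrow> 'b list set set \<Rightarrow> ('a list \<Rightarrow> 'b list) \<Rightarrow> ('a list \<Rightarrow>\<^sub>0 'k::field) set
     \<Rightarrow> ('b list set \<Rightarrow> ('b list \<Rightarrow>\<^sub>0 'k) set) \<Rightarrow> bool" where
  "is_direct_sum L \<M> \<phi> S C \<longleftrightarrow>
     (let h = (\<lambda>z. \<Sum>M\<in>\<M>. relabel (inv_into L \<phi>) (z M)) in
        bij_betw h (\<Pi>\<^sub>E M\<in>\<M>. C M) S \<and>
        (\<forall>y\<in>(\<Pi>\<^sub>E M\<in>\<M>. C M). \<forall>z\<in>(\<Pi>\<^sub>E M\<in>\<M>. C M).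
           h (\<lambda>M\<in>\<M>. y M + z M) = h y + h z \<and>
           h (\<lambda>M\<in>\<M>. mult M (y M) (z M)) = mult L (h y) (h z)) \<and>
        (\<forall>c. \<forall>z\<in>(\<Pi>\<^sub>E M\<in>\<M>. C M). h (\<lambda>M\<in>\<M>. scale c (z M)) = scale c (h z)))"


section \<open>The block language\<close>

text \<open>\<open>block_letters A F\<close> is the alphabet of the block language, so words of the block language
  have type \<open>'a list list\<close>. For a word \<open>x\<close> of length \<open>k\<close>, \<^term>\<open>tl x\<close> is
  \<open>x[2,k]\<close> and \<^term>\<open>butlast x\<close> is \<open>x[1,k-1]\<close>.\<close>

definition block_letters :: "'a set \<Rightarrow> 'a list set \<Rightarrow> 'a list set" where
  "block_letters A F = words_of_length (max_length F) (formal_lang A F)"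

definition block_forbidden :: "'a set \<Rightarrow> 'a list set \<Rightarrow> 'a list list set" where
  "block_forbidden A F =
     {[x, y] | x y. x \<in> block_letters A F \<and> y \<in> block_letters A F \<and> tl x \<noteq> butlast y}"

definition block_lang :: "'a set \<Rightarrow> 'a list set \<Rightarrow> 'a list list set" where
  "block_lang A F = formal_lang (block_letters A F) (block_forbidden A F)"

definition two_sided_unextendable :: "'a set \<Rightarrow> 'a list set \<Rightarrow> 'a list \<Rightarrow> bool" where
  "two_sided_unextendable A L w \<longleftrightarrow> (\<forall>a\<in>A. a # w \<notin> L \<and> w @ [a] \<notin> L)"

text \<open>\<open>\<omega>s\<close> lists the words \<open>\<omega>\<^sub>1, \<dots>, \<omega>\<^sub>n\<close> (\<open>n \<ge> 1\<close>) of the exceptional case of the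
  center; the words \<open>W\<^sub>i\<close> are then the rotations \<^term>\<open>rotate (i - 1) \<omega>s\<close>.\<close>

definition cyclic_listing :: "'a list set \<Rightarrow> 'a list list \<Rightarrow> bool" where
  "cyclic_listing B \<omega>s \<longleftrightarrow> \<omega>s \<noteq> [] \<and> distinct \<omega>s \<and> set \<omega>s = B \<and> distinct (map butlast \<omega>s) \<and>
     (\<forall>i. Suc i < length \<omega>s \<longrightarrow> tl (\<omega>s ! i) = butlast (\<omega>s ! Suc i)) \<and>
     tl (last \<omega>s) = butlast (hd \<omega>s)"

text \<open>Non-vanishing of a product of three words in the algebra of a language means that the
  concatenation belongs to the language (which is closed under subwords).\<close>

definition property_Delta :: "'a set \<Rightarrow> 'a list set \<Rightarrow> 'a list list \<Rightarrow> bool" where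
  "property_Delta A F \<omega>\<^sub>1 \<longleftrightarrow>
     \<not> (\<exists>\<omega>\<^sub>2\<in>block_letters A F. \<exists>\<omega>\<^sub>3\<in>block_letters A F. \<omega>\<^sub>2 \<noteq> \<omega>\<^sub>3 \<and>
          (\<exists>\<sigma>. \<sigma> permutes {0, 1, 2::nat} \<and>
             (let x = (\<lambda>i. [\<omega>\<^sub>1, [\<omega>\<^sub>2], [\<omega>\<^sub>3]] ! \<sigma> i) in x 0 @ x 1 @ x 2 \<in> block_lang A F))) \<or>
     (\<exists>l a. l \<ge> 1 \<and>
        (let Aw = replicate (max_length F) a; B = block_letters A F in
           \<omega>\<^sub>1 = replicate l Aw \<and>
           (B = {Aw} \<or>
            (\<exists>S. a \<notin> S \<and> B = insert Aw {butlast Aw @ [b] | b. b \<in> S}) \<or>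
            (\<exists>S. a \<notin> S \<and> B = insert Aw {d # tl Aw | d. d \<in> S}))))"

end

theory Submission
  imports Defs
begin

text \<open>The words of a block language are the edge paths of a finite digraph without parallel edges,
  and decompositions of such a language correspond to splittings of the set of edges into parts that
  are closed under composability, so irreducible means connected.

  If a word \<open>w\<close> in the support of a central element can be followed by an edge \<open>e\<close>, comparing
  coefficients at \<open>we\<close> shows that \<open>e\<close> is the first edge of \<open>w\<close> and that the rotation of \<open>w\<close> by
  one has the same coefficient. Hence \<open>w\<close> is closed and no edge leaves its cycle, which by
  connectedness is the whole graph.

  For the 3-center, \<open>St\<^sub>3(a, b, c) = 0\<close> with suitable paths \<open>b\<close>, \<open>c\<close> is read off at a path \<open>x\<close>
  to which, up to cancellation, only one word \<open>w\<close> of the support of \<open>a\<close> contributes: \<open>x = wbwb\<close> with \<open>c = wb\<close> if \<open>b\<close> leads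
  from the end of the open path \<open>w\<close> back to its start, \<open>x = pqpqp\<close> with \<open>b = p\<close>, \<open>c = qp\<close> if
  \<open>w = pq\<close> is closed and not a power of a loop, and otherwise products of \<open>w\<close> with two distinct
  edges.\<close>

section \<open>Algebras of languages\<close>

text \<open>The obstacle for the 3-center is that a path \<open>x\<close> can split into
  \<open>b\<close>, \<open>c\<close> and an unknown word in six orders, so several words of the
  support may meet in one coefficient. The test paths are chosen so that first letters, last letters
  or a pair of edges that do not compose rule out the unwanted orders. In \<open>wbwb\<close> two
  orders with sign + survive, which is where the characteristic enters: the coefficient is 2. In
  \<open>pqpqp\<close> the word \<open>qp\<close> occurs as well, but once with each sign. About the
  graph this uses two facts: edges with a common successor have the same successors, and a vertex
  carries at most one loop. The free language on several letters violates the second fact and gets a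
  test word of its own, while a single letter or a single loop is treated as a cycle of length 1.
  Conversely, a word with property (\<Delta>) lies in the 3-center because the six signed terms
  coincide or vanish in pairs.\<close>

abbreviation coef :: "('a \<Rightarrow>\<^sub>0 'k::zero) \<Rightarrow> 'a \<Rightarrow> 'k" where
  "coef \<equiv> Poly_Mapping.lookup"

abbreviation supp :: "('a \<Rightarrow>\<^sub>0 'k::zero) \<Rightarrow> 'a set" where
  "supp \<equiv> Poly_Mapping.keys"

interpretation scale: vector_space "scale :: 'k::field \<Rightarrow> ('a \<Rightarrow>\<^sub>0 'k) \<Rightarrow> _"
  by (rule vector_space_scale)

lemma sum_words: "p = (\<Sum>u\<in>supp p. scale (coef p u) (word_elt u))"
  by (rule poly_mapping_eqI)
    (simp add: lookup_sum lookup_single when_def if_distrib[of "\<lambda>x. _ * x"] in_keys_iff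
      cong: if_cong)

lemma lang_alg_iff: "p \<in> lang_alg L \<longleftrightarrow> (\<forall>u. u \<notin> L \<longrightarrow> coef p u = 0)"
  by (auto simp: lang_alg_def in_keys_iff)

lemma coef_outside: "p \<in> lang_alg L \<Longrightarrow> u \<notin> L \<Longrightarrow> coef p u = 0"
  by (simp add: lang_alg_iff)

lemma word_elt_in_lang_alg [simp]: "word_elt u \<in> lang_alg L \<longleftrightarrow> u \<in> L"
  by (simp add: lang_alg_def)

lemma zero_in_lang_alg [simp]: "0 \<in> lang_alg L"
  by (simp add: lang_alg_def)

lemma add_in_lang_alg: "p \<in> lang_alg L \<Longrightarrow> q \<in> lang_alg L \<Longrightarrow> p + q \<in> lang_alg L"
  by (simp add: lang_alg_iff lookup_add)

lemma scale_in_lang_alg: "p \<in> lang_alg L \<Longrightarrow> scale c p \<in> lang_alg L"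
  by (simp add: lang_alg_iff)

lemma sum_in_lang_alg: "(\<And>i. i \<in> I \<Longrightarrow> f i \<in> lang_alg L) \<Longrightarrow> sum f I \<in> lang_alg L"
  by (simp add: lang_alg_iff lookup_sum)

text \<open>Since the words form a basis, a span of words is a condition on supports; both centers
  are computed in that form.\<close>

lemma lin_span_words:
  "(lin_span {word_elt w | w. w \<in> W} :: ('a list \<Rightarrow>\<^sub>0 'k::field) set) = lang_alg W"
proof
  have "scale.subspace (lang_alg W :: ('a list \<Rightarrow>\<^sub>0 'k) set)"
    by (auto simp: scale.subspace_def add_in_lang_alg scale_in_lang_alg)
  then show "lin_span {word_elt w | w. w \<in> W} \<subseteq> (lang_alg W :: ('a list \<Rightarrow>\<^sub>0 'k) set)"
    by (intro scale.span_minimal) auto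
  show "(lang_alg W :: ('a list \<Rightarrow>\<^sub>0 'k) set) \<subseteq> lin_span {word_elt w | w. w \<in> W}"
  proof
    fix p :: "'a list \<Rightarrow>\<^sub>0 'k" assume p: "p \<in> lang_alg W"
    have "(\<Sum>u\<in>supp p. scale (coef p u) (word_elt u)) \<in> lin_span {word_elt w | w. w \<in> W}"
      using p by (intro scale.span_sum scale.span_scale scale.span_base) (auto simp: lang_alg_def)
    then show "p \<in> lin_span {word_elt w | w. w \<in> W}"
      using sum_words[of p] by simp
  qed
qed

text \<open>A factorization of \<open>x\<close> is the same as a cut position. In this form the sum
  no longer refers to the supports, so linearity and comparisons of products can be checked
  coefficientwise. The cuts at both ends involve the empty word, whose coefficient is zero for
  elements of the algebra of a language without it.\<close>

lemma coef_mult: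
  fixes p q :: "'a list \<Rightarrow>\<^sub>0 'k::field"
  shows "coef (mult L p q) x =
     (if x \<in> L then \<Sum>i\<le>length x. coef p (take i x) * coef q (drop i x) else 0)"
proof -
  have summand: "coef (if u @ v \<in> L then Poly_Mapping.single (u @ v) c else 0) x
      = (if u @ v = x \<and> x \<in> L then c else 0)" for u v and c :: 'k
    by (auto simp: lookup_single when_def)
  have "coef (mult L p q) x
      = (\<Sum>u\<in>supp p. \<Sum>v\<in>supp q. if u @ v = x \<and> x \<in> L then coef p u * coef q v else 0)"
    by (simp add: mult_def lookup_sum summand)
  also have "\<dots> = (\<Sum>(u,v)\<in>supp p \<times> supp q. if u @ v = x \<and> x \<in> L then coef p u * coef q v else 0)"
    by (simp add: sum.cartesian_product)
  also have "\<dots> = (if x \<in> L then \<Sum>i\<le>length x. coef p (take i x) * coef q (drop i x) else 0)"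
  proof (cases "x \<in> L")
    case True
    let ?S = "{(u,v). (u,v) \<in> supp p \<times> supp q \<and> u @ v = x}"
    let ?T = "{i \<in> {..length x}. take i x \<in> supp p \<and> drop i x \<in> supp q}"
    have "(\<Sum>(u,v)\<in>supp p \<times> supp q. if u @ v = x \<and> x \<in> L then coef p u * coef q v else 0)
        = (\<Sum>(u,v)\<in>?S. coef p u * coef q v)"
      using True by (intro sum.mono_neutral_cong_right) (auto split: if_splits)
    also have "\<dots> = (\<Sum>i\<in>?T. coef p (take i x) * coef q (drop i x))"
      by (rule sum.reindex_bij_witness[of _ "\<lambda>i. (take i x, drop i x)" "\<lambda>(u,v). length u"]) auto
    also have "\<dots> = (\<Sum>i\<le>length x. coef p (take i x) * coef q (drop i x))"
      by (rule sum.mono_neutral_left) (auto simp: in_keys_iff)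
    finally show ?thesis using True by simp
  qed simp
  finally show ?thesis .
qed

text \<open>Sums over pairs of words can be transported along a bijection of languages, which cut
  positions would allow only with control of lengths.\<close>

lemma coef_mult_factors:
  fixes p q :: "'a list \<Rightarrow>\<^sub>0 'k::field"
  assumes "p \<in> lang_alg L" "q \<in> lang_alg L" "x \<in> L"
  shows "coef (mult L p q) x = (\<Sum>(u,v) | u \<in> L \<and> v \<in> L \<and> u @ v = x. coef p u * coef q v)"
proof -
  let ?T = "{i \<in> {..length x}. take i x \<in> L \<and> drop i x \<in> L}"
  have "coef (mult L p q) x = (\<Sum>i\<in>?T. coef p (take i x) * coef q (drop i x))"
    unfolding coef_mult using assms
    by (auto intro!: sum.mono_neutral_right) (use coef_outside in blast)+
  also have "\<dots> = (\<Sum>(u,v) | u \<in> L \<and> v \<in> L \<and> u @ v = x. coef p u * coef q v)"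
    by (rule sum.reindex_bij_witness[of _ "\<lambda>(u,v). length u" "\<lambda>i. (take i x, drop i x)"]) auto
  finally show ?thesis .
qed

section \<open>Linearity of the product and the standard polynomial\<close>

lemma mult_in_lang_alg [simp]: "mult L p q \<in> lang_alg L"
  by (simp add: lang_alg_iff coef_mult)

lemma mult_add_left: "mult L (p + p') q = mult L p q + mult L p' q"
  by (rule poly_mapping_eqI) (simp add: coef_mult lookup_add algebra_simps sum.distrib)

lemma mult_add_right: "mult L p (q + q') = mult L p q + mult L p q'"
  by (rule poly_mapping_eqI) (simp add: coef_mult lookup_add algebra_simps sum.distrib)

lemma mult_scale_left: "mult L (scale c p) q = scale c (mult L p q)"
  by (rule poly_mapping_eqI) (simp add: coef_mult sum_distrib_left algebra_simps)

lemma mult_scale_right: "mult L p (scale c q) = scale c (mult L p q)"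
  by (rule poly_mapping_eqI) (simp add: coef_mult sum_distrib_left algebra_simps)

lemma mult_zero_left [simp]: "mult L 0 q = 0"
  by (simp add: mult_def)

lemma mult_zero_right [simp]: "mult L p 0 = 0"
  by (simp add: mult_def)

lemma mult_sum_left: "mult L (\<Sum>i\<in>I. f i) q = (\<Sum>i\<in>I. mult L (f i) q)"
  by (induction I rule: infinite_finite_induct) (simp_all add: mult_add_left)

lemma mult_sum_right: "mult L p (\<Sum>i\<in>I. f i) = (\<Sum>i\<in>I. mult L p (f i))"
  by (induction I rule: infinite_finite_induct) (simp_all add: mult_add_right)

lemma St3_eq:
  "St3 L a b c = mult L (mult L a b) c - mult L (mult L a c) b + mult L (mult L b c) a
     - mult L (mult L b a) c + mult L (mult L c a) b - mult L (mult L c b) a"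
proof -
  have neg: "scale (- 1) p = - p" for p :: "'a list \<Rightarrow>\<^sub>0 'b"
    by (rule poly_mapping_eqI) simp
  have 1: "finite {1, 2::nat}" "0 \<notin> {1, 2::nat}" and 2: "finite {2::nat}" "1 \<notin> {2::nat}"
    by auto
  show ?thesis
    unfolding St3_def
    \<comment> \<open>Each rewriting splits a permutation into a transposition of the least point
      and a permutation of the remaining points.\<close>
    unfolding sum_over_permutations_insert[OF 1] sum_over_permutations_insert[OF 2]
    by (simp add: permutes_sing sign_compose sign_swap_id permutation_swap_id permutation_compose
        Let_def transpose_def neg algebra_simps numeral_2_eq_2)
qed

lemma St3_in_lang_alg: "St3 L a b c \<in> lang_alg L"
  by (simp add: St3_eq lang_alg_iff lookup_add lookup_minus coef_mult)

lemma St3_sum_scale_1: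
  "St3 L (\<Sum>i\<in>I. scale (f i) (g i)) b c = (\<Sum>i\<in>I. scale (f i) (St3 L (g i) b c))"
  by (simp add: St3_eq mult_sum_left mult_sum_right mult_scale_left mult_scale_right
      scale.scale_right_distrib scale.scale_right_diff_distrib sum.distrib sum_subtractf)

lemma St3_sum_scale_2:
  "St3 L a (\<Sum>i\<in>I. scale (f i) (g i)) c = (\<Sum>i\<in>I. scale (f i) (St3 L a (g i) c))"
  by (simp add: St3_eq mult_sum_left mult_sum_right mult_scale_left mult_scale_right
      scale.scale_right_distrib scale.scale_right_diff_distrib sum.distrib sum_subtractf)

lemma St3_sum_scale_3:
  "St3 L a b (\<Sum>i\<in>I. scale (f i) (g i)) = (\<Sum>i\<in>I. scale (f i) (St3 L a b (g i)))"
  by (simp add: St3_eq mult_sum_left mult_sum_right mult_scale_left mult_scale_right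
      scale.scale_right_distrib scale.scale_right_diff_distrib sum.distrib sum_subtractf)

text \<open>By linearity in the last two arguments it is enough to test on words. The first argument
  stays general, since cancellation between its words has to be excluded later.\<close>

lemma three_center_iff_words:
  "a \<in> three_center L \<longleftrightarrow>
     a \<in> lang_alg L \<and> (\<forall>b\<in>L. \<forall>c\<in>L. St3 L a (word_elt b) (word_elt c) = 0)"
proof
  assume "a \<in> three_center L"
  then show "a \<in> lang_alg L \<and> (\<forall>b\<in>L. \<forall>c\<in>L. St3 L a (word_elt b) (word_elt c) = 0)"
    by (simp add: three_center_def)
next
  assume "a \<in> lang_alg L \<and> (\<forall>b\<in>L. \<forall>c\<in>L. St3 L a (word_elt b) (word_elt c) = 0)"
  then have a: "a \<in> lang_alg L"
    and *: "\<forall>b\<in>L. \<forall>c\<in>L. St3 L a (word_elt b) (word_elt c) = 0"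
    by auto
  have "St3 L a b c = 0" if "b \<in> lang_alg L" "c \<in> lang_alg L" for b c
  proof -
    have "St3 L a b c = St3 L a (\<Sum>u\<in>supp b. scale (coef b u) (word_elt u))
        (\<Sum>v\<in>supp c. scale (coef c v) (word_elt v))"
      using sum_words[of b] sum_words[of c] by simp
    also have "\<dots> = (\<Sum>u\<in>supp b. scale (coef b u) (\<Sum>v\<in>supp c. scale (coef c v)
        (St3 L a (word_elt u) (word_elt v))))"
      unfolding St3_sum_scale_2 unfolding St3_sum_scale_3 by (rule refl)
    also have "\<dots> = 0"
    proof -
      have "St3 L a (word_elt u) (word_elt v) = 0" if "u \<in> supp b" "v \<in> supp c" for u v
        using * that \<open>b \<in> _\<close> \<open>c \<in> _\<close> by (auto simp: lang_alg_def)
      then show ?thesis by simp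
    qed
    finally show ?thesis .
  qed
  then show "a \<in> three_center L"
    using a by (simp add: three_center_def)
qed

lemma center_iff_words:
  "a \<in> center L \<longleftrightarrow>
     a \<in> lang_alg L \<and> (\<forall>b\<in>L. mult L a (word_elt b) = mult L (word_elt b) a)"
proof
  assume "a \<in> center L"
  then show "a \<in> lang_alg L \<and> (\<forall>b\<in>L. mult L a (word_elt b) = mult L (word_elt b) a)"
    by (simp add: center_def)
next
  assume "a \<in> lang_alg L \<and> (\<forall>b\<in>L. mult L a (word_elt b) = mult L (word_elt b) a)"
  then have a: "a \<in> lang_alg L" and *: "\<forall>b\<in>L. mult L a (word_elt b) = mult L (word_elt b) a"
    by auto
  have "mult L a b = mult L b a" if "b \<in> lang_alg L" for b
  proof -
    have "mult L a b = mult L a (\<Sum>u\<in>supp b. scale (coef b u) (word_elt u))"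
      using sum_words[of b] by simp
    also have "\<dots> = (\<Sum>u\<in>supp b. scale (coef b u) (mult L a (word_elt u)))"
      by (simp add: mult_sum_right mult_scale_right)
    also have "\<dots> = (\<Sum>u\<in>supp b. scale (coef b u) (mult L (word_elt u) a))"
      using * that by (intro sum.cong) (auto simp: lang_alg_def)
    also have "\<dots> = mult L (\<Sum>u\<in>supp b. scale (coef b u) (word_elt u)) a"
      by (simp add: mult_sum_left mult_scale_left)
    also have "\<dots> = mult L b a"
      using sum_words[of b] by simp
    finally show ?thesis .
  qed
  then show "a \<in> center L"
    using a by (simp add: center_def)
qed

text \<open>With this closure a product of words is nonzero exactly when the whole concatenation
  lies in the language, whatever the bracketing.\<close>

definition factor_closed :: "'a list set \<Rightarrow> bool" where
  "factor_closed L \<longleftrightarrow> [] \<notin> L \<and>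
     (\<forall>u v. u @ v \<in> L \<longrightarrow> (u \<noteq> [] \<longrightarrow> u \<in> L) \<and> (v \<noteq> [] \<longrightarrow> v \<in> L))"

lemma factor_closedD:
  assumes "factor_closed L"
  shows "[] \<notin> L" "u @ v \<in> L \<Longrightarrow> u \<noteq> [] \<Longrightarrow> u \<in> L" "u @ v \<in> L \<Longrightarrow> v \<noteq> [] \<Longrightarrow> v \<in> L"
  using assms unfolding factor_closed_def by blast+

definition elt_or_zero :: "'a list set \<Rightarrow> 'a list \<Rightarrow> ('a list \<Rightarrow>\<^sub>0 'k::field)" where
  "elt_or_zero L w = (if w \<in> L then word_elt w else 0)"

lemma mult3_words:
  assumes "factor_closed L" "u \<noteq> []"
  shows "mult L (mult L (word_elt u) (word_elt v)) (word_elt w) = elt_or_zero L (u @ v @ w)"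
  using factor_closedD(2)[OF assms(1), of "u @ v" w] assms(2)
  by (auto simp: mult_word_elt elt_or_zero_def)

lemma St3_words:
  assumes "factor_closed L" "u \<noteq> []" "v \<noteq> []" "w \<noteq> []"
  shows "St3 L (word_elt u) (word_elt v) (word_elt w) =
    elt_or_zero L (u @ v @ w) - elt_or_zero L (u @ w @ v) + elt_or_zero L (v @ w @ u)
    - elt_or_zero L (v @ u @ w) + elt_or_zero L (w @ u @ v) - elt_or_zero L (w @ v @ u)"
  using assms by (simp add: St3_eq mult3_words)

lemma three_centerI:
  assumes "a \<in> lang_alg L"
    and "\<And>u b c. u \<in> supp a \<Longrightarrow> b \<in> L \<Longrightarrow> c \<in> L \<Longrightarrow>
      St3 L (word_elt u) (word_elt b) (word_elt c) = (0 :: 'a list \<Rightarrow>\<^sub>0 'k)"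
  shows "(a :: 'a list \<Rightarrow>\<^sub>0 'k::field) \<in> three_center L"
  unfolding three_center_iff_words
proof (intro conjI ballI)
  fix b c assume bc: "b \<in> L" "c \<in> L"
  have "St3 L a (word_elt b) (word_elt c)
      = St3 L (\<Sum>u\<in>supp a. scale (coef a u) (word_elt u)) (word_elt b) (word_elt c)"
    using sum_words[of a] by simp
  also have "\<dots> = 0"
    unfolding St3_sum_scale_1 using assms(2) bc by (intro sum.neutral) auto
  finally show "St3 L a (word_elt b) (word_elt c) = 0" .
qed fact

text \<open>The left-hand side of the assumption is the coefficient of \<open>x\<close> in
  \<open>St\<^sub>3(u, b, c)\<close>. Words \<open>b\<close>, \<open>c\<close> and \<open>x\<close> that isolate the word \<open>w\<close> in this
  way show that no element of the 3-center involves \<open>w\<close>.\<close>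

lemma three_center_coef_eq_0:
  fixes a :: "'a list \<Rightarrow>\<^sub>0 'k::field" and \<kappa> :: 'k
  assumes L: "factor_closed L" and a: "a \<in> three_center L"
    and x: "b \<in> L" "c \<in> L" "x \<in> L" and "\<kappa> \<noteq> 0"
    and *: "\<And>u. u \<noteq> [] \<Longrightarrow> of_bool (u @ b @ c = x) - of_bool (u @ c @ b = x)
      + of_bool (b @ c @ u = x) - of_bool (b @ u @ c = x)
      + of_bool (c @ u @ b = x) - of_bool (c @ b @ u = x) = \<kappa> * of_bool (u = w)"
  shows "coef a w = 0"
proof -
  have ne: "b \<noteq> []" "c \<noteq> []" "\<And>u. u \<in> supp a \<Longrightarrow> u \<noteq> []"
    using factor_closedD(1)[OF L] x a by (auto simp: three_center_def lang_alg_def)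
  have e: "coef (elt_or_zero L v) x = of_bool (v = x)" for v
    using x by (auto simp: elt_or_zero_def lookup_single when_def)
  have "0 = coef (St3 L a (word_elt b) (word_elt c)) x"
    using a x by (simp add: three_center_iff_words)
  also have "St3 L a (word_elt b) (word_elt c)
      = St3 L (\<Sum>u\<in>supp a. scale (coef a u) (word_elt u)) (word_elt b) (word_elt c)"
    using sum_words[of a] by simp
  also have "coef \<dots> x = (\<Sum>u\<in>supp a. coef a u * coef (St3 L (word_elt u) (word_elt b) (word_elt c)) x)"
    by (simp add: St3_sum_scale_1 lookup_sum)
  also have "\<dots> = (\<Sum>u\<in>supp a. coef a u * (\<kappa> * of_bool (u = w)))"
    by (intro sum.cong refl arg_cong[where f = "(*) _"])
      (subst *[symmetric], use ne in \<open>simp_all add: St3_words L lookup_add lookup_minus e\<close>)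
  also have "\<dots> = \<kappa> * coef a w"
    by (simp add: if_distrib[of "\<lambda>x. _ * x"] in_keys_iff of_bool_def mult.commute cong: if_cong)
  finally show ?thesis using \<open>\<kappa> \<noteq> 0\<close> by simp
qed

section \<open>Decompositions and direct sums\<close>

lemma center_subset: "center L \<subseteq> lang_alg L"
  by (auto simp: center_def)

lemma three_center_subset: "three_center L \<subseteq> lang_alg L"
  by (auto simp: three_center_def)

lemma formal_lang_factor_closed: "factor_closed (formal_lang A F)"
  by (auto simp: factor_closed_def formal_lang_def words_def sublist_append)

lemma is_formal_lang_factor_closed: "is_formal_lang L \<Longrightarrow> factor_closed L"
  using formal_lang_factor_closed by (auto simp: is_formal_lang_def)

text \<open>Serves both uses of a decomposition: the direct sum statements, and the proof that
  connected graphs give irreducible languages.\<close>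

locale decomposed =
  fixes L :: "'a list set" and \<M> :: "'b list set set" and \<phi> :: "'a list \<Rightarrow> 'b list"
  assumes decomposition: "decomposition L \<M> \<phi>"
begin

lemma finite_components: "finite \<M>"
  and disjoint: "M \<in> \<M> \<Longrightarrow> N \<in> \<M> \<Longrightarrow> u \<in> M \<Longrightarrow> u \<in> N \<Longrightarrow> M = N"
  and component_formal_lang: "M \<in> \<M> \<Longrightarrow> is_formal_lang M"
  and component_nonempty: "M \<in> \<M> \<Longrightarrow> M \<noteq> {}"
  and iso: "partial_iso \<phi> L (\<Union>\<M>)"
  using decomposition by (simp_all add: decomposition_def pairwise_def disjnt_def) blast

lemma bij: "bij_betw \<phi> L (\<Union>\<M>)"
  and concat_iff: "u \<in> L \<Longrightarrow> v \<in> L \<Longrightarrow> \<phi> u @ \<phi> v \<in> \<Union>\<M> \<longleftrightarrow> u @ v \<in> L"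
  and concat_eq: "u \<in> L \<Longrightarrow> v \<in> L \<Longrightarrow> u @ v \<in> L \<Longrightarrow> \<phi> (u @ v) = \<phi> u @ \<phi> v"
  using iso by (simp_all add: partial_iso_def)

lemmas component_factor_closed = is_formal_lang_factor_closed[OF component_formal_lang]

lemma component_of:
  assumes "u \<in> L"
  obtains M where "M \<in> \<M>" "\<phi> u \<in> M"
  using bij assms unfolding bij_betw_def by blast

text \<open>The component of \<open>\<phi> (u @ v)\<close> is closed under factors and
  \<open>\<phi>\<close> respects the product, so that component contains both images; disjointness
  excludes any other.\<close>

lemma same_component:
  assumes "u \<in> L" "v \<in> L" "u @ v \<in> L" "M \<in> \<M>"
  shows "\<phi> u \<in> M \<longleftrightarrow> \<phi> (u @ v) \<in> M" "\<phi> v \<in> M \<longleftrightarrow> \<phi> (u @ v) \<in> M"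
proof -
  obtain N where N: "N \<in> \<M>" "\<phi> (u @ v) \<in> N"
    using component_of[OF assms(3)] .
  have ne: "\<phi> x \<noteq> []" if "x \<in> L" for x
    using component_of[OF that] component_factor_closed factor_closedD(1) by metis
  have "\<phi> u \<in> N" "\<phi> v \<in> N"
    using factor_closedD(2,3)[OF component_factor_closed[OF N(1)], of "\<phi> u" "\<phi> v"] N ne assms
      concat_eq by auto
  then show "\<phi> u \<in> M \<longleftrightarrow> \<phi> (u @ v) \<in> M" "\<phi> v \<in> M \<longleftrightarrow> \<phi> (u @ v) \<in> M"
    using N disjoint assms(4) by blast+
qed

text \<open>The map \<open>h\<close> of \<open>is_direct_sum\<close>. It reads a family only on
  \<open>\<M>\<close>, so families need not be restricted before they are inserted.\<close>

definition embed :: "('b list set \<Rightarrow> ('b list \<Rightarrow>\<^sub>0 'k::field)) \<Rightarrow> ('a list \<Rightarrow>\<^sub>0 'k)" where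
  "embed z = (\<Sum>M\<in>\<M>. relabel (inv_into L \<phi>) (z M))"

abbreviation tuples :: "('b list set \<Rightarrow> ('b list \<Rightarrow>\<^sub>0 'k::field)) set" where
  "tuples \<equiv> \<Pi>\<^sub>E M\<in>\<M>. lang_alg M"

lemma inv_eq_iff: "u \<in> \<Union>\<M> \<Longrightarrow> inv_into L \<phi> u = w \<longleftrightarrow> w \<in> L \<and> u = \<phi> w"
  using bij by (metis bij_betw_def f_inv_into_f inv_into_f_f inv_into_into)

lemma coef_relabel:
  assumes "M \<in> \<M>" "p \<in> lang_alg M"
  shows "coef (relabel (inv_into L \<phi>) p) w = (if w \<in> L then coef p (\<phi> w) else 0)"
proof -
  have *: "inv_into L \<phi> u = w \<longleftrightarrow> u = \<phi> w \<and> w \<in> L" if "u \<in> supp p" for u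
    using that assms inv_eq_iff[of u w] by (auto simp only: lang_alg_def)
  have "coef (relabel (inv_into L \<phi>) p) w
      = (\<Sum>u\<in>supp p. if u = \<phi> w \<and> w \<in> L then coef p u else 0)"
    unfolding relabel_def lookup_sum lookup_single when_def
    by (intro sum.cong refl) (simp add: *)
  also have "\<dots> = (if w \<in> L then coef p (\<phi> w) else 0)"
    by (auto simp: in_keys_iff)
  finally show ?thesis .
qed

text \<open>All other entries vanish at \<open>\<phi> w\<close>, since the components are
  disjoint.\<close>

lemma coef_embed:
  assumes "\<And>M. M \<in> \<M> \<Longrightarrow> z M \<in> lang_alg M" "w \<in> L" "M \<in> \<M>" "\<phi> w \<in> M"
  shows "coef (embed z) w = coef (z M) (\<phi> w)"
proof -
  have "coef (embed z) w = (\<Sum>N\<in>\<M>. coef (z N) (\<phi> w))"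
    unfolding embed_def lookup_sum
    using assms by (intro sum.cong) (simp_all add: coef_relabel)
  also have "\<dots> = (\<Sum>N\<in>{M}. coef (z N) (\<phi> w))"
    using assms disjoint finite_components
    by (intro sum.mono_neutral_right) (auto intro!: coef_outside)
  finally show ?thesis by simp
qed

lemma embed_in_lang_alg: "(\<And>M. M \<in> \<M> \<Longrightarrow> z M \<in> lang_alg M) \<Longrightarrow> embed z \<in> lang_alg L"
  unfolding embed_def by (intro sum_in_lang_alg) (simp add: lang_alg_iff coef_relabel)

lemma embed_cong: "(\<And>M. M \<in> \<M> \<Longrightarrow> y M = z M) \<Longrightarrow> embed y = embed z"
  by (simp add: embed_def cong: sum.cong)

lemma embed_restrict [simp]: "embed (restrict z \<M>) = embed z"
  by (rule embed_cong) simp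

lemma embed_eqI:
  assumes "\<And>M. M \<in> \<M> \<Longrightarrow> z M \<in> lang_alg M" "a \<in> lang_alg L"
    and "\<And>w M. w \<in> L \<Longrightarrow> M \<in> \<M> \<Longrightarrow> \<phi> w \<in> M \<Longrightarrow> coef (z M) (\<phi> w) = coef a w"
  shows "embed z = a"
proof (rule poly_mapping_eqI)
  fix w show "coef (embed z) w = coef a w"
  proof (cases "w \<in> L")
    case True
    then show ?thesis
      using component_of[OF True] assms coef_embed by metis
  next
    case False
    then show ?thesis
      using embed_in_lang_alg[OF assms(1)] assms(2) by (simp add: coef_outside)
  qed
qed

lemma embed_add:
  assumes "\<And>M. M \<in> \<M> \<Longrightarrow> y M \<in> lang_alg M" "\<And>M. M \<in> \<M> \<Longrightarrow> z M \<in> lang_alg M"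
  shows "embed (\<lambda>M. y M + z M) = embed y + embed z"
  by (rule embed_eqI)
    (simp_all add: assms add_in_lang_alg embed_in_lang_alg lookup_add coef_embed)

lemma embed_scale:
  assumes "\<And>M. M \<in> \<M> \<Longrightarrow> z M \<in> lang_alg M"
  shows "embed (\<lambda>M. scale c (z M)) = scale c (embed z)"
  by (rule embed_eqI) (simp_all add: assms scale_in_lang_alg embed_in_lang_alg coef_embed)

lemma embed_diff:
  assumes "\<And>M. M \<in> \<M> \<Longrightarrow> y M \<in> lang_alg M" "\<And>M. M \<in> \<M> \<Longrightarrow> z M \<in> lang_alg M"
  shows "embed (\<lambda>M. y M - z M) = embed y - embed z"
  using embed_in_lang_alg[of y] embed_in_lang_alg[of z] assms
  by (intro embed_eqI) (simp_all add: lang_alg_iff lookup_minus coef_embed)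

lemma embed_mult:
  assumes y: "\<And>M. M \<in> \<M> \<Longrightarrow> y M \<in> lang_alg M" and z: "\<And>M. M \<in> \<M> \<Longrightarrow> z M \<in> lang_alg M"
  shows "embed (\<lambda>M. mult M (y M) (z M)) = mult L (embed y) (embed z)"
proof (rule embed_eqI)
  fix w M assume w: "w \<in> L" "M \<in> \<M>" "\<phi> w \<in> M"
  have split: "\<phi> u \<in> M \<and> \<phi> v \<in> M" if "u \<in> L" "v \<in> L" "u @ v = w" for u v
    using same_component[OF that(1,2) _ w(2)] that(3) w by simp
  let ?A = "{(u,v). u \<in> M \<and> v \<in> M \<and> u @ v = \<phi> w}" and ?B = "{(u,v). u \<in> L \<and> v \<in> L \<and> u @ v = w}"
  \<comment> \<open>Definedness is used backwards here: the preimages of two composable words of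
    \<open>M\<close> are composable in \<open>L\<close>, and injectivity identifies their product
    with \<open>w\<close>.\<close>
  have "(u, v) \<in> map_prod \<phi> \<phi> ` ?B" if uv: "u \<in> M" "v \<in> M" "u @ v = \<phi> w" for u v
  proof -
    obtain u' v' where *: "u' \<in> L" "v' \<in> L" "u = \<phi> u'" "v = \<phi> v'"
      using uv(1,2) w(2) bij unfolding bij_betw_def by blast
    then have "u' @ v' \<in> L" "\<phi> (u' @ v') = \<phi> w"
      using concat_iff[of u' v'] concat_eq[of u' v'] uv(3) w by auto
    then have "u' @ v' = w"
      using bij w(1) unfolding bij_betw_def inj_on_def by blast
    then show ?thesis using * by auto
  qed
  moreover have "map_prod \<phi> \<phi> ` ?B \<subseteq> ?A"
    using split concat_eq w(1) by auto
  ultimately have image: "?A = map_prod \<phi> \<phi> ` ?B" by auto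
  have inj: "inj_on (map_prod \<phi> \<phi>) ?B"
    using bij by (auto simp: bij_betw_def inj_on_def)
  have "coef (mult M (y M) (z M)) (\<phi> w) = (\<Sum>(u,v)\<in>?A. coef (y M) u * coef (z M) v)"
    using w y z by (simp add: coef_mult_factors)
  also have "\<dots> = (\<Sum>(u,v)\<in>?B. coef (y M) (\<phi> u) * coef (z M) (\<phi> v))"
    unfolding image sum.reindex[OF inj] by (simp add: case_prod_beta)
  also have "\<dots> = (\<Sum>(u,v) | u \<in> L \<and> v \<in> L \<and> u @ v = w. coef (embed y) u * coef (embed z) v)"
    using coef_embed[of y, OF y] coef_embed[of z, OF z] split w(2)
    by (intro sum.cong refl) (auto simp del: UN_iff)
  also have "\<dots> = coef (mult L (embed y) (embed z)) w"
    using w by (simp add: coef_mult_factors embed_in_lang_alg y z)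
  finally show "coef (mult M (y M) (z M)) (\<phi> w) = coef (mult L (embed y) (embed z)) w" .
qed simp_all

lemma embed_St3:
  assumes "\<And>M. M \<in> \<M> \<Longrightarrow> x M \<in> lang_alg M" "\<And>M. M \<in> \<M> \<Longrightarrow> y M \<in> lang_alg M"
    "\<And>M. M \<in> \<M> \<Longrightarrow> z M \<in> lang_alg M"
  shows "embed (\<lambda>M. St3 M (x M) (y M) (z M)) = St3 L (embed x) (embed y) (embed z)"
proof -
  have diff: "p - q \<in> lang_alg M" if "p \<in> lang_alg M" "q \<in> lang_alg M"
    for p q :: "'b list \<Rightarrow>\<^sub>0 'c" and M
    using that by (simp add: lang_alg_iff lookup_minus)
  show ?thesis
    unfolding St3_eq by (simp add: assms embed_add embed_diff embed_mult add_in_lang_alg diff)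
qed

lemma inj_embed: "inj_on embed tuples"
proof (rule inj_onI)
  fix y z :: "'b list set \<Rightarrow> ('b list \<Rightarrow>\<^sub>0 'c)"
  assume y: "y \<in> tuples" and z: "z \<in> tuples" and eq: "embed y = embed z"
  show "y = z"
  proof (rule PiE_ext[OF y z], rule poly_mapping_eqI)
    fix M u assume M: "M \<in> \<M>"
    show "coef (y M) u = coef (z M) u"
    proof (cases "u \<in> M")
      case True
      then have u: "\<phi> (inv_into L \<phi> u) = u" "inv_into L \<phi> u \<in> L"
        using inv_eq_iff[of u "inv_into L \<phi> u"] M by (metis UnionI)+
      have "coef (embed y) (inv_into L \<phi> u) = coef (y M) u"
        "coef (embed z) (inv_into L \<phi> u) = coef (z M) u"
        by (subst coef_embed[OF _ u(2) M]; use y z u(1) True in \<open>simp add: PiE_mem\<close>)+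
      then show ?thesis using eq by simp
    next
      case False
      then show ?thesis using PiE_mem[OF y M] PiE_mem[OF z M] by (simp add: coef_outside)
    qed
  qed
qed

lemma embed_eq_iff:
  assumes "\<And>M. M \<in> \<M> \<Longrightarrow> y M \<in> lang_alg M" "\<And>M. M \<in> \<M> \<Longrightarrow> z M \<in> lang_alg M"
  shows "embed y = embed z \<longleftrightarrow> (\<forall>M\<in>\<M>. y M = z M)"
proof
  assume "embed y = embed z"
  then have "restrict y \<M> = restrict z \<M>"
    by (intro inj_onD[OF inj_embed]) (use assms in auto)
  then show "\<forall>M\<in>\<M>. y M = z M"
    by (metis restrict_apply')
qed (auto intro: embed_cong)

lemma embed_tuples: "embed ` tuples = (lang_alg L :: ('a list \<Rightarrow>\<^sub>0 'k::field) set)"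
proof
  show "embed ` tuples \<subseteq> (lang_alg L :: ('a list \<Rightarrow>\<^sub>0 'k) set)"
    by (auto simp: PiE_iff intro!: embed_in_lang_alg)
  show "(lang_alg L :: ('a list \<Rightarrow>\<^sub>0 'k) set) \<subseteq> embed ` tuples"
  proof
    fix a :: "'a list \<Rightarrow>\<^sub>0 'k" assume a: "a \<in> lang_alg L"
    \<comment> \<open>The entry at \<open>M\<close> collects the part of \<open>a\<close> whose
      words are mapped into \<open>M\<close>.\<close>
    define z where "z = (\<lambda>M\<in>\<M>. \<Sum>w | w \<in> supp a \<and> \<phi> w \<in> M. Poly_Mapping.single (\<phi> w) (coef a w))"
    have z: "z M \<in> lang_alg M" if "M \<in> \<M>" for M
      using that unfolding z_def
      by (auto intro!: sum.neutral simp: lang_alg_iff lookup_sum lookup_single when_def)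
    have "embed z = a"
    proof (rule embed_eqI[OF z a])
      fix w M assume w: "w \<in> L" "M \<in> \<M>" "\<phi> w \<in> M"
      have inj: "\<phi> v = \<phi> w \<longleftrightarrow> v = w" if "v \<in> supp a" for v
        using inj_on_eq_iff[OF bij_betw_imp_inj_on[OF bij], of v w] that a w(1)
        by (auto simp: lang_alg_def)
      have "coef (z M) (\<phi> w) = (\<Sum>v | v \<in> supp a \<and> \<phi> v \<in> M. if v = w then coef a v else 0)"
        by (simp only: z_def w(2) restrict_apply if_True lookup_sum lookup_single when_def,
            intro sum.cong refl, use inj in auto)
      also have "\<dots> = coef a w"
        using w by (simp add: in_keys_iff)
      finally show "coef (z M) (\<phi> w) = coef a w" .
    qed
    moreover have "z \<in> tuples" using z by (simp add: PiE_iff z_def)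
    ultimately show "a \<in> embed ` tuples" by blast
  qed
qed

text \<open>The sum map is an injective homomorphism from all tuples onto the algebra of
  \<open>L\<close>, so it restricts to a direct sum decomposition of \<open>S\<close> as soon as
  membership in \<open>S\<close> can be read off entrywise.\<close>

lemma is_direct_sumI:
  fixes S :: "('a list \<Rightarrow>\<^sub>0 'k::field) set"
  assumes "\<And>M. M \<in> \<M> \<Longrightarrow> C M \<subseteq> lang_alg M" "S \<subseteq> lang_alg L"
    and *: "\<And>z. z \<in> tuples \<Longrightarrow> embed z \<in> S \<longleftrightarrow> (\<forall>M\<in>\<M>. z M \<in> C M)"
  shows "is_direct_sum L \<M> \<phi> S C"
proof -
  have sub: "(\<Pi>\<^sub>E M\<in>\<M>. C M) \<subseteq> tuples"
    using assms(1) by (intro PiE_mono) auto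
  have "embed ` (\<Pi>\<^sub>E M\<in>\<M>. C M) = S"
  proof
    show "embed ` (\<Pi>\<^sub>E M\<in>\<M>. C M) \<subseteq> S"
      using * sub by (auto simp: PiE_iff)
    show "S \<subseteq> embed ` (\<Pi>\<^sub>E M\<in>\<M>. C M)"
    proof
      fix a assume "a \<in> S"
      then obtain z where "z \<in> tuples" "a = embed z"
        using assms(2) embed_tuples by blast
      then show "a \<in> embed ` (\<Pi>\<^sub>E M\<in>\<M>. C M)"
        using *[of z] \<open>a \<in> S\<close> by (auto simp: PiE_iff)
    qed
  qed
  then have bij: "bij_betw embed (\<Pi>\<^sub>E M\<in>\<M>. C M) S"
    using inj_on_subset[OF inj_embed sub] by (simp add: bij_betw_def)
  have mem: "z M \<in> lang_alg M" if "z \<in> (\<Pi>\<^sub>E M\<in>\<M>. C M)" "M \<in> \<M>" for z M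
    using that assms(1) by auto
  have "embed (\<lambda>M\<in>\<M>. y M + z M) = embed y + embed z"
    "embed (\<lambda>M\<in>\<M>. mult M (y M) (z M)) = mult L (embed y) (embed z)"
    "embed (\<lambda>M\<in>\<M>. scale c (z M)) = scale c (embed z)"
    if "y \<in> (\<Pi>\<^sub>E M\<in>\<M>. C M)" "z \<in> (\<Pi>\<^sub>E M\<in>\<M>. C M)" for y z c
    using that by (simp_all add: embed_add embed_mult embed_scale mem)
  then show ?thesis
    using bij unfolding is_direct_sum_def Let_def embed_def[symmetric, abs_def] by blast
qed

text \<open>Products of tuples are formed entrywise, so commuting with everything splits into
  conditions on the entries.\<close>

lemma embed_in_center_iff:
  fixes z :: "'b list set \<Rightarrow> ('b list \<Rightarrow>\<^sub>0 'k::field)"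
  assumes z: "z \<in> tuples"
  shows "embed z \<in> center L \<longleftrightarrow> (\<forall>M\<in>\<M>. z M \<in> center M)"
proof -
  have mem: "x M \<in> lang_alg M" if "x \<in> tuples" "M \<in> \<M>" for x :: "'b list set \<Rightarrow> ('b list \<Rightarrow>\<^sub>0 'k)" and M

    using that by auto
  have comm: "mult L (embed z) (embed y) = mult L (embed y) (embed z) \<longleftrightarrow>
      (\<forall>M\<in>\<M>. mult M (z M) (y M) = mult M (y M) (z M))" if y: "y \<in> tuples" for y
  proof -
    have "mult L (embed z) (embed y) = embed (\<lambda>M. mult M (z M) (y M))"
      "mult L (embed y) (embed z) = embed (\<lambda>M. mult M (y M) (z M))"
      using mem[OF y] mem[OF z] by (simp_all add: embed_mult)
    then show ?thesis by (simp add: embed_eq_iff)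
  qed
  have "embed z \<in> center L \<longleftrightarrow> (\<forall>y\<in>tuples. \<forall>M\<in>\<M>. mult M (z M) (y M) = mult M (y M) (z M))"
    unfolding center_def embed_tuples[symmetric] using z comm by auto
  also have "\<dots> \<longleftrightarrow> (\<forall>M\<in>\<M>. \<forall>b\<in>lang_alg M. mult M (z M) b = mult M b (z M))" (is "?l \<longleftrightarrow> ?r")
  proof
    assume ?l
    show ?r
    proof (intro ballI)
      fix M and b :: "'b list \<Rightarrow>\<^sub>0 'k" assume b: "M \<in> \<M>" "b \<in> lang_alg M"
      \<comment> \<open>To isolate one component, the test tuple is \<open>b\<close> there and zero
        elsewhere.\<close>
      have "(\<lambda>N\<in>\<M>. if N = M then b else 0) \<in> tuples"
        using b by auto
      then show "mult M (z M) b = mult M b (z M)"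
        using bspec[OF bspec[OF \<open>?l\<close>] b(1)] b(1) by fastforce
    qed
  qed auto
  finally show ?thesis
    using mem[OF z] by (auto simp: center_def)
qed

lemma embed_in_three_center_iff:
  fixes z :: "'b list set \<Rightarrow> ('b list \<Rightarrow>\<^sub>0 'k::field)"
  assumes z: "z \<in> tuples"
  shows "embed z \<in> three_center L \<longleftrightarrow> (\<forall>M\<in>\<M>. z M \<in> three_center M)"
proof -
  have mem: "x M \<in> lang_alg M" if "x \<in> tuples" "M \<in> \<M>" for x :: "'b list set \<Rightarrow> ('b list \<Rightarrow>\<^sub>0 'k)" and M

    using that by auto
  have vanish: "St3 L (embed z) (embed y) (embed x) = 0 \<longleftrightarrow>
      (\<forall>M\<in>\<M>. St3 M (z M) (y M) (x M) = 0)" if y: "y \<in> tuples" and x: "x \<in> tuples" for y x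
  proof -
    have "St3 L (embed z) (embed y) (embed x) = embed (\<lambda>M. St3 M (z M) (y M) (x M))"
      using mem[OF y] mem[OF z] mem[OF x] by (simp add: embed_St3)
    moreover have "0 = embed (\<lambda>M. 0 :: 'b list \<Rightarrow>\<^sub>0 'k)"
      by (rule embed_eqI[symmetric]) auto
    ultimately show ?thesis
      using embed_eq_iff[of "\<lambda>M. St3 M (z M) (y M) (x M)" "\<lambda>M. 0"] by (simp add: St3_in_lang_alg)
  qed
  have "embed z \<in> three_center L \<longleftrightarrow>
      (\<forall>y\<in>tuples. \<forall>x\<in>tuples. \<forall>M\<in>\<M>. St3 M (z M) (y M) (x M) = 0)"
    unfolding three_center_def embed_tuples[symmetric] using z vanish by auto
  also have "\<dots> \<longleftrightarrow> (\<forall>M\<in>\<M>. \<forall>b\<in>lang_alg M. \<forall>c\<in>lang_alg M. St3 M (z M) b c = 0)" (is "?l \<longleftrightarrow> ?r")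
  proof
    assume ?l
    show ?r
    proof (intro ballI)
      fix M and b c :: "'b list \<Rightarrow>\<^sub>0 'k" assume b: "M \<in> \<M>" "b \<in> lang_alg M" "c \<in> lang_alg M"
      \<comment> \<open>Both test tuples are concentrated on the same component.\<close>
      have "(\<lambda>N\<in>\<M>. if N = M then b else 0) \<in> tuples" "(\<lambda>N\<in>\<M>. if N = M then c else 0) \<in> tuples"
        using b by auto
      then show "St3 M (z M) b c = 0"
        using bspec[OF bspec[OF bspec[OF \<open>?l\<close>]] b(1)] b(1) by fastforce
    qed
  qed (use mem in blast)
  finally show ?thesis
    using mem[OF z] by (auto simp: three_center_def)
qed

theorem center_direct_sum: "is_direct_sum L \<M> \<phi> (center L) center"
  by (rule is_direct_sumI[OF center_subset center_subset embed_in_center_iff])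

theorem three_center_direct_sum: "is_direct_sum L \<M> \<phi> (three_center L) three_center"
  by (rule is_direct_sumI[OF three_center_subset three_center_subset embed_in_three_center_iff])

end

section \<open>Path languages\<close>

text \<open>The words of a block language are the edge paths of a digraph; \<open>R x y\<close> says that the
  edge \<open>y\<close> starts where the edge \<open>x\<close> ends.\<close>

definition path_lang :: "'a set \<Rightarrow> ('a \<Rightarrow> 'a \<Rightarrow> bool) \<Rightarrow> 'a list set" where
  "path_lang B R = {w. w \<noteq> [] \<and> set w \<subseteq> B \<and> successively R w}"

lemma successively_iff_no_forbidden_pair:
  "set w \<subseteq> B \<Longrightarrow>
     successively R w \<longleftrightarrow> (\<forall>x\<in>B. \<forall>y\<in>B. \<not> R x y \<longrightarrow> \<not> sublist [x, y] w)"
  by (induction w rule: induct_list012) (auto simp: sublist_Cons_right)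

lemma path_lang_eq_formal_lang:
  "path_lang B R = formal_lang B {[x, y] | x y. x \<in> B \<and> y \<in> B \<and> \<not> R x y}"
  using successively_iff_no_forbidden_pair[of _ B R]
  by (auto simp: path_lang_def formal_lang_def words_def)

lemma is_formal_lang_path_lang:
  assumes "finite B"
  shows "is_formal_lang (path_lang B R)"
proof -
  have "{[x, y] | x y. x \<in> B \<and> y \<in> B \<and> \<not> R x y} \<subseteq> (\<lambda>(x, y). [x, y]) ` (B \<times> B)"
    by auto
  then have "finite {[x, y] | x y. x \<in> B \<and> y \<in> B \<and> \<not> R x y}"
    by (rule finite_subset) (use assms in simp)
  then show ?thesis
    unfolding is_formal_lang_def path_lang_eq_formal_lang using assms
    by (intro exI[of _ B] exI[of _ "{[x, y] | x y. x \<in> B \<and> y \<in> B \<and> \<not> R x y}"])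
      (auto simp: words_def)
qed

lemma block_lang_eq_path_lang:
  "block_lang A F = path_lang (block_letters A F) (\<lambda>x y. tl x = butlast y)"
  by (simp add: block_lang_def block_forbidden_def path_lang_eq_formal_lang)

lemma Nil_not_in_path_lang [simp]: "[] \<notin> path_lang B R"
  by (simp add: path_lang_def)

lemma Cons_in_path_lang [simp]:
  "x # w \<in> path_lang B R \<longleftrightarrow> x \<in> B \<and> (w = [] \<or> w \<in> path_lang B R \<and> R x (hd w))"
  by (auto simp: path_lang_def successively_Cons)

lemma append_in_path_lang:
  "u \<noteq> [] \<Longrightarrow> v \<noteq> [] \<Longrightarrow>
     u @ v \<in> path_lang B R \<longleftrightarrow> u \<in> path_lang B R \<and> v \<in> path_lang B R \<and> R (last u) (hd v)"
  by (auto simp: path_lang_def successively_append_iff)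

lemma path_lang_factor_closed: "factor_closed (path_lang B R)"
  by (auto simp: factor_closed_def path_lang_def successively_append_iff)

lemma path_lang_set: "w \<in> path_lang B R \<Longrightarrow> x \<in> set w \<Longrightarrow> x \<in> B"
  by (auto simp: path_lang_def)

text \<open>These are the unions of connected components once orientation is forgotten.
  Connectedness is phrased through them because both directions of the irreducibility criterion
  produce or consume a set of edges rather than a walk.\<close>

definition step_closed :: "'a set \<Rightarrow> ('a \<Rightarrow> 'a \<Rightarrow> bool) \<Rightarrow> 'a set \<Rightarrow> bool" where
  "step_closed B R C \<longleftrightarrow> C \<subseteq> B \<and> (\<forall>x\<in>B. \<forall>y\<in>B. R x y \<longrightarrow> (x \<in> C \<longleftrightarrow> y \<in> C))"

text \<open>The empty set of edges counts as connected, in line with the irreducibility of the empty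
  language.\<close>

definition step_connected :: "'a set \<Rightarrow> ('a \<Rightarrow> 'a \<Rightarrow> bool) \<Rightarrow> bool" where
  "step_connected B R \<longleftrightarrow> (\<forall>C. step_closed B R C \<longrightarrow> C \<noteq> {} \<longrightarrow> C = B)"

lemma path_in_step_closed:
  assumes "step_closed B R C" "w \<in> path_lang B R" "x \<in> set w" "x \<in> C"
  shows "set w \<subseteq> C"
proof -
  have "\<forall>y\<in>set w. y \<in> C \<longleftrightarrow> hd w \<in> C"
    using assms(2)
  proof (induction w)
    case (Cons z w)
    show ?case
    proof (cases "w = []")
      case False
      then have "hd w \<in> B" "z \<in> B" "R z (hd w)" "w \<in> path_lang B R"
        using Cons.prems path_lang_set[of w B R "hd w"] by auto
      then show ?thesis
        using Cons.IH assms(1) by (auto simp: step_closed_def)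
    qed simp
  qed simp
  then show ?thesis using assms(3,4) by blast
qed

text \<open>The letters mapped into a fixed component are closed under composability, since
  \<open>[x, y]\<close> and its two letters share a component. Connectedness then puts all letters,
  hence all words, into this component and leaves nothing for a second one.\<close>

lemma alg_irreducible_if_step_connected:
  assumes "step_connected B R"
  shows "alg_irreducible (path_lang B R)"
  unfolding alg_irreducible_def
proof (safe)
  fix \<M> :: "nat list set set" and \<phi>
  assume dec: "decomposition (path_lang B R) \<M> \<phi>" and "card \<M> \<ge> 2"
  interpret decomposed "path_lang B R" \<M> \<phi>
    by unfold_locales (fact dec)
  obtain M N where MN: "M \<in> \<M>" "N \<in> \<M>" "M \<noteq> N"
    using \<open>card \<M> \<ge> 2\<close> by (metis card_2_iff' obtain_subset_with_card_n subsetD)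
  have ex: "\<exists>w\<in>path_lang B R. \<phi> w \<in> K" if "K \<in> \<M>" for K
  proof -
    obtain v where "v \<in> K" using component_nonempty \<open>K \<in> \<M>\<close> by blast
    then have "v \<in> \<phi> ` path_lang B R"
      using bij_betw_imp_surj_on[OF bij] \<open>K \<in> \<M>\<close> by blast
    then show ?thesis using \<open>v \<in> K\<close> by blast
  qed
  have hd: "\<phi> [hd w] \<in> M \<longleftrightarrow> \<phi> w \<in> M" if "w \<in> path_lang B R" for w
    using that same_component(1)[of "[hd w]" "tl w" M] MN(1) by (cases w) auto
  define C where "C = {x \<in> B. \<phi> [x] \<in> M}"
  have "step_closed B R C"
    using same_component[of "[x]" "[y]" M for x y] MN(1) by (auto simp: C_def step_closed_def)
  moreover have "C \<noteq> {}"
    using ex[OF MN(1)] hd by (force simp: C_def path_lang_def)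
  ultimately have "C = B"
    using assms by (simp add: step_connected_def)
  moreover obtain w where w: "w \<in> path_lang B R" "\<phi> w \<in> N"
    using ex[OF MN(2)] by blast
  ultimately have "hd w \<in> C"
    by (auto simp: path_lang_def)
  then have "\<phi> w \<in> M"
    using hd[OF w(1)] by (simp add: C_def)
  then show False
    using disjoint MN w(2) by blast
qed

text \<open>A partition into closed sets splits the paths, because a path cannot leave the closed
  set of its first edge. The renaming \<open>f\<close> with inverse \<open>g\<close> moves the parts
  to another letter type: to \<open>nat\<close>, as \<open>alg_irreducible\<close> demands, or by
  \<open>id\<close> when components are exhibited. Injectivity of \<open>P\<close> keeps the number
  of parts.\<close>

lemma path_decomposition:
  fixes B :: "'a set" and f :: "'a \<Rightarrow> 'b"
  assumes "finite B" and g: "\<And>x. x \<in> B \<Longrightarrow> g (f x) = x"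
    and \<C>: "\<Union>\<C> = B" "{} \<notin> \<C>"
    and disj: "\<And>C D x. C \<in> \<C> \<Longrightarrow> D \<in> \<C> \<Longrightarrow> x \<in> C \<Longrightarrow> x \<in> D \<Longrightarrow> C = D"
    and closed: "\<And>C. C \<in> \<C> \<Longrightarrow> step_closed B R C"
  defines "P \<equiv> \<lambda>C. path_lang (f ` C) (\<lambda>i j. R (g i) (g j))"
  shows "decomposition (path_lang B R) (P ` \<C>) (map f)" "inj_on P \<C>"
proof -
  have map_iff: "map f w \<in> P C \<longleftrightarrow> w \<in> path_lang C R" if "set w \<subseteq> B" "C \<in> \<C>" for w C
  proof -
    have "f ` set w \<subseteq> f ` C \<longleftrightarrow> set w \<subseteq> C"
    proof
      assume "f ` set w \<subseteq> f ` C"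
      then have "g ` f ` set w \<subseteq> g ` f ` C" by blast
      moreover have "g ` f ` D = D" if "D \<subseteq> B" for D
        using that g by (force simp: image_image)
      ultimately show "set w \<subseteq> C"
        using that \<C> by (metis Union_upper)
    qed blast
    moreover have "successively (\<lambda>x y. R (g (f x)) (g (f y))) w \<longleftrightarrow> successively R w"
      using that g by (intro successively_cong) (auto simp: subset_iff)
    ultimately show ?thesis
      by (simp add: P_def path_lang_def successively_map)
  qed
  have mem: "set v \<subseteq> f ` C" if "v \<in> P C" for v C
    using that by (auto simp: P_def path_lang_def)
  have inv: "\<exists>w. set w \<subseteq> C \<and> v = map f w" if "v \<in> P C" for v C
  proof -
    have "v \<in> lists (f ` C)"
      using mem[OF that] by (auto simp: lists_eq_set)
    then show ?thesis
      unfolding lists_image by (auto simp: lists_eq_set)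
  qed
  have map_Union_iff: "map f w \<in> \<Union>(P ` \<C>) \<longleftrightarrow> w \<in> path_lang B R" if w: "set w \<subseteq> B" for w
  proof
    assume "map f w \<in> \<Union>(P ` \<C>)"
    then obtain C where "C \<in> \<C>" "map f w \<in> P C" by blast
    then show "w \<in> path_lang B R"
      using map_iff[OF w] w by (simp add: path_lang_def)
  next
    assume p: "w \<in> path_lang B R"
    then have hd: "hd w \<in> set w" by (cases w) auto
    then obtain C where C: "C \<in> \<C>" "hd w \<in> C"
      using \<C>(1) w by blast
    have "set w \<subseteq> C"
      by (rule path_in_step_closed[OF closed p hd]) fact+
    then have "map f w \<in> P C"
      using C(1) p w map_iff by (simp add: path_lang_def)
    then show "map f w \<in> \<Union>(P ` \<C>)"
      using C(1) by blast
  qed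
  have inj: "inj_on (map f) (path_lang B R)"
    by (rule inj_on_inverseI[of _ "map g"]) (auto simp: path_lang_def g subset_iff intro!: map_idI)
  have image: "map f ` path_lang B R = \<Union>(P ` \<C>)"
  proof
    show "map f ` path_lang B R \<subseteq> \<Union>(P ` \<C>)"
      using map_Union_iff by (auto simp: path_lang_def simp del: UN_iff)
    show "\<Union>(P ` \<C>) \<subseteq> map f ` path_lang B R"
    proof
      fix v assume v: "v \<in> \<Union>(P ` \<C>)"
      then obtain C w where "C \<in> \<C>" "set w \<subseteq> C" "v = map f w"
        using inv by blast
      moreover from this have "set w \<subseteq> B" using \<C> by blast
      ultimately show "v \<in> map f ` path_lang B R"
        using map_Union_iff v by blast
    qed
  qed
  have "partial_iso (map f) (path_lang B R) (\<Union>(P ` \<C>))"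
    unfolding partial_iso_def bij_betw_def
  proof (intro conjI ballI)
    fix u v assume "u \<in> path_lang B R" "v \<in> path_lang B R"
    then show "u @ v \<in> path_lang B R \<longleftrightarrow> map f u @ map f v \<in> \<Union>(P ` \<C>)"
      using map_Union_iff[of "u @ v"] by (auto simp: path_lang_def simp del: UN_iff)
  qed (use inj image in auto)
  moreover have disj_P: "disjnt (P C) (P D)" if "C \<in> \<C>" "D \<in> \<C>" "C \<noteq> D" for C D
  proof -
    have False if "v \<in> P C" "v \<in> P D" for v
    proof -
      have "v \<noteq> []" using that by (auto simp: P_def)
      then have "hd v \<in> f ` C \<inter> f ` D"
        using mem[OF that(1)] mem[OF that(2)] by (auto simp: subset_iff)
      then obtain x y where "x \<in> C" "y \<in> D" "f x = f y" by auto
      then have "x = y" using g \<C> \<open>C \<in> \<C>\<close> \<open>D \<in> \<C>\<close> by (metis UnionI)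
      then show False
        using disj \<open>x \<in> C\<close> \<open>y \<in> D\<close> \<open>C \<in> \<C>\<close> \<open>D \<in> \<C>\<close> \<open>C \<noteq> D\<close> by blast
    qed
    then show ?thesis by (auto simp: disjnt_def)
  qed
  moreover have nonempty: "P C \<noteq> {}" if "C \<in> \<C>" for C
  proof -
    obtain x where "x \<in> C" using \<open>C \<in> \<C>\<close> \<C>(2) by (cases "C = {}") auto
    then have "[f x] \<in> P C" by (simp add: P_def)
    then show ?thesis by blast
  qed
  moreover have fin: "finite \<C>"
    using assms(1) \<C> by (simp add: finite_UnionD)
  moreover have "is_formal_lang (P C)" if "C \<in> \<C>" for C
  proof -
    have "finite C" using assms(1) \<C> that by (meson Union_upper finite_subset)
    then show ?thesis unfolding P_def by (intro is_formal_lang_path_lang) simp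
  qed
  ultimately show "decomposition (path_lang B R) (P ` \<C>) (map f)"
    unfolding decomposition_def pairwise_def by auto
  show "inj_on P \<C>"
    using disj_P nonempty by (intro inj_onI) (metis disjnt_self_iff_empty)
qed

text \<open>A proper non-empty closed set and its complement would decompose the language into two
  parts.\<close>

lemma step_connected_if_alg_irreducible:
  assumes "finite B" "alg_irreducible (path_lang B R)"
  shows "step_connected B R"
  unfolding step_connected_def
proof (intro allI impI, rule ccontr)
  fix C assume C: "step_closed B R C" "C \<noteq> {}" "C \<noteq> B"
  \<comment> \<open>\<open>alg_irreducible\<close> quantifies over languages with letters in
    \<open>nat\<close>, so the edges are numbered.\<close>
  obtain f :: "'a \<Rightarrow> nat" where "inj_on f B"
    using finite_imp_inj_to_nat_seg[OF assms(1)] by blast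
  then have f: "\<And>x. x \<in> B \<Longrightarrow> inv_into B f (f x) = x" by simp
  have sub: "C \<subseteq> B" using C by (simp add: step_closed_def)
  have closed: "step_closed B R (B - C)" using C(1) by (auto simp: step_closed_def)
  have "C \<noteq> B - C" using C sub by blast
  then have two: "card {C, B - C} = 2" by simp
  let ?P = "\<lambda>C. path_lang (f ` C) (\<lambda>i j. R (inv_into B f i) (inv_into B f j))"
  have "decomposition (path_lang B R) (?P ` {C, B - C}) (map f)" "inj_on ?P {C, B - C}"
    by (rule path_decomposition[where f = f and g = "inv_into B f", OF assms(1) f]; use C sub closed in blast)+
  then show False
    using assms(2) card_image[of ?P "{C, B - C}"] two unfolding alg_irreducible_def by fastforce
qed

lemma alg_components_path_lang_exist:
  assumes "finite B"
  shows "\<exists>\<M>. alg_components (path_lang B R) \<M> id"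
proof -
  \<comment> \<open>The connected component of \<open>x\<close>, obtained as the least closed set
    containing it.\<close>
  define cls where "cls x = \<Inter>{C. step_closed B R C \<and> x \<in> C}" for x
  have top: "step_closed B R B" by (simp add: step_closed_def)
  have closed: "step_closed B R (cls x)" if "x \<in> B" for x
    using top that unfolding cls_def step_closed_def by blast
  have least: "cls x \<subseteq> C" if "step_closed B R C" "x \<in> C" for x C
    using that by (auto simp: cls_def)
  have self: "x \<in> cls x" for x by (auto simp: cls_def)
  have sub: "cls x \<subseteq> B" if "x \<in> B" for x
    using least[OF top that] .
  \<comment> \<open>Complements of closed sets are closed, so otherwise the component of
    \<open>y\<close> could be cut out of the least closed set around \<open>x\<close>.\<close>
  have symm: "x \<in> cls y" if "x \<in> B" "y \<in> cls x" for x y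
  proof (rule ccontr)
    assume "x \<notin> cls y"
    moreover have "y \<in> B" using sub that by blast
    then have "step_closed B R (B - cls y)"
      using closed[of y] unfolding step_closed_def by blast
    ultimately have "cls x \<subseteq> B - cls y"
      using least that(1) by blast
    then show False using that(2) self[of y] by blast
  qed
  have eq: "cls x = cls y" if "x \<in> B" "y \<in> cls x" for x y
    using that least[OF closed, of x y] least[OF closed, of y x] symm sub by blast
  \<comment> \<open>A set closed within a component is closed in all of \<open>B\<close>, and
    minimality makes it the whole component.\<close>
  have conn: "step_connected (cls x) R" if x: "x \<in> B" for x
    unfolding step_connected_def
  proof (intro allI impI)
    fix C assume C: "step_closed (cls x) R C" "C \<noteq> {}"
    then have "step_closed B R C"
      using closed[OF x] unfolding step_closed_def by blast
    moreover obtain y where "y \<in> C" using C(2) by blast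
    ultimately have "cls y \<subseteq> C" by (rule least)
    then show "C = cls x"
      using C(1) \<open>y \<in> C\<close> eq[OF x, of y] by (auto simp: step_closed_def)
  qed
  let ?P = "\<lambda>C. path_lang (id ` C) (\<lambda>i j. R (id i) (id j))"
  have "decomposition (path_lang B R) (?P ` (cls ` B)) (map id)"
  proof (rule path_decomposition(1)[OF assms])
    show "\<Union> (cls ` B) = B" using sub self by blast
    show "{} \<notin> cls ` B" using self by blast
    show "C = D" if "C \<in> cls ` B" "D \<in> cls ` B" "x \<in> C" "x \<in> D" for C D x
      using that eq by blast
  qed (use closed in auto)
  then have "alg_components (path_lang B R) (?P ` (cls ` B)) id"
    using alg_irreducible_if_step_connected[OF conn] by (auto simp: alg_components_def)
  then show ?thesis by blast
qed

section \<open>Centers of path algebras\<close>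

lemma coef_mult_letter_right:
  fixes a :: "'a list \<Rightarrow>\<^sub>0 'k::field"
  assumes "x \<in> L" "x \<noteq> []"
  shows "coef (mult L a (word_elt [e])) x = (if last x = e then coef a (butlast x) else 0)"
proof -
  have *: "drop i x = [e] \<longleftrightarrow> i = length x - 1 \<and> last x = e" if "i \<le> length x" for i
    using assms(2) that by (cases x rule: rev_cases) (auto simp: append_eq_Cons_conv le_Suc_eq)
  have "coef (mult L a (word_elt [e])) x
      = (\<Sum>i\<le>length x. if i = length x - 1 \<and> last x = e then coef a (take i x) else 0)"
    using assms(1) by (auto simp: coef_mult lookup_single when_def eq_commute[of "[e]"] * intro!: sum.cong)
  also have "\<dots> = (if last x = e then coef a (butlast x) else 0)"
    by (simp add: butlast_conv_take)
  finally show ?thesis .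
qed

lemma coef_mult_letter_left:
  fixes a :: "'a list \<Rightarrow>\<^sub>0 'k::field"
  assumes "x \<in> L" "x \<noteq> []"
  shows "coef (mult L (word_elt [e]) a) x = (if hd x = e then coef a (tl x) else 0)"
proof -
  have *: "take i x = [e] \<longleftrightarrow> i = 1 \<and> hd x = e" if "i \<le> length x" for i
    using assms(2) that by (cases x; cases i) auto
  have "coef (mult L (word_elt [e]) a) x
      = (\<Sum>i\<le>length x. if i = 1 \<and> hd x = e then coef a (drop i x) else 0)"
    using assms(1) by (auto simp: coef_mult lookup_single when_def eq_commute[of "[e]"] * intro!: sum.cong)
  also have "\<dots> = (if hd x = e then coef a (tl x) else 0)"
  proof -
    have "1 \<le> length x" using assms(2) by (cases x) auto
    then show ?thesis by (simp add: drop_Suc)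
  qed
  finally show ?thesis .
qed

text \<open>Commutation with the letters \<open>hd x\<close> and \<open>last x\<close>, compared at
  \<open>x\<close>: multiplication by a letter adds it at one end, so only the two factors of
  \<open>x\<close> that are shorter by one letter are involved.\<close>

lemma center_coef:
  assumes "a \<in> center (path_lang B R)" "x \<in> path_lang B R"
  shows "hd x = last x \<Longrightarrow> coef a (butlast x) = coef a (tl x)"
    and "hd x \<noteq> last x \<Longrightarrow> coef a (butlast x) = 0"
    and "hd x \<noteq> last x \<Longrightarrow> coef a (tl x) = 0"
proof -
  have ne: "x \<noteq> []" using assms(2) by auto
  have "(if last x = e then coef a (butlast x) else 0) = (if hd x = e then coef a (tl x) else 0)"
    if "e \<in> set x" for e
  proof -
    have "[e] \<in> path_lang B R" using path_lang_set[OF assms(2) that] by simp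
    then show ?thesis
      using assms ne coef_mult_letter_right[OF assms(2) ne, of a e]
        coef_mult_letter_left[OF assms(2) ne, of e a] by (simp add: center_iff_words)
  qed
  from this[of "hd x"] this[of "last x"]
  show "hd x = last x \<Longrightarrow> coef a (butlast x) = coef a (tl x)"
    and "hd x \<noteq> last x \<Longrightarrow> coef a (butlast x) = 0"
    and "hd x \<noteq> last x \<Longrightarrow> coef a (tl x) = 0"
    using ne by (auto split: if_splits)
qed

lemma center_letters_right:
  assumes a: "a \<in> center (path_lang B R)" and v: "coef a v \<noteq> 0" and e: "e \<in> B" "R (last v) e"
  shows "hd v = e" "coef a (rotate1 v) = coef a v"
proof -
  have "v \<in> path_lang B R"
    using a v by (auto simp: center_def lang_alg_iff)
  then have x: "v @ [e] \<in> path_lang B R" "v \<noteq> []"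
    using e by (cases "v = []"; simp add: append_in_path_lang)+
  then show "hd v = e"
    using center_coef(2)[OF a x(1)] v by auto
  then show "coef a (rotate1 v) = coef a v"
    using center_coef(1)[OF a x(1)] x(2) by (cases v) auto
qed

lemma center_letters_left:
  assumes a: "a \<in> center (path_lang B R)" and v: "coef a v \<noteq> 0" and e: "e \<in> B" "R e (hd v)"
  shows "last v = e"
proof -
  have "v \<in> path_lang B R"
    using a v by (auto simp: center_def lang_alg_iff)
  then have x: "e # v \<in> path_lang B R" "v \<noteq> []"
    using e by auto
  then show ?thesis
    using center_coef(3)[OF a x(1)] v by auto
qed

text \<open>On \<open>B\<close> the relation is exactly the cyclic successor, with no further
  adjacencies; a single loop is the case of length 1. Keeping \<open>R\<close> abstract lets one
  development serve the free language on one letter and block languages.\<close>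

definition cycle_on :: "'a set \<Rightarrow> ('a \<Rightarrow> 'a \<Rightarrow> bool) \<Rightarrow> 'a list \<Rightarrow> bool" where
  "cycle_on B R ws \<longleftrightarrow> ws \<noteq> [] \<and> distinct ws \<and> set ws = B \<and>
     (\<forall>i<length ws. \<forall>y\<in>B. R (ws ! i) y \<longleftrightarrow> y = ws ! (Suc i mod length ws))"

text \<open>Distinctness of the words without their last letter says that an edge has at most one
  successor, which turns the listed steps into an equivalence.\<close>

lemma cycle_on_iff_cyclic_listing:
  "cycle_on B (\<lambda>x y. tl x = butlast y) ws \<longleftrightarrow> cyclic_listing B ws"
proof (cases "ws = []")
  case False
  define n where "n = length ws"
  have n: "n > 0" using False by (simp add: n_def)
  have steps: "(\<forall>i. Suc i < n \<longrightarrow> tl (ws ! i) = butlast (ws ! Suc i)) \<and> tl (last ws) = butlast (hd ws)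
      \<longleftrightarrow> (\<forall>i<n. tl (ws ! i) = butlast (ws ! (Suc i mod n)))" (is "?l \<longleftrightarrow> ?r")
  proof
    assume ?l
    show ?r
    proof (intro allI impI)
      fix i assume "i < n"
      show "tl (ws ! i) = butlast (ws ! (Suc i mod n))"
      proof (cases "Suc i = n")
        case True
        then have "i = n - 1" by simp
        then show ?thesis
          using True \<open>?l\<close> False by (auto simp: last_conv_nth hd_conv_nth n_def)
      next
        case False
        then show ?thesis using \<open>?l\<close> \<open>i < n\<close> by simp
      qed
    qed
  next
    assume r: ?r
    have "tl (ws ! i) = butlast (ws ! Suc i)" if "Suc i < n" for i
      using r[rule_format, of i] that by simp
    moreover have "tl (last ws) = butlast (hd ws)"
      using r[rule_format, of "n - 1"] n False by (simp add: last_conv_nth hd_conv_nth n_def)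
    ultimately show ?l by blast
  qed
  show ?thesis
  proof
    assume c: "cycle_on B (\<lambda>x y. tl x = butlast y) ws"
    have dist: "distinct ws" and set: "set ws = B"
      and R: "\<And>i y. i < n \<Longrightarrow> y \<in> B \<Longrightarrow> tl (ws ! i) = butlast y \<longleftrightarrow> y = ws ! (Suc i mod n)"
      using c by (auto simp: cycle_on_def n_def)
    have inB: "ws ! (i mod n) \<in> B" for i
      using set n by (auto simp: n_def)
    have "inj_on butlast (set ws)"
    proof (rule inj_onI)
      fix x y assume x: "x \<in> set ws" and y: "y \<in> set ws" and eq: "butlast x = butlast y"
      then obtain i where i: "x = ws ! i" "i < n"
        by (auto simp: in_set_conv_nth n_def)
      \<comment> \<open>The predecessor of \<open>i\<close> on the cycle; \<open>n\<close> is added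
        before subtracting so that \<open>i = 0\<close> causes no truncation.\<close>
      define p where "p = (i + n - 1) mod n"
      have p: "Suc p mod n = i" "p < n"
        using i(2) n by (simp_all add: p_def mod_Suc_eq)
      have "tl (ws ! p) = butlast x"
        using R[OF p(2), of x] x set i p by simp
      then have "y = ws ! (Suc p mod n)"
        using R[OF p(2), of y] y set eq by simp
      then show "x = y" using p i by simp
    qed
    moreover have "\<forall>i<n. tl (ws ! i) = butlast (ws ! (Suc i mod n))"
      using R inB by blast
    ultimately show "cyclic_listing B ws"
      using steps False dist set by (simp add: cyclic_listing_def distinct_map n_def)
  next
    assume c: "cyclic_listing B ws"
    have dist: "distinct ws" and set: "set ws = B" and inj: "inj_on butlast B"
      and R: "\<And>i. i < n \<Longrightarrow> tl (ws ! i) = butlast (ws ! (Suc i mod n))"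
      using c steps by (auto simp: cyclic_listing_def distinct_map n_def)
    have inB: "ws ! (i mod n) \<in> B" for i
      using set n by (auto simp: n_def)
    have "tl (ws ! i) = butlast y \<longleftrightarrow> y = ws ! (Suc i mod n)" if "i < n" "y \<in> B" for i y
      using R[OF that(1)] inj_on_eq_iff[OF inj that(2) inB, of "Suc i"] by (simp only: eq_commute[of "butlast y"])
    then show "cycle_on B (\<lambda>x y. tl x = butlast y) ws"
      using False dist set by (simp add: cycle_on_def n_def)
  qed
qed (simp add: cycle_on_def cyclic_listing_def)

text \<open>An extendable word in the support of a central element closes up, its rotations stay in
  the support, and its letters have no neighbours off the cycle.\<close>

lemma center_extendable_imp_cycle:
  assumes conn: "step_connected B R" and a: "a \<in> center (path_lang B R)"
    and w: "coef a w \<noteq> 0" "\<not> two_sided_unextendable B (path_lang B R) w"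
  shows "\<exists>ws. cycle_on B R ws"
proof -
  have wL: "v \<in> path_lang B R" "v \<noteq> []" if "coef a v \<noteq> 0" for v
    using a that by (auto simp: center_def lang_alg_iff)
  have inB: "hd v \<in> B" "last v \<in> B" if "coef a v \<noteq> 0" for v
    using wL[OF that] path_lang_set[of v B R] by simp_all
  have "\<exists>e\<in>B. R e (hd w) \<or> R (last w) e"
    using w(2) wL[OF w(1)] by (auto simp: two_sided_unextendable_def append_in_path_lang)
  then have closed: "R (last w) (hd w)"
    using center_letters_left[OF a w(1)] center_letters_right(1)[OF a w(1)] by auto
  have step: "coef a (rotate1 v) \<noteq> 0 \<and> R (last (rotate1 v)) (hd (rotate1 v))"
    if "coef a v \<noteq> 0" "R (last v) (hd v)" for v
    using that center_letters_right(2)[OF a that(1) inB(1)[OF that(1)] that(2)] wL[OF that(1)]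
    by (cases v) (auto split: if_splits)
  have rot: "coef a (rotate i w) \<noteq> 0 \<and> R (last (rotate i w)) (hd (rotate i w))" for i
    by (induction i) (use w closed step in auto)
  define n where "n = length w"
  have n: "n > 0" using wL[OF w(1)] by (simp add: n_def)
  \<comment> \<open>The letters of \<open>w\<close> continued periodically; the rotations of
    \<open>w\<close> are windows of this sequence, and each has a nonzero coefficient.\<close>
  define c where "c i = w ! (i mod n)" for i
  have hd_rot: "hd (rotate i w) = c i" for i
    using hd_rotate_conv_nth[of w i] n by (simp add: c_def n_def)
  have last_rot: "last (rotate (Suc i) w) = c i" for i
  proof -
    have "rotate i w \<noteq> []" using n by (auto simp: n_def)
    then have "last (rotate1 (rotate i w)) = hd (rotate i w)"
      by (cases "rotate i w") auto
    then show ?thesis by (simp add: hd_rot)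
  qed
  have cB: "c i \<in> B" for i
    using inB(1)[of "rotate i w"] rot[of i] by (simp add: hd_rot)
  have R: "R (c i) (c (Suc i))" for i
    using rot[of "Suc i"] by (simp only: hd_rot last_rot)
  have succ: "e = c (Suc i)" if "e \<in> B" "R (c i) e" for e i
    using center_letters_right(1)[OF a, of "rotate (Suc i) w" e] rot[of "Suc i"] that
    by (simp add: hd_rot last_rot del: rotate_Suc)
  have pred: "e = c i" if "e \<in> B" "R e (c (Suc i))" for e i
    using center_letters_left[OF a, of "rotate (Suc i) w" e] rot[of "Suc i"] that
    by (simp add: hd_rot last_rot del: rotate_Suc)
  have range: "range c = B"
  proof -
    \<comment> \<open>Every index is replaced by a successor index, since \<open>pred\<close> speaks
      of \<open>c (Suc i)\<close>.\<close>
    have Suc_n: "c (Suc (i + n - 1)) = c i" for i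
      using n by (simp add: c_def)
    have "step_closed B R (range c)"
      unfolding step_closed_def
    proof (intro conjI ballI impI iffI)
      fix x y assume "x \<in> B" "y \<in> B" "R x y"
      show "y \<in> range c" if "x \<in> range c"
        using that succ \<open>y \<in> B\<close> \<open>R x y\<close> by auto
      show "x \<in> range c" if y: "y \<in> range c"
      proof -
        obtain i where "y = c (Suc (i + n - 1))" using y Suc_n by auto
        then show ?thesis using pred \<open>x \<in> B\<close> \<open>R x y\<close> by blast
      qed
    qed (use cB in auto)
    then show ?thesis using conn by (auto simp: step_connected_def)
  qed
  \<comment> \<open>\<open>w\<close> may run around the cycle several times, so the list must stop
    at the first return to \<open>c 0\<close> and not at \<open>n\<close>.\<close>
  define m where "m = (LEAST m. m > 0 \<and> c m = c 0)"
  have m: "m > 0" "c m = c 0"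
    using LeastI[of "\<lambda>m. m > 0 \<and> c m = c 0" n] n by (simp_all add: m_def c_def)
  have m_least: "\<not> (k > 0 \<and> c k = c 0)" if "k < m" for k
    using not_less_Least[of k "\<lambda>m. m > 0 \<and> c m = c 0"] that by (simp add: m_def)
  \<comment> \<open>Uniqueness of predecessors pushes a repetition back to index 0, where minimality
    of \<open>m\<close> rules it out.\<close>
  have rewind: "c k = c 0" if "c (i + k) = c i" for i k
    using that
  proof (induction i)
    case (Suc i)
    then have "R (c (i + k)) (c (Suc i))" using R[of "i + k"] by simp
    then show ?case using Suc.IH pred cB by metis
  qed simp
  have inj: "i = j" if "c i = c j" "i \<le> j" "j < m" for i j
    using rewind[of i "j - i"] m_least[of "j - i"] that
    by (cases "i = j") (auto simp: less_imp_diff_less)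
  have periodic: "c (i + m) = c i" for i
  proof (induction i)
    case (Suc i)
    then have "R (c i) (c (Suc i + m))" using R[of "i + m"] by simp
    then show ?case using succ cB by metis
  qed (simp add: m)
  have periodic_mult: "c (i + m * k) = c i" for i k
  proof (induction k)
    case (Suc k)
    have "i + m * Suc k = i + m * k + m" by simp
    then show ?case using Suc periodic by metis
  qed simp
  have c_mod: "c (i mod m) = c i" for i
    using periodic_mult[of "i mod m" "i div m"] by simp
  have "cycle_on B R (map c [0..<m])"
    unfolding cycle_on_def
  proof (intro conjI allI impI ballI)
    show "distinct (map c [0..<m])"
      unfolding distinct_map
    proof (intro conjI inj_onI)
      fix i j assume "i \<in> set [0..<m]" "j \<in> set [0..<m]" "c i = c j"
      then show "i = j" using inj[of i j] inj[of j i] by (cases "i \<le> j") auto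
    qed simp
    have "c i \<in> c ` {0..<m}" for i
      using c_mod[of i] m by (metis atLeastLessThan_iff imageI le0 mod_less_divisor)
    then show "set (map c [0..<m]) = B"
      using range by auto
  next
    fix i y assume i: "i < length (map c [0..<m])" and y: "y \<in> B"
    have "c (Suc i mod m) = c (Suc i)" using c_mod by simp
    then show "R (map c [0..<m] ! i) y \<longleftrightarrow> y = map c [0..<m] ! (Suc i mod length (map c [0..<m]))"
      using i y m succ[OF y] R[of i] by auto
  qed (use m in simp)
  then show ?thesis by blast
qed

section \<open>Connected graphs that are not cycles\<close>

lemma unextendable_append:
  assumes "two_sided_unextendable B (path_lang B R) u"
  shows "v \<noteq> [] \<Longrightarrow> u @ v \<notin> path_lang B R" "v \<noteq> [] \<Longrightarrow> v @ u \<notin> path_lang B R"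
proof -
  assume v: "v \<noteq> []"
  show "u @ v \<notin> path_lang B R"
  proof
    assume *: "u @ v \<in> path_lang B R"
    obtain e v' where e: "v = [e] @ v'" using v by (cases v) auto
    then have "u @ [e] \<in> path_lang B R" "e \<in> B"
      using factor_closedD(2)[OF path_lang_factor_closed, of "u @ [e]" v'] *
        path_lang_set[OF *, of e] by simp_all
    then show False using assms by (auto simp: two_sided_unextendable_def)
  qed
  show "v @ u \<notin> path_lang B R"
  proof
    assume *: "v @ u \<in> path_lang B R"
    obtain e v' where e: "v = v' @ [e]" using v by (cases v rule: rev_cases) auto
    then have "e # u \<in> path_lang B R" "e \<in> B"
      using factor_closedD(3)[OF path_lang_factor_closed, of v' "e # u"] *
        path_lang_set[OF *, of e] by simp_all
    then show False using assms by (auto simp: two_sided_unextendable_def)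
  qed
qed

text \<open>An unextendable word annihilates the algebra from both sides and is therefore central;
  an extendable word in the support would force a cycle.\<close>

theorem center_path_lang_noncyclic:
  assumes "step_connected B R" "\<nexists>ws. cycle_on B R ws"
  shows "(center (path_lang B R) :: ('a list \<Rightarrow>\<^sub>0 'k::field) set) =
    lin_span {word_elt w | w. w \<in> path_lang B R \<and> two_sided_unextendable B (path_lang B R) w}"
    (is "_ = lin_span {word_elt w | w. w \<in> ?L \<and> ?U w}")
proof -
  have "center ?L = (lang_alg {w \<in> ?L. ?U w} :: ('a list \<Rightarrow>\<^sub>0 'k) set)"
  proof (intro equalityI subsetI)
    fix a :: "'a list \<Rightarrow>\<^sub>0 'k" assume a: "a \<in> center ?L"
    then have "a \<in> lang_alg ?L" by (simp add: center_def)
    then show "a \<in> lang_alg {w \<in> ?L. ?U w}"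
      using center_extendable_imp_cycle[OF assms(1) a] assms(2)
      by (auto simp: lang_alg_iff)
  next
    fix a :: "'a list \<Rightarrow>\<^sub>0 'k" assume a: "a \<in> lang_alg {w \<in> ?L. ?U w}"
    then have aL: "a \<in> lang_alg ?L" by (auto simp: lang_alg_def)
    have "mult ?L a b = 0 \<and> mult ?L b a = 0" if b: "b \<in> lang_alg ?L" for b
    proof (intro conjI poly_mapping_eqI)
      have 0: "coef a u * coef b v = 0" "coef b v * coef a u = 0"
        if "u @ v \<in> ?L \<or> v @ u \<in> ?L" for u v
      proof -
        \<comment> \<open>The cuts at the ends of \<open>x\<close> have an empty factor and fall
          under one of the first two cases.\<close>
        consider "\<not> (u \<in> ?L \<and> ?U u)" | "v \<notin> ?L" | "?U u" "v \<noteq> []"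
          using Nil_not_in_path_lang[of B R] by blast
        then show "coef a u * coef b v = 0" "coef b v * coef a u = 0"
          using a b that unextendable_append[of B R u v] by (cases; auto simp: lang_alg_iff)+
      qed
      fix x
      show "coef (mult ?L a b) x = coef 0 x"
        unfolding coef_mult using 0(1)[of "take i x" "drop i x" for i]
        by (cases "x \<in> ?L") (simp_all del: mult_eq_0_iff)
      show "coef (mult ?L b a) x = coef 0 x"
        unfolding coef_mult using 0(2)[of "drop i x" "take i x" for i]
        by (cases "x \<in> ?L") (simp_all del: mult_eq_0_iff)
    qed
    then show "a \<in> center ?L" using aL by (simp add: center_def)
  qed
  then show ?thesis
    by (subst (asm) lin_span_words[of "{w \<in> ?L. ?U w}", symmetric]) simp
qed

section \<open>The algebra of a cycle\<close>

locale cycle =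
  fixes B :: "'a set" and R :: "'a \<Rightarrow> 'a \<Rightarrow> bool" and ws :: "'a list"
  assumes cycle_on: "cycle_on B R ws"
begin

abbreviation L :: "'a list set" where "L \<equiv> path_lang B R"

definition n :: nat where "n = length ws"

definition c :: "nat \<Rightarrow> 'a" where "c i = ws ! (i mod n)"

text \<open>Unrolling the cycle turns its paths into intervals of indices, so that concatenation and
  closedness become arithmetic modulo \<open>n\<close>.\<close>

definition arc :: "nat \<Rightarrow> nat \<Rightarrow> 'a list" where "arc s l = map c [s..<s + l]"

lemma n_pos: "n > 0"
  using cycle_on by (simp add: cycle_on_def n_def)

lemma c_in_B: "c i \<in> B"
  using cycle_on n_pos by (auto simp: cycle_on_def c_def n_def)

lemma c_eq_iff: "c i = c j \<longleftrightarrow> i mod n = j mod n"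
  using cycle_on n_pos by (auto simp: cycle_on_def c_def n_def nth_eq_iff_index_eq)

lemma c_surj: "x \<in> B \<Longrightarrow> \<exists>i<n. x = c i"
  using cycle_on by (auto simp: cycle_on_def c_def n_def in_set_conv_nth) (metis mod_less)

lemma R_c_iff: "y \<in> B \<Longrightarrow> R (c i) y \<longleftrightarrow> y = c (Suc i)"
  using cycle_on n_pos by (simp add: cycle_on_def c_def n_def mod_Suc_eq)

lemma length_arc [simp]: "length (arc s l) = l"
  by (simp add: arc_def)

lemma arc_Suc: "arc s (Suc l) = c s # arc (Suc s) l"
  by (simp add: arc_def upt_rec)

lemma nth_arc: "i < l \<Longrightarrow> arc s l ! i = c (s + i)"
  by (simp add: arc_def)

lemma arc_eq_Nil [simp]: "arc s l = [] \<longleftrightarrow> l = 0"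
  by (metis length_0_conv length_arc)

lemma arc_0 [simp]: "arc s 0 = []"
  by simp

lemma hd_arc: "l > 0 \<Longrightarrow> hd (arc s l) = c s"
  by (cases l) (simp_all add: arc_Suc)

lemma arc_add: "arc s (k + l) = arc s k @ arc (s + k) l"
  using upt_add_eq_append[of s "s + k" l] by (simp add: arc_def add.assoc)

lemma take_arc: "k \<le> l \<Longrightarrow> take k (arc s l) = arc s k"
  by (simp add: arc_def take_map)

lemma drop_arc: "drop k (arc s l) = arc (s + k) (l - k)"
  by (rule nth_equalityI) (simp_all add: nth_arc add.assoc)

lemma arc_periodic: "arc (s + n * k) l = arc s l"
proof -
  have "s + n * k + i = (s + i) + k * n" for i by simp
  then have "c (s + n * k + i) = c (s + i)" for i
    by (simp only: c_eq_iff mod_mult_self1)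
  then show ?thesis
    by (intro nth_equalityI) (simp_all add: nth_arc)
qed

lemma arc_in_L: "l > 0 \<Longrightarrow> arc s l \<in> L"
proof (induction l arbitrary: s)
  case (Suc l)
  then show ?case
    by (cases "l = 0") (simp_all add: arc_Suc c_in_B hd_arc R_c_iff)
qed simp

lemma take_in_L:
  assumes "x \<in> L" "i > 0"
  shows "take i x \<in> L"
  using assms factor_closedD(2)[OF path_lang_factor_closed, of "take i x" "drop i x" B R]
  by (cases "x = []") auto

lemma drop_in_L:
  assumes "x \<in> L" "i < length x"
  shows "drop i x \<in> L"
  using assms factor_closedD(3)[OF path_lang_factor_closed, of "take i x" "drop i x" B R]
  by auto

text \<open>Every edge of a cycle has one successor, so a path is determined by its first edge and
  its length.\<close>

lemma L_arc: "w \<in> L \<Longrightarrow> \<exists>s<n. w = arc s (length w)"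
proof (induction w)
  case (Cons x w)
  then obtain s where s: "s < n" "x = c s" using c_surj by auto
  show ?case
  proof (cases "w = []")
    case True
    then show ?thesis using s by (auto simp: arc_def)
  next
    case False
    then have "w \<in> L" "R x (hd w)" using Cons.prems by auto
    then obtain t where t: "w = arc t (length w)" using Cons.IH by blast
    then have "hd w = c t" using False hd_arc[of "length w" t] by simp
    then have "c t = c (Suc s)" using R_c_iff[of "c t" s] \<open>R x (hd w)\<close> s(2) c_in_B by simp
    then have "c (t + i) = c (Suc s + i)" for i
      unfolding c_eq_iff by (metis mod_add_left_eq)
    then have "arc t l = arc (Suc s) l" for l
      by (intro nth_equalityI) (simp_all add: nth_arc)
    then have "x # w = arc s (length (x # w))"
      using s t by (simp add: arc_Suc)
    then show ?thesis using s by blast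
  qed
qed simp

lemma arc_eq_iff:
  assumes "s < n" "t < n" "k > 0"
  shows "arc s k = arc t l \<longleftrightarrow> s = t \<and> k = l"
proof
  assume eq: "arc s k = arc t l"
  have "k = l" using arg_cong[OF eq, of length] by simp
  moreover have "c s = c t" using hd_arc[of k s] hd_arc[of l t] eq assms(3) \<open>k = l\<close> by simp
  ultimately show "s = t \<and> k = l" using assms by (simp add: c_eq_iff)
qed simp

lemma rotate_eq_arc: "rotate i ws = arc i n"
proof (rule nth_equalityI)
  fix j assume "j < length (rotate i ws)"
  then show "rotate i ws ! j = arc i n ! j"
    by (simp add: nth_rotate arc_def c_def n_def add.commute)
qed (simp add: n_def)

text \<open>Full turns from the same start can be concatenated, because shifting an arc by
  \<open>n\<close> does not change it.\<close>

lemma alg_pow_rotate: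
  assumes "m \<ge> 1"
  shows "alg_pow L (word_elt (rotate i ws)) m = word_elt (arc i (n * m))"
proof -
  have "(mult L (word_elt (rotate i ws)) ^^ k) (word_elt (rotate i ws)) = word_elt (arc i (n * Suc k))" for k
  proof (induction k)
    case (Suc k)
    have "arc i n @ arc i (n * Suc k) = arc i (n * Suc (Suc k))"
      using arc_add[of i n "n * Suc k"] arc_periodic[of i 1 "n * Suc k"] by simp
    then show ?case
      using Suc arc_in_L[of "n * Suc (Suc k)" i] n_pos by (simp add: mult_word_elt rotate_eq_arc)
  qed (simp add: rotate_eq_arc)
  from this[of "m - 1"] show ?thesis
    using assms by (simp add: alg_pow_def)
qed

definition rot_sum :: "'k::field poly \<Rightarrow> ('a list \<Rightarrow>\<^sub>0 'k)" where
  "rot_sum f = (\<Sum>i<length ws. poly_eval L f (word_elt (rotate i ws)))"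

text \<open>A path that makes \<open>M\<close> whole turns is a power of exactly one rotation of
  \<open>ws\<close>, so its coefficient depends on its length alone. The computations below work
  with this formula instead of the double sum.\<close>

lemma coef_rot_sum:
  assumes "poly f 0 = 0"
  shows "coef (rot_sum f) w = (if w \<in> L \<and> n dvd length w then coeff f (length w div n) else 0)"
proof -
  have "coef (rot_sum f) w = (\<Sum>i<n. \<Sum>m=1..degree f. coeff f m * of_bool (arc i (n * m) = w))"
    by (simp add: rot_sum_def poly_eval_def n_def[symmetric] lookup_sum alg_pow_rotate lookup_single
        when_def of_bool_def)
  also have "\<dots> = (if w \<in> L \<and> n dvd length w then coeff f (length w div n) else 0)"
  proof (cases "w \<in> L \<and> n dvd length w")
    case True
    then obtain M where M: "length w = n * M" by blast
    moreover obtain s where "s < n" "w = arc s (length w)"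
      using L_arc True by blast
    ultimately have s: "s < n" "w = arc s (length w)" "length w = n * M" by blast+
    have pos: "length w > 0" using True by auto
    then have "M > 0" using s(3) by (cases M) auto
    have eq: "arc i (n * m) = w \<longleftrightarrow> i = s \<and> m = M" if "i < n" for i m
    proof -
      have "arc i (n * m) = w \<longleftrightarrow> arc s (length w) = arc i (n * m)" using s(2) by metis
      also have "\<dots> \<longleftrightarrow> i = s \<and> m = M"
        unfolding arc_eq_iff[OF s(1) that pos] using s(3) n_pos by auto
      finally show ?thesis .
    qed
    \<comment> \<open>When \<open>M\<close> exceeds the degree, the inner sum has no term for
      \<open>M\<close>, and \<open>coeff f M\<close> is zero as well.\<close>
    have "(\<Sum>i<n. \<Sum>m=1..degree f. coeff f m * of_bool (arc i (n * m) = w))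
        = (\<Sum>i<n. if i = s then coeff f M else 0)"
      using \<open>M > 0\<close> by (intro sum.cong refl) (auto simp: eq of_bool_def if_distrib[of "\<lambda>x. _ * x"] coeff_eq_0 cong: if_cong)
    also have "\<dots> = coeff f M" using s(1) by simp
    finally show ?thesis using True s n_pos by simp
  next
    case False
    have "arc i (n * m) \<noteq> w" if "m \<ge> 1" for i m
      using False arc_in_L[of "n * m" i] n_pos that by auto
    then show ?thesis using False by (auto intro!: sum.neutral)
  qed
  finally show ?thesis .
qed

lemma rot_sum_in_lang_alg: "poly f 0 = 0 \<Longrightarrow> rot_sum f \<in> lang_alg L"
  by (simp add: lang_alg_iff coef_rot_sum)

text \<open>A shift of the start by whole turns is invisible. This is why elements supported on
  closed paths, with coefficients depending on length alone, commute with everything.\<close>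

lemma drop_eq_take:
  assumes "x \<in> L" "n dvd i" "i \<le> length x"
  shows "drop i x = take (length x - i) x"
proof -
  obtain s where s: "x = arc s (length x)" using L_arc[OF assms(1)] by blast
  obtain k where k: "i = n * k" using assms(2) by blast
  have "drop i x = arc (s + i) (length x - i)"
    by (subst s) (rule drop_arc)
  moreover have "take (length x - i) x = arc s (length x - i)"
    by (subst s) (simp add: take_arc)
  ultimately show ?thesis using arc_periodic[of s k] k by simp
qed

lemma rot_sum_in_center:
  assumes "poly f 0 = 0"
  shows "rot_sum f \<in> center L"
proof -
  have "mult L (rot_sum f) q = mult L q (rot_sum f)" for q
  proof (rule poly_mapping_eqI)
    fix x
    show "coef (mult L (rot_sum f) q) x = coef (mult L q (rot_sum f)) x"
    proof (cases "x \<in> L")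
      case True
      \<comment> \<open>The coefficients as a function of length; \<open>g 0 = 0\<close> takes care
        of the empty factors.\<close>
      define g where "g i = (if n dvd i then coeff f (i div n) else 0)" for i
      have g0: "g 0 = 0" using assms by (simp add: g_def poly_0_coeff_0)
      have L: "i = 0 \<or> take i x \<in> L" "i = length x \<or> drop i x \<in> L" if "i \<le> length x" for i
        using take_in_L[OF True, of i] drop_in_L[OF True, of i] that by (cases "i = length x"; auto)+
      have t: "coef (rot_sum f) (take i x) = g i" if "i \<le> length x" for i
        using L(1)[OF that] g0 that assms by (auto simp: coef_rot_sum g_def)
      have d: "coef (rot_sum f) (drop i x) = g (length x - i)" if "i \<le> length x" for i
        using L(2)[OF that] g0 that assms by (auto simp: coef_rot_sum g_def)
      have "coef (mult L (rot_sum f) q) x = (\<Sum>i\<le>length x. g i * coef q (drop i x))"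
        using True by (simp add: coef_mult t)
      also have "\<dots> = (\<Sum>i\<le>length x. g i * coef q (take (length x - i) x))"
        using drop_eq_take[OF True] by (intro sum.cong refl) (auto simp: g_def)
      also have "\<dots> = (\<Sum>i\<le>length x. g (length x - i) * coef q (take i x))"
        by (rule sum.reindex_bij_witness[of _ "\<lambda>i. length x - i" "\<lambda>i. length x - i"]) auto
      also have "\<dots> = coef (mult L q (rot_sum f)) x"
        using True by (simp add: coef_mult d mult.commute)
      finally show ?thesis .
    qed (simp add: coef_mult)
  qed
  then show ?thesis
    using rot_sum_in_lang_alg[OF assms] by (simp add: center_def)
qed

text \<open>Compared at the path with one more edge, whose first and last edge agree iff
  \<open>n\<close> divides \<open>l\<close>: in that case consecutive arcs have equal coefficients,
  otherwise the coefficient vanishes.\<close>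

lemma center_coef_arc:
  assumes a: "a \<in> center L" and l: "l > 0"
  shows "coef a (arc s l) = (if n dvd l then coef a (arc 0 l) else 0)"
proof -
  have x: "hd (arc s (Suc l)) = c s" "last (arc s (Suc l)) = c (s + l)"
    "tl (arc s (Suc l)) = arc (Suc s) l" "butlast (arc s (Suc l)) = arc s l" for s
  proof -
    have "arc s (Suc l) = arc s l @ [c (s + l)]" by (simp add: arc_def)
    then show "last (arc s (Suc l)) = c (s + l)" "butlast (arc s (Suc l)) = arc s l"
      by simp_all
  qed (simp_all add: arc_Suc)
  have eq: "c s = c (s + l) \<longleftrightarrow> n dvd l" for s
    using mod_eq_dvd_iff_nat[of s "s + l" n] by (auto simp: c_eq_iff)
  show ?thesis
  proof (cases "n dvd l")
    case True
    have "coef a (arc s l) = coef a (arc 0 l)" for s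
    proof (induction s)
      case (Suc s)
      have "coef a (butlast (arc s (Suc l))) = coef a (tl (arc s (Suc l)))"
        by (rule center_coef(1)[OF a arc_in_L]) (simp_all only: x eq True zero_less_Suc)
      then show ?case using Suc by (simp only: x)
    qed simp
    then show ?thesis using True by simp
  next
    case False
    have "coef a (butlast (arc s (Suc l))) = 0"
      by (rule center_coef(2)[OF a arc_in_L]) (simp_all only: x eq False zero_less_Suc not_False_eq_True)
    then show ?thesis using False by (simp only: x if_False)
  qed
qed

text \<open>The polynomial is read off from the closed paths that start with
  \<open>c 0\<close>.\<close>

lemma center_eq_rot_sum:
  fixes a :: "'a list \<Rightarrow>\<^sub>0 'k::field"
  assumes a: "a \<in> center L"
  shows "\<exists>f. poly f 0 = 0 \<and> a = rot_sum f"
proof -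
  have aL: "a \<in> lang_alg L" using a by (simp add: center_def)
  \<comment> \<open>A crude bound for the degree: no word of the support is longer than the sum of
    all lengths.\<close>
  define N where "N = (\<Sum>w\<in>supp a. length w)"
  define f :: "'k poly" where "f = (\<Sum>m=1..N. monom (coef a (arc 0 (n * m))) m)"
  have bound: "m \<le> N" if "coef a (arc 0 (n * m)) \<noteq> 0" for m
  proof -
    have "arc 0 (n * m) \<in> supp a" using that by (simp add: in_keys_iff)
    then have "length (arc 0 (n * m)) \<le> N"
      unfolding N_def by (intro member_le_sum) auto
    moreover have "m \<le> n * m" using n_pos by simp
    ultimately show ?thesis by (metis length_arc le_trans)
  qed
  have coeff: "coeff f m = (if m = 0 then 0 else coef a (arc 0 (n * m)))" for m
    using bound[of m] by (auto simp: f_def coeff_sum)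
  have f0: "poly f 0 = 0" by (simp add: poly_0_coeff_0 coeff)
  moreover have "a = rot_sum f"
  proof (rule poly_mapping_eqI)
    fix w
    show "coef a w = coef (rot_sum f) w"
    proof (cases "w \<in> L")
      case True
      then obtain s where s: "w = arc s (length w)" using L_arc by blast
      have pos: "length w > 0" using True by auto
      then have "coef a w = (if n dvd length w then coef a (arc 0 (length w)) else 0)"
        using center_coef_arc[OF a, of "length w" s] s by simp
      then show ?thesis using True pos f0 n_pos by (auto simp: coef_rot_sum coeff elim!: dvdE)
    qed (use aL f0 in \<open>simp add: coef_rot_sum coef_outside\<close>)
  qed
  ultimately show ?thesis by blast
qed

theorem center_cycle: "center L = {rot_sum f | f. poly f 0 = 0}"
  using center_eq_rot_sum rot_sum_in_center by blast

text \<open>Only cuts after whole turns contribute, and on these the product is the Cauchy product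
  of the coefficients.\<close>

lemma rot_sum_mult:
  assumes "poly f 0 = 0" "poly g 0 = 0"
  shows "rot_sum (f * g) = mult L (rot_sum f) (rot_sum g)"
proof (rule poly_mapping_eqI)
  have 0: "coeff f 0 = 0" "coeff g 0 = 0" using assms by (simp_all add: poly_0_coeff_0)
  have fg: "poly (f * g) 0 = 0" using assms by simp
  fix x
  show "coef (rot_sum (f * g)) x = coef (mult L (rot_sum f) (rot_sum g)) x"
  proof (cases "x \<in> L")
    case True
    have L: "i = 0 \<or> take i x \<in> L" "i = length x \<or> drop i x \<in> L" if "i \<le> length x" for i
      using take_in_L[OF True, of i] drop_in_L[OF True, of i] that by (cases "i = length x"; auto)+
    have t: "coef (rot_sum f) (take i x) = (if n dvd i then coeff f (i div n) else 0)"
      if "i \<le> length x" for i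
      using L(1)[OF that] 0 that assms by (auto simp: coef_rot_sum)
    have d: "coef (rot_sum g) (drop i x)
        = (if n dvd length x - i then coeff g ((length x - i) div n) else 0)"
      if "i \<le> length x" for i
      using L(2)[OF that] 0 that assms by (auto simp: coef_rot_sum)
    have "coef (mult L (rot_sum f) (rot_sum g)) x
        = (\<Sum>i\<le>length x. (if n dvd i then coeff f (i div n) else 0) *
            (if n dvd length x - i then coeff g ((length x - i) div n) else 0))"
      using True by (simp add: coef_mult t d)
    also have "\<dots> = (if n dvd length x then coeff (f * g) (length x div n) else 0)"
    proof (cases "n dvd length x")
      case True
      then obtain M where M: "length x = n * M" by blast
      have "(\<Sum>i\<le>length x. (if n dvd i then coeff f (i div n) else 0) *
            (if n dvd length x - i then coeff g ((length x - i) div n) else 0))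
          = (\<Sum>i\<in>(\<lambda>j. n * j) ` {..M}. coeff f (i div n) * coeff g ((length x - i) div n))"
        using n_pos M by (intro sum.mono_neutral_cong_right) (auto elim!: dvdE)
      also have "\<dots> = (\<Sum>j\<le>M. coeff f j * coeff g (M - j))"
        using n_pos M by (subst sum.reindex)
          (auto intro!: inj_onI sum.cong simp: diff_mult_distrib2[symmetric])
      finally show ?thesis using True M n_pos by (simp add: coeff_mult)
    next
      case False
      have neutral: "\<not> n dvd i \<or> \<not> n dvd length x - i" if "i \<le> length x" for i
        using False that dvd_add[of n "length x - i" i] by auto
      show ?thesis
        unfolding if_not_P[OF False]
      proof (intro sum.neutral ballI)
        fix i assume "i \<in> {..length x}"
        then show "(if n dvd i then coeff f (i div n) else 0) *
            (if n dvd length x - i then coeff g ((length x - i) div n) else 0) = 0"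
          using neutral[of i] by auto
      qed
    qed
    finally show ?thesis using True fg by (simp add: coef_rot_sum)
  qed (use fg in \<open>simp add: coef_rot_sum coef_mult\<close>)
qed

text \<open>Injectivity holds because the coefficients at the closed paths starting with
  \<open>c 0\<close> recover the polynomial.\<close>

theorem center_cycle_iso: "iso_polys_zero_const L (center L :: ('a list \<Rightarrow>\<^sub>0 'k::field) set)"
proof -
  have "inj_on rot_sum {f :: 'k poly. poly f 0 = 0}"
  proof (rule inj_onI)
    fix f g :: "'k poly" assume fg: "f \<in> {f. poly f 0 = 0}" "g \<in> {f. poly f 0 = 0}" "rot_sum f = rot_sum g"
    show "f = g"
    proof (rule poly_eqI)
      fix m show "coeff f m = coeff g m"
      proof (cases "m = 0")
        case False
        then have "coef (rot_sum h) (arc 0 (n * m)) = coeff h m" if "poly h 0 = 0" for h :: "'k poly"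
          using that arc_in_L[of "n * m" 0] n_pos by (simp add: coef_rot_sum)
        then show ?thesis using fg by (metis mem_Collect_eq)
      qed (use fg in \<open>simp add: poly_0_coeff_0\<close>)
    qed
  qed
  then have "bij_betw rot_sum {f :: 'k poly. poly f 0 = 0} (center L)"
    unfolding center_cycle by (auto simp: bij_betw_def)
  moreover have "rot_sum (f + g) = rot_sum f + rot_sum g" if "poly f 0 = 0" "poly g 0 = 0"
    for f g :: "'k poly"
    using that by (intro poly_mapping_eqI) (simp add: coef_rot_sum lookup_add)
  moreover have "rot_sum (smult r f) = scale r (rot_sum f)" if "poly f 0 = 0" for r and f :: "'k poly"
    using that by (intro poly_mapping_eqI) (simp add: coef_rot_sum)
  ultimately show ?thesis
    unfolding iso_polys_zero_const_def using rot_sum_mult by blast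
qed

section \<open>A single loop\<close>

lemma append_commute_loop:
  assumes "n = 1" "u \<in> L" "v \<in> L"
  shows "u @ v = v @ u"
proof -
  have arc: "arc s l = arc 0 l" for s l
    using arc_periodic[of 0 s l] assms(1) by simp
  have "w = arc 0 (length w)" if "w \<in> L" for w
    using L_arc[OF that] arc by metis
  then show ?thesis
    using assms(2,3) arc arc_add[of 0] by (metis add.commute)
qed

text \<open>In a power of one letter, prefixes and suffixes of equal length agree, so the algebra is
  commutative.\<close>

lemma center_loop:
  assumes "n = 1"
  shows "center L = (lang_alg L :: ('a list \<Rightarrow>\<^sub>0 'k::field) set)"
proof -
  have "mult L p q = mult L q p" for p q :: "'a list \<Rightarrow>\<^sub>0 'k"
  proof (rule poly_mapping_eqI)
    fix x
    show "coef (mult L p q) x = coef (mult L q p) x"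
    proof (cases "x \<in> L")
      case True
      have "coef (mult L p q) x = (\<Sum>i\<le>length x. coef p (take i x) * coef q (take (length x - i) x))"
        using True drop_eq_take[OF True] assms by (simp add: coef_mult)
      also have "\<dots> = (\<Sum>i\<le>length x. coef q (take i x) * coef p (take (length x - i) x))"
        by (rule sum.reindex_bij_witness[of _ "\<lambda>i. length x - i" "\<lambda>i. length x - i"]) auto
      also have "\<dots> = coef (mult L q p) x"
        using True drop_eq_take[OF True] assms by (simp add: coef_mult)
      finally show ?thesis .
    qed (simp add: coef_mult)
  qed
  then show ?thesis by (auto simp: center_def)
qed

text \<open>All six products coincide, and three carry each sign.\<close>

lemma three_center_loop:
  assumes "n = 1"
  shows "three_center L = (lang_alg L :: ('a list \<Rightarrow>\<^sub>0 'k::field) set)"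
proof (intro equalityI subsetI)
  fix a :: "'a list \<Rightarrow>\<^sub>0 'k" assume a: "a \<in> lang_alg L"
  show "a \<in> three_center L"
  proof (rule three_centerI[OF a])
    fix u v w assume "u \<in> supp a" "v \<in> L" "w \<in> L"
    then have uvw: "u \<in> L" "v \<in> L" "w \<in> L" using a by (auto simp: lang_alg_def)
    have eqs: "u @ w @ v = u @ v @ w" "v @ w @ u = u @ v @ w" "v @ u @ w = u @ v @ w"
      "w @ u @ v = u @ v @ w" "w @ v @ u = u @ v @ w"
      using append_commute_loop[OF assms] uvw by (metis append_assoc)+
    have "u \<noteq> []" "v \<noteq> []" "w \<noteq> []" using uvw by auto
    then show "St3 L (word_elt u) (word_elt v) (word_elt w) = 0"
      unfolding St3_words[OF path_lang_factor_closed \<open>u \<noteq> []\<close> \<open>v \<noteq> []\<close> \<open>w \<noteq> []\<close>] eqs by simp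
  qed
qed (simp add: three_center_def)

end

section \<open>3-centers of path algebras\<close>

lemma append_commute_singleton:
  assumes "set u \<subseteq> {e}" "set v \<subseteq> {e}"
  shows "u @ v = v @ u"
proof -
  have "u = replicate (length u) e" "v = replicate (length v) e"
    using assms by (auto intro!: replicate_eqI)
  then show ?thesis by (metis add.commute replicate_add)
qed

lemma path_lang_ends: "w \<in> path_lang B R \<Longrightarrow> hd w \<in> B" "w \<in> path_lang B R \<Longrightarrow> last w \<in> B"
  using path_lang_set[of w B R "hd w"] path_lang_set[of w B R "last w"] by (cases "w = []"; simp)+

lemma elt_or_zero_outside: "w \<notin> L \<Longrightarrow> elt_or_zero L w = 0"
  by (simp add: elt_or_zero_def)

lemma elt_or_zero_eqI: "(v \<in> L \<or> w \<in> L \<Longrightarrow> v = w) \<Longrightarrow> elt_or_zero L v = elt_or_zero L w"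
  by (auto simp: elt_or_zero_def)

text \<open>The witness is the edge by which the path leaves its initial run of equal
  letters.\<close>

lemma ex_other_successor:
  "v \<in> path_lang B R \<Longrightarrow> \<not> set v \<subseteq> {hd v} \<Longrightarrow> \<exists>f\<in>B. f \<noteq> hd v \<and> R (hd v) f"
proof (induction v)
  case (Cons e v)
  then have v: "v \<in> path_lang B R" "v \<noteq> []" "R e (hd v)" by auto
  then have "hd v \<in> B" using path_lang_set[of v B R "hd v"] by simp
  then show ?case using Cons v by (cases "hd v = e") auto
qed simp

lemma ex_other_predecessor:
  "v \<in> path_lang B R \<Longrightarrow> \<not> set v \<subseteq> {last v} \<Longrightarrow> \<exists>f\<in>B. f \<noteq> last v \<and> R f (last v)"
proof (induction v rule: rev_induct)
  case (snoc e v)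
  then have "v \<noteq> []" by auto
  with snoc.prems have v: "v \<in> path_lang B R" "v \<noteq> []" "R (last v) e"
    by (simp_all add: append_in_path_lang)
  then have "last v \<in> B" using path_lang_set[of v B R "last v"] by simp
  then show ?case using snoc v by (cases "last v = e") auto
qed simp

text \<open>The first alternative of property \<open>\<Delta>\<close>.\<close>

definition rigid :: "'a set \<Rightarrow> ('a \<Rightarrow> 'a \<Rightarrow> bool) \<Rightarrow> 'a list \<Rightarrow> bool" where
  "rigid B R w \<longleftrightarrow> (\<forall>e\<in>B. \<forall>f\<in>B. e \<noteq> f \<longrightarrow>
     w @ [e, f] \<notin> path_lang B R \<and> [e] @ w @ [f] \<notin> path_lang B R \<and> [e, f] @ w \<notin> path_lang B R)"

text \<open>If \<open>v\<close> were not a power of its first letter, that letter would have a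
  different successor, and \<open>w\<close> followed by these two edges would contradict
  rigidity.\<close>

lemma rigid_right:
  assumes "rigid B R w" "w \<in> path_lang B R" "w @ v \<in> path_lang B R"
  shows "set v \<subseteq> {hd v}"
proof (rule ccontr)
  assume other: "\<not> set v \<subseteq> {hd v}"
  then have ne: "w \<noteq> []" "v \<noteq> []" using assms(2) by auto
  then have v: "v \<in> path_lang B R" "R (last w) (hd v)"
    using assms(3) by (simp_all add: append_in_path_lang)
  then have "hd v \<in> B" using ne path_lang_set[of v B R "hd v"] by simp
  moreover obtain f where f: "f \<in> B" "f \<noteq> hd v" "R (hd v) f"
    using ex_other_successor[OF v(1) other] by blast
  moreover have "w @ [hd v, f] \<in> path_lang B R"
    using assms(2) v ne f \<open>hd v \<in> B\<close> by (simp add: append_in_path_lang)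
  ultimately show False
    using assms(1) unfolding rigid_def by metis
qed

lemma rigid_left:
  assumes "rigid B R w" "w \<in> path_lang B R" "v @ w \<in> path_lang B R"
  shows "set v \<subseteq> {last v}"
proof (rule ccontr)
  assume other: "\<not> set v \<subseteq> {last v}"
  then have ne: "w \<noteq> []" "v \<noteq> []" using assms(2) by auto
  then have v: "v \<in> path_lang B R" "R (last v) (hd w)"
    using assms(3) by (simp_all add: append_in_path_lang)
  then have "last v \<in> B" using ne path_lang_set[of v B R "last v"] by simp
  moreover obtain f where f: "f \<in> B" "f \<noteq> last v" "R f (last v)"
    using ex_other_predecessor[OF v(1) other] by blast
  moreover have "[f, last v] @ w \<in> path_lang B R"
    using assms(2) v ne f \<open>last v \<in> B\<close> by simp
  ultimately show False
    using assms(1) unfolding rigid_def by metis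
qed

text \<open>Rigidity is applied repeatedly: the edges next to \<open>w\<close> must coincide, say in
  \<open>e\<close>; since \<open>e\<close> then leads back into \<open>w\<close>, the first edge of
  \<open>w\<close> is \<open>e\<close> too, and any deviation inside \<open>w\<close> would again
  give two distinct edges after \<open>w\<close>.\<close>

lemma rigid_middle:
  assumes rigid: "rigid B R w" and w: "w \<in> path_lang B R"
    and bwc: "b \<noteq> []" "c \<noteq> []" "b @ w @ c \<in> path_lang B R"
  shows "\<exists>e. set b \<subseteq> {e} \<and> set w \<subseteq> {e} \<and> set c \<subseteq> {e}"
proof -
  have ne: "w \<noteq> []" using w by auto
  have mem: "b \<in> path_lang B R" "c \<in> path_lang B R" "R (last b) (hd w)" "R (last w) (hd c)"
    "b @ w \<in> path_lang B R" "w @ c \<in> path_lang B R"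
    using bwc ne w by (simp_all add: append_in_path_lang)
  define e where "e = hd c"
  have inB: "last b \<in> B" "e \<in> B" "hd w \<in> B"
    using path_lang_set[OF mem(1)] path_lang_set[OF mem(2)] path_lang_set[OF w] bwc ne
    by (simp_all add: e_def)
  have "[last b] @ w @ [e] \<in> path_lang B R"
    using w mem inB ne by (simp add: append_in_path_lang e_def)
  then have eq: "last b = e" using rigid inB unfolding rigid_def by metis
  have after: "w @ [e, f] \<in> path_lang B R" if "f \<in> B" "R e f" for f
    using w mem inB ne that by (simp add: append_in_path_lang e_def)
  have "R e (hd w)" using mem(3) eq by simp
  then have "hd w = e"
    using after[of "hd w"] inB rigid unfolding rigid_def by metis
  moreover have "set w \<subseteq> {hd w}"
  proof (rule ccontr)
    assume "\<not> set w \<subseteq> {hd w}"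
    then obtain f where "f \<in> B" "f \<noteq> e" "R e f"
      using ex_other_successor[OF w] \<open>hd w = e\<close> by auto
    then show False using after[of f] rigid inB unfolding rigid_def by metis
  qed
  ultimately show ?thesis
    using rigid_right[OF rigid w mem(6)] rigid_left[OF rigid w mem(5)] eq e_def by auto
qed

text \<open>The two terms with \<open>w\<close> in front, and the two with \<open>w\<close> at the
  end, cancel because \<open>b\<close> and \<open>c\<close> commute whenever such a term is nonzero.
  A nonzero term with \<open>w\<close> in the middle makes all three words powers of one
  letter.\<close>

lemma St3_rigid:
  assumes rigid: "rigid B R w" and w: "w \<in> path_lang B R"
    and b: "b \<in> path_lang B R" and c: "c \<in> path_lang B R"
  shows "St3 (path_lang B R) (word_elt w) (word_elt b) (word_elt c) = (0 :: _ \<Rightarrow>\<^sub>0 'k::field)"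
proof -
  let ?L = "path_lang B R"
  have ne: "w \<noteq> []" "b \<noteq> []" "c \<noteq> []" using w b c by auto
  note St3 = St3_words[OF path_lang_factor_closed ne, of B R]
  show ?thesis
  proof (cases "b @ w @ c \<in> ?L \<or> c @ w @ b \<in> ?L")
    case True
    then obtain e where e: "set b \<subseteq> {e}" "set w \<subseteq> {e}" "set c \<subseteq> {e}"
      using rigid_middle[OF rigid w] ne by metis
    have eqs: "w @ c @ b = w @ b @ c" "b @ c @ w = w @ b @ c" "b @ w @ c = w @ b @ c"
      "c @ w @ b = w @ b @ c" "c @ b @ w = w @ b @ c"
      using append_commute_singleton[OF e(1,2)] append_commute_singleton[OF e(1,3)]
        append_commute_singleton[OF e(2,3)] by (metis append_assoc)+
    show ?thesis unfolding St3 eqs by simp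
  next
    case False
    have right: "b @ c = c @ b" if mem: "w @ b @ c \<in> ?L \<or> w @ c @ b \<in> ?L"
    proof -
      have "set (b @ c) \<subseteq> {hd (b @ c)} \<or> set (b @ c) \<subseteq> {hd (c @ b)}"
        using mem rigid_right[OF rigid w, of "b @ c"] rigid_right[OF rigid w, of "c @ b"] by auto
      then obtain e where "set (b @ c) \<subseteq> {e}" by blast
      then show ?thesis using append_commute_singleton[of b e c] by simp
    qed
    have left: "b @ c = c @ b" if mem: "b @ c @ w \<in> ?L \<or> c @ b @ w \<in> ?L"
    proof -
      have "set (b @ c) \<subseteq> {last (b @ c)} \<or> set (b @ c) \<subseteq> {last (c @ b)}"
        using mem rigid_left[OF rigid w, of "b @ c"] rigid_left[OF rigid w, of "c @ b"] by auto
      then obtain e where "set (b @ c) \<subseteq> {e}" by blast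
      then show ?thesis using append_commute_singleton[of b e c] by simp
    qed
    have "elt_or_zero ?L (w @ b @ c) = (elt_or_zero ?L (w @ c @ b) :: _ \<Rightarrow>\<^sub>0 'k)"
      using right by (auto simp: elt_or_zero_def)
    moreover have "elt_or_zero ?L (b @ c @ w) = (elt_or_zero ?L (c @ b @ w) :: _ \<Rightarrow>\<^sub>0 'k)"
    proof (rule elt_or_zero_eqI)
      assume "b @ c @ w \<in> ?L \<or> c @ b @ w \<in> ?L"
      then show "b @ c @ w = c @ b @ w" using left by (metis append_assoc)
    qed
    ultimately show ?thesis using False unfolding St3 by (simp add: elt_or_zero_def)
  qed
qed

text \<open>Every letter of \<open>v\<close> has a successor in the path, and only \<open>e\<close>
  can have one.\<close>

lemma path_set_if_dead_ends:
  assumes "v @ u \<in> path_lang B R" "u \<noteq> []" "\<forall>f\<in>B. \<forall>y\<in>B. R f y \<longrightarrow> f = e"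
  shows "set v \<subseteq> {e}"
  using assms(1)
proof (induction v)
  case (Cons x v)
  then have "v @ u \<in> path_lang B R" "R x (hd (v @ u))" "x \<in> B"
    using assms(2) by auto
  moreover from this have "hd (v @ u) \<in> B"
    using path_lang_ends(1) by blast
  ultimately show ?case using Cons.IH assms(3) by auto
qed simp

lemma path_set_if_dead_starts:
  assumes "u @ v \<in> path_lang B R" "u \<noteq> []" "\<forall>f\<in>B. \<forall>y\<in>B. R y f \<longrightarrow> f = e"
  shows "set v \<subseteq> {e}"
  using assms(1)
proof (induction v rule: rev_induct)
  case (snoc x v)
  then have "(u @ v) @ [x] \<in> path_lang B R" by simp
  then have "u @ v \<in> path_lang B R" "R (last (u @ v)) x" "x \<in> B"
    using assms(2) append_in_path_lang[of "u @ v" "[x]" B R] by auto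
  moreover from this have "last (u @ v) \<in> B"
    using path_lang_ends(2) by blast
  ultimately show ?case using snoc.IH assms(3) by auto
qed simp

text \<open>If only \<open>e\<close> has successors, a factor with another letter must come last;
  the two remaining terms then agree or vanish together, by commutation of powers of
  \<open>e\<close>, and have opposite signs. The other case is the mirror image.\<close>

lemma St3_loop_dead_ends:
  assumes w: "w \<in> path_lang B R" "set w \<subseteq> {e}"
    and dead: "(\<forall>f\<in>B. \<forall>y\<in>B. R f y \<longrightarrow> f = e) \<or> (\<forall>f\<in>B. \<forall>y\<in>B. R y f \<longrightarrow> f = e)"
    and b: "b \<in> path_lang B R" and c: "c \<in> path_lang B R"
  shows "St3 (path_lang B R) (word_elt w) (word_elt b) (word_elt c) = (0 :: _ \<Rightarrow>\<^sub>0 'k::field)"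
proof -
  let ?L = "path_lang B R"
  have ne: "w \<noteq> []" "b \<noteq> []" "c \<noteq> []" using w b c by auto
  note St3 = St3_words[OF path_lang_factor_closed ne, of B R]
  consider (both) "set b \<subseteq> {e}" "set c \<subseteq> {e}" | (b) "\<not> set b \<subseteq> {e}" | (c) "\<not> set c \<subseteq> {e}"
    by blast
  then show ?thesis
  proof cases
    case both
    have eqs: "w @ c @ b = w @ b @ c" "b @ c @ w = w @ b @ c" "b @ w @ c = w @ b @ c"
      "c @ w @ b = w @ b @ c" "c @ b @ w = w @ b @ c"
      using append_commute_singleton[OF both] append_commute_singleton[OF w(2) both(1)]
        append_commute_singleton[OF w(2) both(2)] by (metis append_assoc)+
    show ?thesis unfolding St3 eqs by simp
  next
    case b
    show ?thesis
      using dead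
    proof
      assume d: "\<forall>f\<in>B. \<forall>y\<in>B. R f y \<longrightarrow> f = e"
      have "w @ b @ c \<notin> ?L" "b @ c @ w \<notin> ?L" "b @ w @ c \<notin> ?L" "c @ b @ w \<notin> ?L"
        using path_set_if_dead_ends[OF _ _ d, of "w @ b" c] path_set_if_dead_ends[OF _ _ d, of b "c @ w"]
          path_set_if_dead_ends[OF _ _ d, of b "w @ c"] path_set_if_dead_ends[OF _ _ d, of "c @ b" w]
          b ne by auto
      moreover have "elt_or_zero ?L (w @ c @ b) = (elt_or_zero ?L (c @ w @ b) :: _ \<Rightarrow>\<^sub>0 'k)"
      proof (rule elt_or_zero_eqI)
        assume mem: "w @ c @ b \<in> ?L \<or> c @ w @ b \<in> ?L"
        have "set (w @ c) \<subseteq> {e}"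
          using mem path_set_if_dead_ends[OF _ _ d, of "w @ c" b]
            path_set_if_dead_ends[OF _ _ d, of "c @ w" b] ne by auto
        then show "w @ c @ b = c @ w @ b" using append_commute_singleton[of w e c] by simp
      qed
      ultimately show ?thesis unfolding St3 by (simp add: elt_or_zero_outside)
    next
      assume d: "\<forall>f\<in>B. \<forall>y\<in>B. R y f \<longrightarrow> f = e"
      have "w @ b @ c \<notin> ?L" "w @ c @ b \<notin> ?L" "c @ w @ b \<notin> ?L" "c @ b @ w \<notin> ?L"
        using path_set_if_dead_starts[OF _ _ d, of w "b @ c"] path_set_if_dead_starts[OF _ _ d, of w "c @ b"]
          path_set_if_dead_starts[OF _ _ d, of c "w @ b"] path_set_if_dead_starts[OF _ _ d, of c "b @ w"]
          b ne by auto
      moreover have "elt_or_zero ?L (b @ w @ c) = (elt_or_zero ?L (b @ c @ w) :: _ \<Rightarrow>\<^sub>0 'k)"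
      proof (rule elt_or_zero_eqI)
        assume mem: "b @ w @ c \<in> ?L \<or> b @ c @ w \<in> ?L"
        have "set (w @ c) \<subseteq> {e}"
          using mem path_set_if_dead_starts[OF _ _ d, of b "w @ c"]
            path_set_if_dead_starts[OF _ _ d, of b "c @ w"] ne by auto
        then show "b @ w @ c = b @ c @ w" using append_commute_singleton[of w e c] by simp
      qed
      ultimately show ?thesis unfolding St3 by (simp add: elt_or_zero_outside)
    qed
  next
    case c
    show ?thesis
      using dead
    proof
      assume d: "\<forall>f\<in>B. \<forall>y\<in>B. R f y \<longrightarrow> f = e"
      have "w @ c @ b \<notin> ?L" "b @ c @ w \<notin> ?L" "c @ w @ b \<notin> ?L" "c @ b @ w \<notin> ?L"
        using path_set_if_dead_ends[OF _ _ d, of "w @ c" b] path_set_if_dead_ends[OF _ _ d, of c "b @ w"]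
          path_set_if_dead_ends[OF _ _ d, of c "w @ b"] path_set_if_dead_ends[OF _ _ d, of "b @ c" w]
          c ne by auto
      moreover have "elt_or_zero ?L (w @ b @ c) = (elt_or_zero ?L (b @ w @ c) :: _ \<Rightarrow>\<^sub>0 'k)"
      proof (rule elt_or_zero_eqI)
        assume mem: "w @ b @ c \<in> ?L \<or> b @ w @ c \<in> ?L"
        have "set (w @ b) \<subseteq> {e}"
          using mem path_set_if_dead_ends[OF _ _ d, of "w @ b" c]
            path_set_if_dead_ends[OF _ _ d, of "b @ w" c] ne by auto
        then show "w @ b @ c = b @ w @ c" using append_commute_singleton[of w e b] by simp
      qed
      ultimately show ?thesis unfolding St3 by (simp add: elt_or_zero_outside)
    next
      assume d: "\<forall>f\<in>B. \<forall>y\<in>B. R y f \<longrightarrow> f = e"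
      have "w @ b @ c \<notin> ?L" "w @ c @ b \<notin> ?L" "b @ w @ c \<notin> ?L" "b @ c @ w \<notin> ?L"
        using path_set_if_dead_starts[OF _ _ d, of w "b @ c"] path_set_if_dead_starts[OF _ _ d, of w "c @ b"]
          path_set_if_dead_starts[OF _ _ d, of b "w @ c"] path_set_if_dead_starts[OF _ _ d, of b "c @ w"]
          c ne by auto
      moreover have "elt_or_zero ?L (c @ w @ b) = (elt_or_zero ?L (c @ b @ w) :: _ \<Rightarrow>\<^sub>0 'k)"
      proof (rule elt_or_zero_eqI)
        assume mem: "c @ w @ b \<in> ?L \<or> c @ b @ w \<in> ?L"
        have "set (w @ b) \<subseteq> {e}"
          using mem path_set_if_dead_starts[OF _ _ d, of c "w @ b"]
            path_set_if_dead_starts[OF _ _ d, of c "b @ w"] ne by auto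
        then show "c @ w @ b = c @ b @ w" using append_commute_singleton[of w e b] by simp
      qed
      ultimately show ?thesis unfolding St3 by (simp add: elt_or_zero_outside)
    qed
  qed
qed

text \<open>What the 3-center needs to know about the block graph. The first assumption expresses
  that adjacency is meeting at a vertex; of the absence of parallel edges the case of loops is
  recorded.\<close>

locale edge_paths =
  fixes B :: "'a set" and R :: "'a \<Rightarrow> 'a \<Rightarrow> bool"
  assumes common_end: "R x y \<Longrightarrow> R x' y \<Longrightarrow> R x' y' \<Longrightarrow> R x y'"
    and one_loop: "x \<in> B \<Longrightarrow> y \<in> B \<Longrightarrow> R x x \<Longrightarrow> R y y \<Longrightarrow> R x y \<Longrightarrow> x = y"
begin

abbreviation L :: "'a list set" where "L \<equiv> path_lang B R"

lemma not_adjacent: "\<not> R (last v) (hd v') \<Longrightarrow> v \<noteq> [] \<Longrightarrow> v' \<noteq> [] \<Longrightarrow> u @ v @ v' @ u' \<notin> L"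
  by (auto simp: path_lang_def successively_append_iff)

section \<open>Words that cannot occur in the 3-center\<close>

context
  fixes a :: "'a list \<Rightarrow>\<^sub>0 'k::field_char_0"
  assumes a: "a \<in> three_center L"
begin

lemmas isolate = three_center_coef_eq_0[OF path_lang_factor_closed a]

text \<open>\<open>ubc\<close> and \<open>bcu\<close> enter with the same sign, so one lemma covers
  test paths with \<open>w\<close> at either end; each of the last two conditions concerns the end
  not occupied by \<open>w\<close>.\<close>

lemma isolate_outer:
  assumes "b \<in> L" "c \<in> L" "x \<in> L" "x = w @ b @ c \<or> x = b @ c @ w"
    and "\<And>u. u \<noteq> [] \<Longrightarrow> u @ c @ b \<noteq> x" "\<And>u. u \<noteq> [] \<Longrightarrow> b @ u @ c \<noteq> x"
      "\<And>u. u \<noteq> [] \<Longrightarrow> c @ u @ b \<noteq> x" "\<And>u. u \<noteq> [] \<Longrightarrow> c @ b @ u \<noteq> x"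
      "\<And>u. x = w @ b @ c \<Longrightarrow> b @ c @ u \<noteq> x" "\<And>u. x = b @ c @ w \<Longrightarrow> u @ b @ c \<noteq> x"
  shows "coef a w = 0"
  using assms(4)
proof
  assume x: "x = w @ b @ c"
  show ?thesis
    by (rule isolate[OF assms(1-3), of 1]) (use assms(5-9) x in auto)
next
  assume x: "x = b @ c @ w"
  show ?thesis
    by (rule isolate[OF assms(1-3), of 1]) (use assms(5-8,10) x in auto)
qed

lemma isolate_middle:
  assumes "b \<in> L" "c \<in> L" "b @ w @ c \<in> L"
    and "\<And>u. u \<noteq> [] \<Longrightarrow> u @ b @ c \<noteq> b @ w @ c" "\<And>u. u \<noteq> [] \<Longrightarrow> u @ c @ b \<noteq> b @ w @ c"
      "\<And>u. u \<noteq> [] \<Longrightarrow> b @ c @ u \<noteq> b @ w @ c" "\<And>u. u \<noteq> [] \<Longrightarrow> c @ u @ b \<noteq> b @ w @ c"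
      "\<And>u. u \<noteq> [] \<Longrightarrow> c @ b @ u \<noteq> b @ w @ c"
  shows "coef a w = 0"
\<comment> \<open>The order \<open>buc\<close> is an odd permutation of \<open>ubc\<close>, hence
  the constant \<open>- 1\<close>.\<close>
proof (rule isolate[OF assms(1-3), of "- 1"])
  fix u :: "'a list" assume u: "u \<noteq> []"
  have "b @ u @ c = b @ w @ c \<longleftrightarrow> u = w" by simp
  then show "of_bool (u @ b @ c = b @ w @ c) - of_bool (u @ c @ b = b @ w @ c)
      + of_bool (b @ c @ u = b @ w @ c) - of_bool (b @ u @ c = b @ w @ c)
      + of_bool (c @ u @ b = b @ w @ c) - of_bool (c @ b @ u = b @ w @ c)
      = - 1 * (of_bool (u = w) :: 'k)"
    by (simp only: assms(4-8)[OF u]) simp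
qed simp

text \<open>With \<open>c = wb\<close>, both \<open>ubc\<close> and \<open>cub\<close> give
  \<open>wbwb\<close> exactly for \<open>u = w\<close>, and both have sign +. The resulting factor 2
  must be invertible.\<close>

lemma three_center_returning:
  assumes w: "w \<in> L" and b: "b \<in> L" and R: "R (last w) (hd b)" "R (last b) (hd w)"
    and open_path: "\<not> R (last w) (hd w)"
  shows "coef a w = 0"
proof (rule isolate[where b = b and c = "w @ b" and x = "w @ b @ w @ b" and \<kappa> = 2])
  have ne: "w \<noteq> []" "b \<noteq> []" using w b by auto
  show x: "w @ b \<in> L" "w @ b @ w @ b \<in> L"
    using w b ne R by (simp_all add: append_in_path_lang)
  \<comment> \<open>If \<open>b\<close> were closed, \<open>hd b\<close> and \<open>hd w\<close>
    would start at the same vertex, and \<open>w\<close> would be closed too.\<close>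
  have bb: "\<not> R (last b) (hd b)" using common_end[OF R(1) _ R(2)] open_path by blast
  have hd: "hd b \<noteq> hd w" using R(1) open_path by metis
  fix u :: "'a list" assume "u \<noteq> []"
  have "u @ (w @ b) @ b \<noteq> w @ b @ w @ b" "(w @ b) @ b @ u \<noteq> w @ b @ w @ b"
    using not_adjacent[OF bb ne(2,2), of "u @ w" "[]"] not_adjacent[OF bb ne(2,2), of w u] x(2)
    by auto
  moreover have "b @ v \<noteq> w @ b @ w @ b" for v
    using hd ne by (metis hd_append2)
  ultimately show "of_bool (u @ b @ w @ b = w @ b @ w @ b) - of_bool (u @ (w @ b) @ b = w @ b @ w @ b)
      + of_bool (b @ (w @ b) @ u = w @ b @ w @ b) - of_bool (b @ u @ w @ b = w @ b @ w @ b)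
      + of_bool ((w @ b) @ u @ b = w @ b @ w @ b) - of_bool ((w @ b) @ b @ u = w @ b @ w @ b)
      = 2 * (of_bool (u = w) :: 'k)"
    by simp
qed (use b in simp_all)

text \<open>As \<open>p\<close> is not closed, \<open>pp\<close> is not a path and \<open>q\<close>
  does not begin with the first letter of \<open>p\<close>; this excludes the orders
  \<open>ucb\<close>, \<open>cub\<close> and \<open>cbu\<close>.\<close>

lemma three_center_closed_split:
  assumes w: "p @ q \<in> L" "p \<noteq> []" "q \<noteq> []" and R: "R (last q) (hd p)" "\<not> R (last p) (hd p)"
  shows "coef a (p @ q) = 0"
proof (rule isolate[where b = p and c = "q @ p" and x = "p @ q @ p @ q @ p" and \<kappa> = 1])
  have pq: "p \<in> L" "q \<in> L" "R (last p) (hd q)"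
    using w by (simp_all add: append_in_path_lang)
  then show "p \<in> L" by simp
  show x: "q @ p \<in> L" "p @ q @ p @ q @ p \<in> L"
    using w pq R by (simp_all add: append_in_path_lang)
  have hd: "hd q \<noteq> hd p" using pq(3) R(2) by metis
  fix u :: "'a list" assume "u \<noteq> []"
  have "u @ (q @ p) @ p \<notin> L" "(q @ p) @ p @ u \<notin> L"
    using not_adjacent[OF R(2) w(2,2), of "u @ q" "[]"] not_adjacent[OF R(2) w(2,2), of q u] by simp_all
  then have pp: "u @ (q @ p) @ p \<noteq> p @ q @ p @ q @ p" "(q @ p) @ p @ u \<noteq> p @ q @ p @ q @ p"
    using x(2) by metis+
  have "hd ((q @ p) @ u @ p) \<noteq> hd (p @ q @ p @ q @ p)"
    using hd w by simp
  then have qu: "(q @ p) @ u @ p \<noteq> p @ q @ p @ q @ p" by metis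
  \<comment> \<open>The word \<open>qp\<close> fits two orders, with opposite signs; what remains is
    \<open>pq\<close>.\<close>
  have u: "u @ p @ q @ p = p @ q @ p @ q @ p \<longleftrightarrow> u = p @ q"
    "p @ (q @ p) @ u = p @ q @ p @ q @ p \<longleftrightarrow> u = q @ p"
    "p @ u @ q @ p = p @ q @ p @ q @ p \<longleftrightarrow> u = q @ p"
    using append_same_eq[of u "p @ q @ p" "p @ q"] append_same_eq[of u "q @ p" "q @ p"] by simp_all
  show "of_bool (u @ p @ q @ p = p @ q @ p @ q @ p)
      - of_bool (u @ (q @ p) @ p = p @ q @ p @ q @ p)
      + of_bool (p @ (q @ p) @ u = p @ q @ p @ q @ p) - of_bool (p @ u @ q @ p = p @ q @ p @ q @ p)
      + of_bool ((q @ p) @ u @ p = p @ q @ p @ q @ p) - of_bool ((q @ p) @ p @ u = p @ q @ p @ q @ p)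
      = 1 * (of_bool (u = p @ q) :: 'k)"
    unfolding u using pp qu by (simp only: of_bool_eq) simp
qed simp

text \<open>Every prefix of \<open>w\<close> is closed, otherwise
  \<open>three_center_closed_split\<close> would apply to it. So all edges of \<open>w\<close> end
  at its starting vertex, hence are loops there, and a vertex has only one loop.\<close>

lemma three_center_closed:
  assumes w: "w \<in> L" "R (last w) (hd w)" "coef a w \<noteq> 0"
  shows "\<exists>e\<in>B. R e e \<and> set w \<subseteq> {e}"
proof -
  define e where "e = hd w"
  have e: "e \<in> set w" "e \<in> B"
    using w(1) path_lang_ends(1)[OF w(1)] by (cases w; simp add: e_def)+
  have to_e: "R x e" if x: "x \<in> set w" for x
  proof -
    obtain p q where pq: "w = (p @ [x]) @ q" using split_list[OF x] by auto
    show ?thesis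
    proof (cases "q = []")
      case True
      then show ?thesis using w(2) pq by (simp add: e_def)
    next
      case False
      show ?thesis
      proof (rule ccontr)
        assume "\<not> R x e"
        then have "coef a ((p @ [x]) @ q) = 0"
          using three_center_closed_split[of "p @ [x]" q] w(1,2) pq False
          by (cases p) (simp_all add: e_def)
        then show False using w(3) pq by simp
      qed
    qed
  qed
  have "x = e" if x: "x \<in> set w" for x
  proof -
    obtain p q where pq: "w = p @ [x] @ q" using split_list[OF x] by auto
    show ?thesis
    proof (cases "p = []")
      case True
      then show ?thesis using pq by (simp add: e_def)
    next
      case False
      then have "R (last p) x" using w(1) pq by (simp add: append_in_path_lang)
      moreover have "R (last p) e" using to_e pq False by simp
      \<comment> \<open>\<open>x\<close> ends where \<open>e\<close> starts, and the preceding edge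
        leads to both \<open>e\<close> and \<open>x\<close>, so \<open>x\<close> starts there as
        well.\<close>
      ultimately have "R x x" using common_end to_e[OF x] by blast
      then show ?thesis
        using one_loop[OF path_lang_set[OF w(1) x] e(2)] to_e x e(1) by blast
    qed
  qed
  then show ?thesis using to_e[OF e(1)] e(2) by blast
qed

text \<open>With another edge entering and another one leaving the vertex of the loop, the path
  \<open>gwf\<close> isolates \<open>w\<close>. Together with the next two lemmas this leaves only
  star-shaped graphs around the loop.\<close>

lemma three_center_through_loop:
  assumes e: "e \<in> B" "R e e" and w: "w \<in> L" "set w \<subseteq> {e}"
    and g: "g \<in> B" "R g e" "g \<noteq> e" and f: "f \<in> B" "R e f" "f \<noteq> e"
  shows "coef a w = 0"
proof (rule isolate_middle[where b = "[g]" and c = "[f]"])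
  have ne: "w \<noteq> []" using w by auto
  then have hl: "hd w = e" "last w = e" using w(2) by (auto simp: subset_iff)
  show "[g] \<in> L" "[f] \<in> L" "[g] @ w @ [f] \<in> L"
    using w g f hl ne by (simp_all add: append_in_path_lang)
  \<comment> \<open>An edge that both enters and leaves the vertex of the loop would be a second
    loop there.\<close>
  have gf: "g \<noteq> f" using common_end[of f e e f] one_loop[of e f] e f g by blast
  fix u :: "'a list" assume "u \<noteq> []"
  show "u @ [g] @ [f] \<noteq> [g] @ w @ [f]"
  proof
    assume "u @ [g] @ [f] = [g] @ w @ [f]"
    then have "u @ [g] = [g] @ w" by simp
    from arg_cong[OF this, of last] show False using hl ne g(3) by simp
  qed
  show "[g] @ [f] @ u \<noteq> [g] @ w @ [f]"
    using f(3) hl(1) ne by (cases w) auto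
  show "u @ [f] @ [g] \<noteq> [g] @ w @ [f]"
  proof
    assume "u @ [f] @ [g] = [g] @ w @ [f]"
    from arg_cong[OF this, of last] show False using gf by simp
  qed
  show "[f] @ u @ [g] \<noteq> [g] @ w @ [f]" "[f] @ [g] @ u \<noteq> [g] @ w @ [f]"
    using gf by simp_all
qed

text \<open>\<open>wfh\<close> isolates \<open>w\<close>, since neither \<open>f\<close> nor
  \<open>h\<close> can be the first letter of a power of \<open>e\<close>.\<close>

lemma three_center_loop_then:
  assumes e: "e \<in> B" "R e e" and w: "w \<in> L" "set w \<subseteq> {e}"
    and f: "f \<in> B" "R e f" "f \<noteq> e" and h: "h \<in> B" "R f h" "h \<noteq> e"
  shows "coef a w = 0"
proof (rule isolate_outer[where b = "[f]" and c = "[h]" and x = "w @ [f, h]"])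
  have ne: "w \<noteq> []" using w by auto
  then have hl: "hd w = e" "last w = e" using w(2) by (auto simp: subset_iff)
  show "[f] \<in> L" "[h] \<in> L" "w @ [f, h] \<in> L"
    using w h f hl ne by (simp_all add: append_in_path_lang)
  have hf: "h \<noteq> f" using one_loop[of e f] e f h by blast
  have first: "[f] @ v \<noteq> w @ [f, h]" "[h] @ v \<noteq> w @ [f, h]" for v
    using f(3) h(3) hl(1) ne by (cases w; auto)+
  fix u :: "'a list"
  show "u @ [h] @ [f] \<noteq> w @ [f, h]" using hf by simp
  show "[f] @ u @ [h] \<noteq> w @ [f, h]" "[h] @ u @ [f] \<noteq> w @ [f, h]" "[h] @ [f] @ u \<noteq> w @ [f, h]"
    "[f] @ [h] @ u \<noteq> w @ [f, h]"
    by (rule first)+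
  assume "w @ [f, h] = [f] @ [h] @ w"
  then show "u @ [f] @ [h] \<noteq> w @ [f, h]" using first(1)[of "[h] @ w"] by simp
qed simp

lemma three_center_then_loop:
  assumes e: "e \<in> B" "R e e" and w: "w \<in> L" "set w \<subseteq> {e}"
    and f: "f \<in> B" "R f e" "f \<noteq> e" and h: "h \<in> B" "R h f" "h \<noteq> e"
  shows "coef a w = 0"
proof (rule isolate_outer[where b = "[h]" and c = "[f]" and x = "[h, f] @ w"])
  have ne: "w \<noteq> []" using w by auto
  then have hl: "hd w = e" "last w = e" using w(2) by (auto simp: subset_iff)
  show "[f] \<in> L" "[h] \<in> L" "[h, f] @ w \<in> L"
    using w h f hl ne by simp_all
  have hf: "h \<noteq> f" using one_loop[of f e] e f h by blast
  have final: "v @ [f] \<noteq> [h, f] @ w" "v @ [h] \<noteq> [h, f] @ w" for v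
    using f(3) h(3) hl(2) ne by (cases w rule: rev_cases; auto)+
  fix u :: "'a list"
  show "[f] @ [h] @ u \<noteq> [h, f] @ w" using hf by simp
  show "u @ [f] @ [h] \<noteq> [h, f] @ w" "[h] @ u @ [f] \<noteq> [h, f] @ w"
    "[f] @ u @ [h] \<noteq> [h, f] @ w" "u @ [h] @ [f] \<noteq> [h, f] @ w"
    using final(2)[of "u @ [f]"] final(1)[of "[h] @ u"] final(2)[of "[f] @ u"] final(1)[of "u @ [h]"]
    by simp_all
  assume "[h, f] @ w = w @ [h] @ [f]"
  then show "[h] @ [f] @ u \<noteq> [h, f] @ w" using final(1)[of "w @ [h]"] by simp
qed simp

text \<open>Two distinct edges around an open word isolate it, because its first letter cannot
  follow it and its last letter cannot precede it. A return through a single edge is excluded by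
  \<open>three_center_returning\<close>.\<close>

lemma three_center_open_rigid:
  assumes w: "w \<in> L" "\<not> R (last w) (hd w)" "coef a w \<noteq> 0"
  shows "rigid B R w"
  unfolding rigid_def
proof (intro ballI impI conjI notI)
  have ne: "w \<noteq> []" using w by auto
  have no_return: False if "e \<in> B" "R (last w) e" "R e (hd w)" for e
    using three_center_returning[OF w(1), of "[e]"] that w by simp
  fix e f assume ef: "e \<in> B" "f \<in> B" "e \<noteq> f"
  have letters: "[e] \<in> L" "[f] \<in> L" using ef by simp_all
  show False if x: "w @ [e, f] \<in> L"
  proof -
    have adj: "R (last w) e" "R e f" using x ne by (simp_all add: append_in_path_lang)
    \<comment> \<open>\<open>f\<close> differs from \<open>hd w\<close>, since otherwise
      \<open>e\<close> would lead back to the start of \<open>w\<close>.\<close>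
    have hd: "hd w \<noteq> e" "hd w \<noteq> f" using adj w(2) no_return[OF ef(1)] by auto
    have first: "[e] @ v \<noteq> w @ [e, f]" "[f] @ v \<noteq> w @ [e, f]" for v
      using hd ne by (cases w; auto)+
    have "coef a w = 0"
    proof (rule isolate_outer[OF letters x])
      fix u :: "'a list"
      assume "w @ [e, f] = [e] @ [f] @ w"
      then show "u @ [e] @ [f] \<noteq> w @ [e, f]" using first(1)[of "[f] @ w"] by simp
    qed (use first ef(3) in auto)
    then show False using w(3) by simp
  qed
  show False if x: "[e] @ w @ [f] \<in> L"
  proof -
    have adj: "R (last w) f" "R e (hd w)" using x ne by (simp_all add: append_in_path_lang)
    have hd: "hd w \<noteq> f" and last: "last w \<noteq> e" using adj w(2) by auto
    have "coef a w = 0"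
    proof (rule isolate_middle[OF letters x])
      fix u :: "'a list"
      show "[e] @ [f] @ u \<noteq> [e] @ w @ [f]"
        using hd ne by (cases w) auto
      show "u @ [e] @ [f] \<noteq> [e] @ w @ [f]"
      proof
        assume "u @ [e] @ [f] = [e] @ w @ [f]"
        then have "u @ [e] = [e] @ w" by simp
        from arg_cong[OF this, of last] show False using last ne by simp
      qed
      show "u @ [f] @ [e] \<noteq> [e] @ w @ [f]"
      proof
        assume "u @ [f] @ [e] = [e] @ w @ [f]"
        from arg_cong[OF this, of last] show False using ef(3) by simp
      qed
    qed (use ef(3) in simp_all)
    then show False using w(3) by simp
  qed
  show False if x: "[e, f] @ w \<in> L"
  proof -
    have adj: "R e f" "R f (hd w)" using x ne by simp_all
    have last: "last w \<noteq> e" "last w \<noteq> f" using adj w(2) no_return[OF ef(2)] by auto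
    have final: "v @ [e] \<noteq> [e, f] @ w" "v @ [f] \<noteq> [e, f] @ w" for v
      using last ne by (cases w rule: rev_cases; auto)+
    have "coef a w = 0"
    proof (rule isolate_outer[OF letters x])
      fix u :: "'a list"
      show "u @ [f] @ [e] \<noteq> [e, f] @ w" "[e] @ u @ [f] \<noteq> [e, f] @ w"
        "[f] @ u @ [e] \<noteq> [e, f] @ w" "u @ [e] @ [f] \<noteq> [e, f] @ w"
        using final(1)[of "u @ [f]"] final(2)[of "[e] @ u"] final(1)[of "[f] @ u"] final(2)[of "u @ [e]"]
        by simp_all
      assume "[e, f] @ w = w @ [e] @ [f]"
      then show "[e] @ [f] @ u \<noteq> [e, f] @ w" using final(2)[of "w @ [e]"] by simp
    qed (use ef(3) in simp_all)
    then show False using w(3) by simp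
  qed
qed

end

text \<open>A loop with edges that all leave its vertex, or all enter it, and cannot be prolonged at
  their other end: the graph form of cases (2) and (3) of property (\<Delta>). The loop alone, case
  (1), satisfies both.\<close>

definition loop_star :: "'a \<Rightarrow> bool" where
  "loop_star e \<longleftrightarrow> e \<in> B \<and> R e e \<and>
     ((\<forall>f\<in>B. R e f) \<and> (\<forall>f\<in>B. \<forall>y\<in>B. R f y \<longrightarrow> f = e) \<or>
      (\<forall>f\<in>B. R f e) \<and> (\<forall>f\<in>B. \<forall>y\<in>B. R y f \<longrightarrow> f = e))"

lemma three_center_support:
  fixes a :: "'a list \<Rightarrow>\<^sub>0 'k::field_char_0"
  assumes conn: "step_connected B R" and a: "a \<in> three_center L" and w: "coef a w \<noteq> 0"
  shows "rigid B R w \<or> (\<exists>e. loop_star e \<and> set w \<subseteq> {e})"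
proof -
  have wL: "w \<in> L" using a w by (auto simp: three_center_def lang_alg_iff)
  show ?thesis
  proof (cases "R (last w) (hd w)")
    case True
    then obtain e where e: "e \<in> B" "R e e" "set w \<subseteq> {e}"
      using three_center_closed[OF a wL _ w] by blast
    have through: "\<not> (R g e \<and> R e f)" if "g \<in> B" "f \<in> B" "g \<noteq> e" "f \<noteq> e" for f g
      using three_center_through_loop[OF a e(1,2) wL e(3)] that w by blast
    have loop_then: "h = e" if "f \<in> B" "h \<in> B" "R e f" "f \<noteq> e" "R f h" for f h
      using three_center_loop_then[OF a e(1,2) wL e(3)] that w by blast
    have then_loop: "h = e" if "f \<in> B" "h \<in> B" "R f e" "f \<noteq> e" "R h f" for f h
      using three_center_then_loop[OF a e(1,2) wL e(3)] that w by blast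
    have "loop_star e"
    \<comment> \<open>By \<open>through\<close>, the other edges at the vertex either all enter or
      all leave. In each case the edges at the vertex form a closed set, which connectedness makes
      all of \<open>B\<close>.\<close>
    proof (cases "\<exists>g\<in>B. g \<noteq> e \<and> R g e")
      case True
      then have out: "f = e" if "f \<in> B" "R e f" for f using through that by blast
      let ?C = "{f \<in> B. R f e}"
      have dead: "f = e" if "f \<in> ?C" "y \<in> B" "R y f" for f y
        using then_loop[of f y] out[of f] that by blast
      have "step_closed B R ?C"
        unfolding step_closed_def
      proof (intro conjI ballI impI iffI)
        fix x y assume xy: "x \<in> B" "y \<in> B" "R x y"
        show "x \<in> ?C" if "y \<in> ?C" using dead[OF that xy(1,3)] xy by auto
        show "y \<in> ?C" if "x \<in> ?C"
          using that common_end[of e e x y] out[of y] e xy by auto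
      qed auto
      then have "?C = B" using conn e by (auto simp: step_connected_def)
      then show ?thesis using dead e unfolding loop_star_def by blast
    next
      case False
      then have into: "f = e" if "f \<in> B" "R f e" for f using that by blast
      let ?C = "{f \<in> B. R e f}"
      have dead: "f = e" if "f \<in> ?C" "y \<in> B" "R f y" for f y
        using loop_then[of f y] into[of f] that by blast
      have "step_closed B R ?C"
        unfolding step_closed_def
      proof (intro conjI ballI impI iffI)
        fix x y assume xy: "x \<in> B" "y \<in> B" "R x y"
        show "y \<in> ?C" if "x \<in> ?C" using dead[OF that xy(2,3)] xy by auto
        show "x \<in> ?C" if "y \<in> ?C"
          using that common_end[of x y e e] into[of x] e xy by auto
      qed auto
      then have "?C = B" using conn e by (auto simp: step_connected_def)
      then show ?thesis using dead e unfolding loop_star_def by blast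
    qed
    then show ?thesis using e by blast
  next
    case False
    then show ?thesis using three_center_open_rigid[OF a wL _ w] by blast
  qed
qed

theorem three_center_path_lang:
  assumes "step_connected B R"
  shows "(three_center L :: ('a list \<Rightarrow>\<^sub>0 'k::field_char_0) set) =
    lin_span {word_elt w | w. w \<in> L \<and> (rigid B R w \<or> (\<exists>e. loop_star e \<and> set w \<subseteq> {e}))}"
    (is "_ = lin_span {word_elt w | w. w \<in> L \<and> ?D w}")
proof -
  have "three_center L = (lang_alg {w \<in> L. ?D w} :: ('a list \<Rightarrow>\<^sub>0 'k) set)"
  proof (intro equalityI subsetI)
    fix a :: "'a list \<Rightarrow>\<^sub>0 'k" assume a: "a \<in> three_center L"
    then have "a \<in> lang_alg L" by (simp add: three_center_def)
    then show "a \<in> lang_alg {w \<in> L. ?D w}"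
      using three_center_support[OF assms a] by (auto simp: lang_alg_iff)
  next
    fix a :: "'a list \<Rightarrow>\<^sub>0 'k" assume a: "a \<in> lang_alg {w \<in> L. ?D w}"
    show "a \<in> three_center L"
    proof (rule three_centerI)
      show "a \<in> lang_alg L" using a by (auto simp: lang_alg_def)
      fix u b c assume "u \<in> supp a" and bc: "b \<in> L" "c \<in> L"
      then have u: "u \<in> L" "?D u" using a by (auto simp: lang_alg_def)
      from u(2) show "St3 L (word_elt u) (word_elt b) (word_elt c) = 0"
      proof (elim disjE exE conjE)
        fix e assume "loop_star e" "set u \<subseteq> {e}"
        then show ?thesis
          using bc u(1) by (intro St3_loop_dead_ends[where e = e]) (auto simp: loop_star_def)
      qed (rule St3_rigid[OF _ u(1) bc])
    qed
  qed
  then show ?thesis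
    by (subst (asm) lin_span_words[of "{w \<in> L. ?D w}", symmetric]) simp
qed

end

section \<open>Block languages\<close>

text \<open>Serves to unfold the quantifier over permutations in property (\<Delta>).\<close>

lemma ex_permutes_3:
  "(\<exists>\<sigma>. \<sigma> permutes {0, 1, 2::nat} \<and> P (\<sigma> 0) (\<sigma> 1) (\<sigma> 2)) \<longleftrightarrow>
     P 0 1 2 \<or> P 0 2 1 \<or> P 1 0 2 \<or> P 1 2 0 \<or> P 2 0 1 \<or> P 2 1 0" (is "?l \<longleftrightarrow> ?r")
proof
  assume ?l
  then obtain \<sigma> where \<sigma>: "\<sigma> permutes {0, 1, 2::nat}" "P (\<sigma> 0) (\<sigma> 1) (\<sigma> 2)" by blast
  have "\<sigma> 0 \<in> {0, 1, 2}" "\<sigma> 1 \<in> {0, 1, 2}" "\<sigma> 2 \<in> {0, 1, 2}"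
    unfolding permutes_in_image[OF \<sigma>(1)] by simp_all
  moreover have "\<sigma> 0 \<noteq> \<sigma> 1" "\<sigma> 0 \<noteq> \<sigma> 2" "\<sigma> 1 \<noteq> \<sigma> 2"
    using permutes_inj[OF \<sigma>(1)] by (simp_all add: inj_eq)
  ultimately show ?r using \<sigma>(2) by auto
next
  have t: "transpose i j permutes {0, 1, 2::nat}" if "i \<in> {0, 1, 2}" "j \<in> {0, 1, 2}" for i j
    using that by (rule permutes_swap_id)
  have ex: ?l if "\<tau> permutes {0, 1, 2::nat}" "P (\<tau> 0) (\<tau> 1) (\<tau> 2)" for \<tau>
    using that by blast
  assume ?r
  then show ?l
  proof (elim disjE)
    assume "P 0 1 2"
    then show ?l by (intro ex[of id] permutes_id) simp
  next
    assume "P 0 2 1"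
    then show ?l by (intro ex[of "transpose 1 2"] t) (simp_all add: transpose_def)
  next
    assume "P 1 0 2"
    then show ?l by (intro ex[of "transpose 0 1"] t) (simp_all add: transpose_def)
  next
    assume "P 1 2 0"
    then show ?l
      by (intro ex[of "transpose 0 1 \<circ> transpose 1 2"] permutes_compose t) (simp_all add: transpose_def)
  next
    assume "P 2 0 1"
    then show ?l
      by (intro ex[of "transpose 1 2 \<circ> transpose 0 1"] permutes_compose t) (simp_all add: transpose_def)
  next
    assume "P 2 1 0"
    then show ?l by (intro ex[of "transpose 0 2"] t) (simp_all add: transpose_def)
  qed
qed

lemma butlast_replicate: "butlast (replicate n x) = replicate (n - 1) x"
  by (simp add: butlast_conv_take)

text \<open>Equality with its own shift makes neighbouring letters equal; this identifies the loops
  of the block graph.\<close>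

lemma replicate_if_tl_eq_butlast:
  assumes "tl w = butlast w" "w \<noteq> []"
  shows "w = replicate (length w) (hd w)"
proof -
  have "w ! Suc i = w ! i" if "Suc i < length w" for i
    using that assms(1) nth_tl[of i w] nth_butlast[of i w] by simp
  then have const: "i < length w \<Longrightarrow> w ! i = w ! 0" for i
    by (induction i) auto
  show ?thesis
  proof (rule nth_equalityI)
    fix i assume "i < length w"
    then show "w ! i = replicate (length w) (hd w) ! i"
      using const[of i] assms(2) by (simp add: hd_conv_nth)
  qed simp
qed

lemma block_letters_finite: "finite A \<Longrightarrow> finite (block_letters A F)"
  by (rule finite_subset[OF _ finite_lists_length_eq[of A "max_length F"]])
    (auto simp: block_letters_def words_of_length_def formal_lang_def words_def)

lemma length_block_letter: "x \<in> block_letters A F \<Longrightarrow> length x = max_length F"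
  by (simp add: block_letters_def words_of_length_def)

abbreviation follows :: "'a list \<Rightarrow> 'a list \<Rightarrow> bool" where
  "follows x y \<equiv> tl x = butlast y"

text \<open>Loops are constant words, and two constant words whose overlap of length
  \<open>k - 1\<close> is non-empty use the same letter; this is where \<open>k \<ge> 2\<close>
  matters.\<close>

lemma block_edge_paths:
  assumes "max_length F \<ge> 2"
  shows "edge_paths (block_letters A F) follows"
proof
  fix x y assume xy: "x \<in> block_letters A F" "y \<in> block_letters A F"
    and loops: "follows x x" "follows y y" "follows x y"
  have len: "length x = max_length F" "length y = max_length F"
    using xy by (simp_all add: length_block_letter)
  then have ne: "x \<noteq> []" "y \<noteq> []" using assms by auto
  have x: "x = replicate (max_length F) (hd x)" and y: "y = replicate (max_length F) (hd y)"
    using replicate_if_tl_eq_butlast loops(1,2) ne len by metis+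
  obtain j where j: "max_length F = Suc (Suc j)"
    using assms by (metis Suc_le_D add_2_eq_Suc le_Suc_ex)
  have "tl (replicate (max_length F) (hd x)) = butlast (replicate (max_length F) (hd y))"
    using loops(3) x y by metis
  then have "hd x = hd y" by (simp add: j)
  then show "x = y" using x y by metis
qed auto

text \<open>The first alternative of the property is rigidity; the second describes powers of the
  loop in a loop star.\<close>

lemma property_Delta_iff:
  assumes k: "max_length F \<ge> 2" and w: "w \<in> block_lang A F"
  shows "property_Delta A F w \<longleftrightarrow>
    rigid (block_letters A F) follows w \<or>
    (\<exists>e. edge_paths.loop_star (block_letters A F) follows e \<and> set w \<subseteq> {e})"
proof -
  interpret edge_paths "block_letters A F" follows
    using k by (rule block_edge_paths)
  define B where "B = block_letters A F"
  have len: "length f = max_length F" "f \<noteq> []" "butlast f \<noteq> []" "tl f \<noteq> []" if "f \<in> B" for f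
    using that k length_block_letter[of f A F] by (auto simp: B_def simp flip: length_0_conv)
  have w_ne: "w \<noteq> []" using w by (auto simp: block_lang_eq_path_lang)
  have perm: "(\<exists>\<sigma>. \<sigma> permutes {0, 1, 2::nat} \<and>
      (let x = (\<lambda>i. [w, [e], [f]] ! \<sigma> i) in x 0 @ x 1 @ x 2 \<in> block_lang A F)) \<longleftrightarrow>
      w @ [e, f] \<in> block_lang A F \<or> w @ [f, e] \<in> block_lang A F \<or>
      [e] @ w @ [f] \<in> block_lang A F \<or> [e, f] @ w \<in> block_lang A F \<or>
      [f] @ w @ [e] \<in> block_lang A F \<or> [f, e] @ w \<in> block_lang A F" for e f
    unfolding Let_def
    using ex_permutes_3[of "\<lambda>i j k. [w, [e], [f]] ! i @ [w, [e], [f]] ! j @ [w, [e], [f]] ! k \<in> block_lang A F"]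
    by simp
  have first_iff: "\<not> (\<exists>e\<in>B. \<exists>f\<in>B. e \<noteq> f \<and>
      (\<exists>\<sigma>. \<sigma> permutes {0, 1, 2::nat} \<and>
        (let x = (\<lambda>i. [w, [e], [f]] ! \<sigma> i) in x 0 @ x 1 @ x 2 \<in> block_lang A F))) \<longleftrightarrow>
    rigid B follows w"
  proof -
    \<comment> \<open>Both \<open>(e, f)\<close> and \<open>(f, e)\<close> are quantified, so three
      of the six orders remain.\<close>
    have symm: "\<not> (\<exists>e\<in>B. \<exists>f\<in>B. e \<noteq> f \<and> (X e f \<or> X f e \<or> Y e f \<or> Z e f \<or> Y f e \<or> Z f e)) \<longleftrightarrow>
        (\<forall>e\<in>B. \<forall>f\<in>B. e \<noteq> f \<longrightarrow> \<not> X e f \<and> \<not> Y e f \<and> \<not> Z e f)" for X Y Z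
      by (rule iffI) (metis, metis)
    show ?thesis
      unfolding perm symm[of "\<lambda>e f. w @ [e, f] \<in> block_lang A F" "\<lambda>e f. [e] @ w @ [f] \<in> block_lang A F"
          "\<lambda>e f. [e, f] @ w \<in> block_lang A F"]
      by (simp only: rigid_def B_def block_lang_eq_path_lang)
  qed
  have second_iff: "(\<exists>l a. l \<ge> 1 \<and>
        (let Aw = replicate (max_length F) a in
           w = replicate l Aw \<and>
           (B = {Aw} \<or>
            (\<exists>S. a \<notin> S \<and> B = insert Aw {butlast Aw @ [b] | b. b \<in> S}) \<or>
            (\<exists>S. a \<notin> S \<and> B = insert Aw {d # tl Aw | d. d \<in> S}))))
    \<longleftrightarrow> (\<exists>e. loop_star e \<and> set w \<subseteq> {e})" (is "?l \<longleftrightarrow> ?r")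
  proof
    assume ?l
    then obtain l a where la: "w = replicate l (replicate (max_length F) a) \<and>
        (B = {replicate (max_length F) a} \<or>
         (\<exists>S. a \<notin> S \<and> B = insert (replicate (max_length F) a)
            {butlast (replicate (max_length F) a) @ [b] | b. b \<in> S}) \<or>
         (\<exists>S. a \<notin> S \<and> B = insert (replicate (max_length F) a)
            {d # tl (replicate (max_length F) a) | d. d \<in> S}))"
      unfolding Let_def by (elim exE conjE) (rule that, intro conjI)
    define Aw where Aw: "Aw = replicate (max_length F) a"
    note la = la[folded Aw]
    then have w: "w = replicate l Aw"
      and B: "B = {Aw} \<or> (\<exists>S. a \<notin> S \<and> B = insert Aw {butlast Aw @ [b] | b. b \<in> S}) \<or>
            (\<exists>S. a \<notin> S \<and> B = insert Aw {d # tl Aw | d. d \<in> S})"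
      by (rule conjunct1, rule conjunct2)
    have AwB: "Aw \<in> B" using B by blast
    obtain j where j: "max_length F = Suc (Suc j)"
      using k by (metis Suc_le_D add_2_eq_Suc le_Suc_ex)
    have tl_Aw: "tl Aw = replicate (Suc j) a" and butlast_Aw: "butlast Aw = replicate (Suc j) a"
      by (simp_all add: Aw j butlast_replicate tl_replicate del: replicate.simps)
    from B have "loop_star Aw"
    proof (elim disjE exE conjE)
      assume "B = {Aw}"
      then show ?thesis using tl_Aw butlast_Aw unfolding loop_star_def unfolding B_def[symmetric] by simp
    next
      fix S assume S: "a \<notin> S" and B: "B = insert Aw {butlast Aw @ [b] | b. b \<in> S}"
      have before: "butlast f = replicate (Suc j) a" if "f \<in> B" for f
        using that by (auto simp: B butlast_Aw)
      \<comment> \<open>A word ending in a letter other than \<open>a\<close> has no successor,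
        because every word of \<open>B\<close> begins with \<open>k - 1\<close> copies of
        \<open>a\<close>.\<close>
      have "f = Aw" if f: "f \<in> B" "y \<in> B" "follows f y" for f y
      proof (rule ccontr)
        assume "f \<noteq> Aw"
        then obtain b where b: "b \<in> S" "f = butlast Aw @ [b]" using f(1) B by blast
        then have "last (tl f) = b" by (simp add: butlast_Aw)
        moreover have "last (tl f) = a" using f(3) before[OF f(2)] by simp
        ultimately show False using S b(1) by simp
      qed
      note dead = this
      show ?thesis
        unfolding loop_star_def unfolding B_def[symmetric]
        by (intro conjI disjI1 ballI impI) (metis AwB tl_Aw butlast_Aw before dead)+
    next
      fix S assume S: "a \<notin> S" and B: "B = insert Aw {d # tl Aw | d. d \<in> S}"
      have after: "tl f = replicate (Suc j) a" if "f \<in> B" for f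
        using that by (auto simp: B tl_Aw)
      have "f = Aw" if f: "f \<in> B" "y \<in> B" "follows y f" for f y
      proof (rule ccontr)
        assume "f \<noteq> Aw"
        then obtain d where d: "d \<in> S" "f = d # tl Aw" using f(1) B by blast
        then have "hd (butlast f) = d" by (simp add: tl_Aw)
        moreover have "hd (butlast f) = a" using f(3) after[OF f(2)] by (metis hd_replicate Zero_not_Suc)
        ultimately show False using S d(1) by simp
      qed
      note dead = this
      show ?thesis
        unfolding loop_star_def unfolding B_def[symmetric]
        by (intro conjI disjI2 ballI impI) (metis AwB tl_Aw butlast_Aw after dead)+
    qed
    then show ?r using w by (intro exI[of _ Aw]) auto
  next
    assume ?r
    then obtain e where e: "loop_star e" "set w \<subseteq> {e}" by blast
    have eB: "e \<in> B" and ee: "follows e e" using e(1) by (auto simp: loop_star_def B_def)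
    define a where "a = hd e"
    have e_eq: "e = replicate (max_length F) a"
      using replicate_if_tl_eq_butlast[OF ee] len[OF eB] by (simp add: a_def)
    then have last_e: "last e = a" using len(2)[OF eB] by (metis last_replicate length_0_conv length_replicate)
    have w_eq: "w = replicate (length w) e"
      using e(2) by (auto intro!: replicate_eqI)
    \<comment> \<open>\<open>S\<close> may be empty, so the single loop is covered by either
      shape.\<close>
    have "(\<exists>S. a \<notin> S \<and> B = insert e {butlast e @ [b] | b. b \<in> S}) \<or>
          (\<exists>S. a \<notin> S \<and> B = insert e {d # tl e | d. d \<in> S})"
    proof -
      consider "\<forall>f\<in>B. follows e f" | "\<forall>f\<in>B. follows f e"
        using e(1) unfolding loop_star_def B_def by blast
      then show ?thesis
      proof cases
        case 1
        then have f: "f = butlast e @ [last f]" if "f \<in> B" for f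
          using ee that len(2)[OF that] by (metis append_butlast_last_id)
        let ?S = "last ` (B - {e})"
        have "a \<notin> ?S"
        proof
          assume "a \<in> ?S"
          then obtain f where "f \<in> B" "f \<noteq> e" "last f = a" by auto
          then show False using f[of f] f[OF eB] last_e by metis
        qed
        moreover have "B = insert e {butlast e @ [b] | b. b \<in> ?S}"
        proof (intro equalityI subsetI)
          fix g assume "g \<in> B"
          then show "g \<in> insert e {butlast e @ [b] | b. b \<in> ?S}" using f[of g] by blast
        next
          fix g assume "g \<in> insert e {butlast e @ [b] | b. b \<in> ?S}"
          then show "g \<in> B" using f eB by fastforce
        qed
        ultimately show ?thesis by blast
      next
        case 2
        then have f: "f = hd f # tl e" if "f \<in> B" for f
          using ee that len(2)[OF that] by (metis list.collapse)
        let ?S = "hd ` (B - {e})"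
        have "a \<notin> ?S"
        proof
          assume "a \<in> ?S"
          then obtain f where "f \<in> B" "f \<noteq> e" "hd f = a" by auto
          then show False using f[of f] f[OF eB] a_def by metis
        qed
        moreover have "B = insert e {d # tl e | d. d \<in> ?S}"
        proof (intro equalityI subsetI)
          fix g assume "g \<in> B"
          then show "g \<in> insert e {d # tl e | d. d \<in> ?S}" using f[of g] by blast
        next
          fix g assume "g \<in> insert e {d # tl e | d. d \<in> ?S}"
          then show "g \<in> B" using f eB by fastforce
        qed
        ultimately show ?thesis by blast
      qed
    qed
    then show ?l
      unfolding Let_def e_eq[symmetric] using w_eq w_ne e_eq
      by (intro exI[of _ "length w"] exI[of _ a]) (auto simp: Suc_le_eq)
  qed
  show ?thesis
    unfolding property_Delta_def Let_def
    by (rule arg_cong2[where f = "(\<or>)", OF first_iff[unfolded Let_def B_def]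
          second_iff[unfolded Let_def B_def]])
qed

lemma three_center_block_lang:
  assumes "finite A" "max_length F \<ge> 2" "alg_irreducible (block_lang A F)"
  shows "(three_center (block_lang A F) :: ('a list list \<Rightarrow>\<^sub>0 'k::field_char_0) set)
    = lin_span {word_elt w | w. w \<in> block_lang A F \<and> property_Delta A F w}"
proof -
  interpret edge_paths "block_letters A F" follows
    using assms(2) by (rule block_edge_paths)
  have "step_connected (block_letters A F) follows"
    using assms(3) step_connected_if_alg_irreducible[OF block_letters_finite[OF assms(1)]]
    by (simp add: block_lang_eq_path_lang)
  from three_center_path_lang[OF this, where 'k = 'k]
  have *: "(three_center (block_lang A F) :: ('a list list \<Rightarrow>\<^sub>0 'k) set) = lin_span {word_elt w | w. w \<in> block_lang A F \<and>
      (rigid (block_letters A F) follows w \<or> (\<exists>e. loop_star e \<and> set w \<subseteq> {e}))}"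
    unfolding block_lang_eq_path_lang .
  show ?thesis
    unfolding * using property_Delta_iff[OF assms(2)] by (intro arg_cong[where f = lin_span]) blast
qed

section \<open>Forbidden letters\<close>

lemma sublist_singleton_iff: "sublist [x] w \<longleftrightarrow> x \<in> set w"
  by (induction w) (auto simp: sublist_Cons_right)

text \<open>Forbidden words are non-empty, so with maximal length 1 they are letters. What remains
  is the free language on the other letters, seen as the paths of a bouquet of loops.\<close>

lemma formal_lang_forbidden_letters:
  assumes "finite F" "F \<noteq> {}" "F \<subseteq> words A" "max_length F = 1"
  shows "formal_lang A F = path_lang {a \<in> A. [a] \<notin> F} (\<lambda>_ _. True)"
proof -
  have letter: "\<exists>a. f = [a]" if "f \<in> F" for f
  proof -
    have "length f \<le> 1"
      using assms(1,4) that unfolding max_length_def by (metis Max_ge finite_imageI imageI)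
    moreover have "f \<noteq> []" using assms(3) that by (auto simp: words_def)
    ultimately show ?thesis by (cases f) auto
  qed
  have "(\<forall>f\<in>F. \<not> sublist f w) \<longleftrightarrow> (\<forall>a\<in>set w. [a] \<notin> F)" for w
    using letter sublist_singleton_iff by metis
  moreover have "successively (\<lambda>_ _. True) w" for w :: "'a list"
    by (induction w rule: induct_list012) auto
  ultimately show ?thesis
    by (auto simp: formal_lang_def words_def path_lang_def)
qed

text \<open>Appending a letter different from \<open>hd w\<close> gives a path whose first and last
  letters differ, which forces the coefficient of \<open>w\<close> to vanish.\<close>

lemma free_lang_center:
  assumes "x \<in> B" "y \<in> B" "x \<noteq> y"
  shows "center (path_lang B (\<lambda>_ _. True)) = {0 :: 'a list \<Rightarrow>\<^sub>0 'k::field}"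
proof (intro equalityI subsetI)
  fix a :: "'a list \<Rightarrow>\<^sub>0 'k" assume a: "a \<in> center (path_lang B (\<lambda>_ _. True))"
  have "coef a w = 0" for w
  proof (cases "w \<in> path_lang B (\<lambda>_ _. True)")
    case True
    then have ne: "w \<noteq> []" by auto
    obtain e where "e \<in> B" "e \<noteq> hd w" using assms by metis
    then have "w @ [e] \<in> path_lang B (\<lambda>_ _. True)" "hd (w @ [e]) \<noteq> last (w @ [e])"
      using True ne by (auto simp: append_in_path_lang)
    then show ?thesis using center_coef(2)[OF a] by fastforce
  qed (use a in \<open>auto simp: center_def intro: coef_outside\<close>)
  then show "a \<in> {0}" by (simp add: poly_mapping_eqI)
qed (simp add: center_def)

text \<open>Several loops at one vertex are outside \<open>edge_paths\<close>, hence a separate test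
  word: \<open>b\<close> and \<open>c\<close> begin with \<open>e\<close> while the test word begins
  with \<open>hd w\<close>, which puts \<open>u\<close> in front, and the last letters distinguish
  the orders \<open>bc\<close> and \<open>cb\<close>.\<close>

lemma free_lang_three_center:
  assumes "x \<in> B" "y \<in> B" "x \<noteq> y"
  shows "three_center (path_lang B (\<lambda>_ _. True)) = {0 :: 'a list \<Rightarrow>\<^sub>0 'k::field}"
proof (intro equalityI subsetI)
  fix a :: "'a list \<Rightarrow>\<^sub>0 'k" assume a: "a \<in> three_center (path_lang B (\<lambda>_ _. True))"
  have "coef a w = 0" for w
  proof (cases "w \<in> path_lang B (\<lambda>_ _. True)")
    case True
    then have ne: "w \<noteq> []" and hd: "hd w \<in> B" by (auto intro: path_lang_ends)
    obtain e where e: "e \<in> B" "e \<noteq> hd w" using assms by metis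
    show ?thesis
    proof (rule three_center_coef_eq_0[OF path_lang_factor_closed a,
          where b = "[e]" and c = "[e, hd w]" and x = "w @ [e] @ [e, hd w]" and \<kappa> = 1])
      show "w @ [e] @ [e, hd w] \<in> path_lang B (\<lambda>_ _. True)"
        using True ne hd e by (simp add: append_in_path_lang)
      have "e # v \<noteq> w @ [e, e, hd w]" for v
        using e(2) ne by (cases w) auto
      then show "of_bool (u @ [e] @ [e, hd w] = w @ [e] @ [e, hd w])
          - of_bool (u @ [e, hd w] @ [e] = w @ [e] @ [e, hd w])
          + of_bool ([e] @ [e, hd w] @ u = w @ [e] @ [e, hd w])
          - of_bool ([e] @ u @ [e, hd w] = w @ [e] @ [e, hd w])
          + of_bool ([e, hd w] @ u @ [e] = w @ [e] @ [e, hd w])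
          - of_bool ([e, hd w] @ [e] @ u = w @ [e] @ [e, hd w]) = 1 * (of_bool (u = w) :: 'k)" for u
        using e(2) by simp
    qed (use e hd in simp_all)
  qed (use a in \<open>auto simp: three_center_def intro: coef_outside\<close>)
  then show "a \<in> {0}" by (simp add: poly_mapping_eqI)
qed (simp add: three_center_def St3_eq)

theorem theorem1p5:
  fixes A :: "'a set" and F :: "'a list set"
  assumes "finite A" and "finite F" and "F \<noteq> {}" and "F \<subseteq> words A"
  shows
    "(max_length F = 1 \<longrightarrow>
       (\<forall>t. {a \<in> A. [a] \<notin> F} = {t} \<longrightarrow>
          (center (formal_lang A F) :: ('a list \<Rightarrow>\<^sub>0 'k::field_char_0) set)
            = three_center (formal_lang A F) \<and>
          (three_center (formal_lang A F) :: ('a list \<Rightarrow>\<^sub>0 'k) set)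
            = {poly_eval (formal_lang A F) f (word_elt [t]) | f. poly f 0 = 0}) \<and>
       (card {a \<in> A. [a] \<notin> F} \<ge> 2 \<longrightarrow>
          (center (formal_lang A F) :: ('a list \<Rightarrow>\<^sub>0 'k) set) = three_center (formal_lang A F) \<and>
          (three_center (formal_lang A F) :: ('a list \<Rightarrow>\<^sub>0 'k) set) = {0})) \<and>
     (max_length F \<ge> 2 \<longrightarrow>
       (\<exists>\<M>. alg_components (block_lang A F) \<M> id) \<and>
       (\<forall>(\<M> :: 'c list set set) \<phi>. alg_components (block_lang A F) \<M> \<phi> \<longrightarrow>
          is_direct_sum (block_lang A F) \<M> \<phi>
            (center (block_lang A F) :: ('a list list \<Rightarrow>\<^sub>0 'k) set) center) \<and>
       (alg_irreducible (block_lang A F) \<longrightarrow>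
          ((\<nexists>\<omega>s. cyclic_listing (block_letters A F) \<omega>s) \<longrightarrow>
             (center (block_lang A F) :: ('a list list \<Rightarrow>\<^sub>0 'k) set)
               = lin_span {word_elt w | w. w \<in> block_lang A F \<and>
                   two_sided_unextendable (block_letters A F) (block_lang A F) w}) \<and>
          (\<forall>\<omega>s. cyclic_listing (block_letters A F) \<omega>s \<longrightarrow>
             (center (block_lang A F) :: ('a list list \<Rightarrow>\<^sub>0 'k) set)
               = {\<Sum>i<length \<omega>s. poly_eval (block_lang A F) f (word_elt (rotate i \<omega>s)) | f.
                   poly f 0 = 0} \<and>
             iso_polys_zero_const (block_lang A F)
               (center (block_lang A F) :: ('a list list \<Rightarrow>\<^sub>0 'k) set)))) \<and>
     (max_length F \<ge> 2 \<longrightarrow>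
       (\<forall>(\<M> :: 'c list set set) \<phi>. alg_components (block_lang A F) \<M> \<phi> \<longrightarrow>
          is_direct_sum (block_lang A F) \<M> \<phi>
            (three_center (block_lang A F) :: ('a list list \<Rightarrow>\<^sub>0 'k) set) three_center) \<and>
       (alg_irreducible (block_lang A F) \<longrightarrow>
          ((\<nexists>a. block_letters A F = {replicate (max_length F) a}) \<longrightarrow>
             (three_center (block_lang A F) :: ('a list list \<Rightarrow>\<^sub>0 'k) set)
               = lin_span {word_elt w | w. w \<in> block_lang A F \<and> property_Delta A F w}) \<and>
          ((\<exists>a. block_letters A F = {replicate (max_length F) a}) \<longrightarrow>
             (three_center (block_lang A F) :: ('a list list \<Rightarrow>\<^sub>0 'k) set)
               = lang_alg (block_lang A F) \<and>
             iso_polys_zero_const (block_lang A F)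
               (three_center (block_lang A F) :: ('a list list \<Rightarrow>\<^sub>0 'k) set))))"
proof (intro conjI impI allI)
  let ?X = "formal_lang A F" and ?B = "{a \<in> A. [a] \<notin> F}"
  assume "max_length F = 1"
  then have X: "?X = path_lang ?B (\<lambda>_ _. True)"
    by (rule formal_lang_forbidden_letters[OF assms(2-4)])
  fix t assume t: "?B = {t}"
  \<comment> \<open>A single remaining letter is a cycle of length 1, whose only rotation is the
    letter itself.\<close>
  have "cycle_on ?B (\<lambda>_ _. True) [t]"
    unfolding t cycle_on_def by simp
  then interpret cycle ?B "\<lambda>_ _. True" "[t]"
    by (rule cycle.intro)
  have n: "n = 1" by (simp add: n_def)
  show "(center ?X :: ('a list \<Rightarrow>\<^sub>0 'k) set) = three_center ?X"
    unfolding X center_loop[OF n] three_center_loop[OF n] ..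
  show "(three_center ?X :: ('a list \<Rightarrow>\<^sub>0 'k) set)
      = {poly_eval ?X f (word_elt [t]) | f. poly f 0 = 0}"
    \<comment> \<open>The 3-center is the whole algebra, hence equal to the center, which the
      general result on cycles describes by polynomials.\<close>
    unfolding X three_center_loop[OF n] center_loop[OF n, symmetric] center_cycle rot_sum_def by simp
next
  let ?X = "formal_lang A F" and ?B = "{a \<in> A. [a] \<notin> F}"
  assume "max_length F = 1" and "card ?B \<ge> 2"
  then have X: "?X = path_lang ?B (\<lambda>_ _. True)"
    using formal_lang_forbidden_letters[OF assms(2-4)] by blast
  obtain T where "T \<subseteq> ?B" "card T = 2"
    using obtain_subset_with_card_n[OF \<open>card ?B \<ge> 2\<close>] by blast
  then obtain x y where xy: "x \<in> ?B" "y \<in> ?B" "x \<noteq> y"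
    unfolding card_2_iff by blast
  show "(center ?X :: ('a list \<Rightarrow>\<^sub>0 'k) set) = three_center ?X"
    "(three_center ?X :: ('a list \<Rightarrow>\<^sub>0 'k) set) = {0}"
    unfolding X free_lang_center[OF xy] free_lang_three_center[OF xy] by (rule refl)+
next
  \<comment> \<open>Existence of components keeps the direct sum statements from being
    vacuous.\<close>
  show "\<exists>\<M>. alg_components (block_lang A F) \<M> id"
    unfolding block_lang_eq_path_lang
    by (rule alg_components_path_lang_exist[OF block_letters_finite[OF assms(1)]])
next
  fix \<M> :: "'c list set set" and \<phi>
  assume "alg_components (block_lang A F) \<M> \<phi>"
  then interpret decomposed "block_lang A F" \<M> \<phi>
    by unfold_locales (simp add: alg_components_def)
  show "is_direct_sum (block_lang A F) \<M> \<phi>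
      (center (block_lang A F) :: ('a list list \<Rightarrow>\<^sub>0 'k) set) center"
    "is_direct_sum (block_lang A F) \<M> \<phi>
      (three_center (block_lang A F) :: ('a list list \<Rightarrow>\<^sub>0 'k) set) three_center"
    by (rule center_direct_sum three_center_direct_sum)+
next
  assume "alg_irreducible (block_lang A F)" and acyclic: "\<nexists>\<omega>s. cyclic_listing (block_letters A F) \<omega>s"
  then have "step_connected (block_letters A F) follows"
    using step_connected_if_alg_irreducible[OF block_letters_finite[OF assms(1)]]
    by (simp add: block_lang_eq_path_lang)
  then show "(center (block_lang A F) :: ('a list list \<Rightarrow>\<^sub>0 'k) set)
      = lin_span {word_elt w | w. w \<in> block_lang A F \<and>
          two_sided_unextendable (block_letters A F) (block_lang A F) w}"
    unfolding block_lang_eq_path_lang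
    by (rule center_path_lang_noncyclic) (use acyclic in \<open>simp add: cycle_on_iff_cyclic_listing\<close>)
next
  fix \<omega>s assume "cyclic_listing (block_letters A F) \<omega>s"
  then interpret cycle "block_letters A F" follows \<omega>s
    by unfold_locales (simp add: cycle_on_iff_cyclic_listing)
  show "(center (block_lang A F) :: ('a list list \<Rightarrow>\<^sub>0 'k) set)
      = {\<Sum>i<length \<omega>s. poly_eval (block_lang A F) f (word_elt (rotate i \<omega>s)) | f. poly f 0 = 0}"
    unfolding block_lang_eq_path_lang center_cycle rot_sum_def ..
  show "iso_polys_zero_const (block_lang A F)
      (center (block_lang A F) :: ('a list list \<Rightarrow>\<^sub>0 'k) set)"
    unfolding block_lang_eq_path_lang by (rule center_cycle_iso)
next
  assume "max_length F \<ge> 2" "alg_irreducible (block_lang A F)"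
  then show "(three_center (block_lang A F) :: ('a list list \<Rightarrow>\<^sub>0 'k) set)
      = lin_span {word_elt w | w. w \<in> block_lang A F \<and> property_Delta A F w}"
    by (rule three_center_block_lang[OF assms(1)])
next
  assume "\<exists>a. block_letters A F = {replicate (max_length F) a}"
  then obtain a where "block_letters A F = {replicate (max_length F) a}" ..
  \<comment> \<open>The only block letter is a loop, so the results on cycles apply with
    \<open>n = 1\<close>.\<close>
  then have "cycle_on (block_letters A F) follows [replicate (max_length F) a]"
    by (simp add: cycle_on_def butlast_replicate tl_replicate)
  then interpret cycle "block_letters A F" follows "[replicate (max_length F) a]"
    by (rule cycle.intro)
  have n: "n = 1" by (simp add: n_def)
  show "(three_center (block_lang A F) :: ('a list list \<Rightarrow>\<^sub>0 'k) set) = lang_alg (block_lang A F)"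
    "iso_polys_zero_const (block_lang A F)
      (three_center (block_lang A F) :: ('a list list \<Rightarrow>\<^sub>0 'k) set)"
    using center_cycle_iso[where 'k = 'k]
    unfolding block_lang_eq_path_lang three_center_loop[OF n] center_loop[OF n] by simp_all
qed

end
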